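(* Let $n,m$ be positive integers, let $\rho$ be a rational representation of $GL(n,\mathbb{C})$ on a finite dimensional complex vector space $V_\rho$, and let $\mathcal{M}$ be a positive definite symmetric half-integral matrix of degree $m$. Put $S:=(2\mathcal{M})^{-1}$, let $V_\tau\neq 0$ be an irreducible $GL(n,\mathbb{C})$-invariant subspace of the space $\mathcal{H}_{m,n}$ of polynomials on $\mathbb{C}^{(m,n)}$ that are pluriharmonic with respect to $S$, where $GL(n,\mathbb{C})$ acts by $(\tau(A)P)(W)=P(WA)$, and let $\hat\tau$ be the representation of $GL(n,\mathbb{C})$ on $V_\tau^*$ defined by $(\hat\tau(A)^{-1}\zeta)(P)=\zeta(\tau({}^tA^{-1})P)$. Let $f\in J_{\rho,\mathcal{M}}(\Gamma_n)$ be a Jacobi form of index $\mathcal{M}$ with respect to $\rho$ on $\Gamma_n$, and define $f_\tau:H_n\to V_\tau^*\otimes V_\rho=\mathrm{Hom}(V_\tau,V_\rho)$ by $$(f_\tau(Z))(P):=P(\partial_W)f(Z,W)\Big|_{W=0},\qquad Z\in H_n,\ P\in V_\tau .$$ Then $f_\tau$ is a modular form of type $\hat\tau\otimes\rho$ on $\Gamma_n$, i.e. $f_\tau\in[\Gamma_n,\hat\tau\otimes\rho]$.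
   Context: Notation. $F^{(k,l)}$ is the set of $k\times l$ matrices with entries in a commutative ring $F$; ${}^tA$ is the transpose and $\sigma(A)$ the trace of $A$; $B[A]:={}^tABA$; $E_n$ is the identity matrix of degree $n$. $H_n=\{Z\in\mathbb{C}^{(n,n)}: Z={}^tZ,\ \mathrm{Im}\,Z>0\}$, $H_{n,m}:=H_n\times\mathbb{C}^{(m,n)}$. $Sp(n,\mathbb{R})=\{M\in\mathbb{R}^{(2n,2n)}:{}^tMJ_nM=J_n\}$ with $J_n=\begin{pmatrix}0&E_n\\-E_n&0\end{pmatrix}$, $\Gamma_n=Sp(n,\mathbb{Z})$. For $M=\begin{pmatrix}A&B\\C&D\end{pmatrix}\in Sp(n,\mathbb{R})$ and $Z\in H_n$, $M<Z>:=(AZ+B)(CZ+D)^{-1}$. Jacobi group. The Heisenberg group $H_{\mathbb{R}}^{(n,m)}$ consists of triples $(\lambda,\mu,\kappa)$ with $\lambda,\mu\in\mathbb{R}^{(m,n)}$, $\kappa\in\mathbb{R}^{(m,m)}$, $\kappa+\mu\,{}^t\lambda$ symmetric; $H_{\mathbb{Z}}^{(n,m)}$ is the subset with $\lambda,\mu,\kappa$ integral. The Jacobi group is $G^J=Sp(n,\mathbb{R})\ltimes H_{\mathbb{R}}^{(n,m)}$ with multiplication $$(M,(\lambda,\mu,\kappa))\cdot(M',(\lambda',\mu',\kappa'))=(MM',(\tilde\lambda+\lambda',\tilde\mu+\mu',\kappa+\kappa'+\tilde\lambda\,{}^t\mu'-\tilde\mu\,{}^t\lambda')),\quad (\tilde\lambda,\tilde\mu):=(\lambda,\mu)M',$$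 and $\Gamma_n^J:=\Gamma_n\ltimes H_{\mathbb{Z}}^{(n,m)}$. Jacobi forms. For $f\in C^\infty(H_{n,m},V_\rho)$ and $(M,(\lambda,\mu,\kappa))\in G^J$ with $M=\begin{pmatrix}A&B\\C&D\end{pmatrix}$, define $$(f|_{\rho,\mathcal{M}}[(M,(\lambda,\mu,\kappa))])(Z,W):=e^{-2\pi i\sigma(\mathcal{M}[W+\lambda Z+\mu](CZ+D)^{-1}C)}\,e^{2\pi i\sigma(\mathcal{M}(\lambda Z\,{}^t\lambda+2\lambda\,{}^tW+(\kappa+\mu\,{}^t\lambda)))}\,\rho(CZ+D)^{-1}f(M<Z>,(W+\lambda Z+\mu)(CZ+D)^{-1}).$$ $J_{\rho,\mathcal{M}}(\Gamma_n)$ is the space of holomorphic functions $f:H_{n,m}\to V_\rho$ such that (A) $f|_{\rho,\mathcal{M}}[\tilde\gamma]=f$ for all $\tilde\gamma\in\Gamma_n^J$; (B) $f$ has a Fourier expansion $f(Z,W)=\sum_{T\ge 0\ \text{half-integral}}\ \sum_{R\in\mathbb{Z}^{(n,m)}}c(T,R)\,e^{2\pi i\sigma(TZ)}e^{2\pi i\sigma(RW)}$ with $c(T,R)\neq0$ only if $\begin{pmatrix}T&\frac12R\\ \frac12{}^tR&\mathcal{M}\end{pmatrix}\ge0$ (for $n\ge2$ condition (B) is automatic). A symmetric matrix is half-integral if its diagonal entries are integers and its off-diagonal entries are in $\frac12\mathbb{Z}$. Pluriharmonic polynomials. For a polynomial $P$ in the entries of $W=(W_{kl})\in\mathbb{C}^{(m,n)}$,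 $P(\partial_W):=P\left(\frac{\partial}{\partial W_{11}},\dots,\frac{\partial}{\partial W_{mn}}\right)$. For a positive definite symmetric rational matrix $S$ of degree $m$ with inverse $S^{-1}=(t_{pq})$, $P$ is pluriharmonic with respect to $S$ if $\sum_{p,q=1}^m t_{pq}\frac{\partial^2P}{\partial W_{pi}\partial W_{qj}}=0$ for all $1\le i,j\le n$. (The space of such $P$ is invariant under $P(W)\mapsto P(WA)$, $A\in GL(n,\mathbb{C})$.) Modular forms. For a rational representation $\pi$ of $GL(n,\mathbb{C})$ on a finite dimensional space $V_\pi$, a holomorphic function $g:H_n\to V_\pi$ is a modular form of type $\pi$ on $\Gamma_n$ if $g(M<Z>)=\pi(CZ+D)g(Z)$ for all $Z\in H_n$ and all $M=\begin{pmatrix}A&B\\C&D\end{pmatrix}\in\Gamma_n$; if $n=1$ one requires additionally that $g$ be holomorphic at the cusp, i.e. that $g$ has a Fourier expansion $g(Z)=\sum_{t\ge0}a(t)e^{2\pi i tZ}$ with $t$ running over non-negative integers. $[\Gamma_n,\pi]$ is the vector space of these modular forms. *)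

theory Defs
  imports
    "HOL-Analysis.Analysis"
    "HOL-Library.Poly_Mapping"
    "HOL-Library.Function_Algebras"
begin

text \<open>
  A \<open>k \<times> l\<close> matrix has type \<open>'a ^ 'l ^ 'k\<close>, with the column index first. The types
  \<open>'n\<close> and \<open>'m\<close> index \<open>1..n\<close> and \<open>1..m\<close>, so that \<open>\<complex>\<close>-valued
  \<open>m \<times> n\<close> matrices have type \<open>complex ^ 'n ^ 'm\<close>.
\<close>

section \<open>Matrices\<close>

abbreviation cmat :: "real ^ 'l ^ 'k \<Rightarrow> complex ^ 'l ^ 'k" where
  "cmat A \<equiv> map_matrix complex_of_real A"

definition mscale :: "complex \<Rightarrow> complex ^ 'l ^ 'k \<Rightarrow> complex ^ 'l ^ 'k" where
  "mscale c A = map_matrix (\<lambda>a. c * a) A"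

text \<open>\<open>B[A]\<close>\<close>

definition quad :: "complex ^ 'm ^ 'm \<Rightarrow> complex ^ 'n ^ 'm \<Rightarrow> complex ^ 'n ^ 'n" where
  "quad B A = transpose A ** B ** A"

definition pos_def :: "real ^ 'n ^ 'n \<Rightarrow> bool" where
  "pos_def A \<longleftrightarrow> transpose A = A \<and> (\<forall>x. x \<noteq> 0 \<longrightarrow> x \<bullet> (A *v x) > 0)"

definition pos_semidef :: "real ^ 'n ^ 'n \<Rightarrow> bool" where
  "pos_semidef A \<longleftrightarrow> transpose A = A \<and> (\<forall>x. x \<bullet> (A *v x) \<ge> 0)"

definition half_integral :: "real ^ 'n ^ 'n \<Rightarrow> bool" where
  "half_integral A \<longleftrightarrow> transpose A = A \<and> (\<forall>i. A $ i $ i \<in> \<int>) \<and> (\<forall>i j. 2 * A $ i $ j \<in> \<int>)"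

definition integral_mat :: "real ^ 'l ^ 'k \<Rightarrow> bool" where
  "integral_mat A \<longleftrightarrow> (\<forall>i j. A $ i $ j \<in> \<int>)"

definition block_mat ::
  "'a ^ 'n ^ 'n \<Rightarrow> 'a ^ 'm ^ 'n \<Rightarrow> 'a ^ 'n ^ 'm \<Rightarrow> 'a ^ 'm ^ 'm \<Rightarrow> 'a ^ ('n + 'm) ^ ('n + 'm)"
where
  "block_mat A B C D = (\<chi> i j. case i of
      Inl a \<Rightarrow> (case j of Inl b \<Rightarrow> A $ a $ b | Inr b \<Rightarrow> B $ a $ b)
    | Inr a \<Rightarrow> (case j of Inl b \<Rightarrow> C $ a $ b | Inr b \<Rightarrow> D $ a $ b))"

definition blkA :: "'a ^ ('n + 'n) ^ ('n + 'n) \<Rightarrow> 'a ^ 'n ^ 'n" where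
  "blkA M = (\<chi> i j. M $ Inl i $ Inl j)"
definition blkB :: "'a ^ ('n + 'n) ^ ('n + 'n) \<Rightarrow> 'a ^ 'n ^ 'n" where
  "blkB M = (\<chi> i j. M $ Inl i $ Inr j)"
definition blkC :: "'a ^ ('n + 'n) ^ ('n + 'n) \<Rightarrow> 'a ^ 'n ^ 'n" where
  "blkC M = (\<chi> i j. M $ Inr i $ Inl j)"
definition blkD :: "'a ^ ('n + 'n) ^ ('n + 'n) \<Rightarrow> 'a ^ 'n ^ 'n" where
  "blkD M = (\<chi> i j. M $ Inr i $ Inr j)"


section \<open>Siegel upper half space, symplectic group, Jacobi modular group\<close>

definition siegel :: "(complex ^ 'n ^ 'n) set" where
  "siegel = {Z. transpose Z = Z \<and> pos_def (map_matrix Im Z)}"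

definition Jmat :: "real ^ ('n::finite + 'n) ^ ('n + 'n)" where
  "Jmat = block_mat 0 (mat 1) (- mat 1) 0"

definition Sp_real :: "(real ^ ('n::finite + 'n) ^ ('n + 'n)) set" where
  "Sp_real = {M. transpose M ** Jmat ** M = Jmat}"

definition Gamma :: "(real ^ ('n::finite + 'n) ^ ('n + 'n)) set" where
  "Gamma = {M \<in> Sp_real. integral_mat M}"

definition autfac :: "real ^ ('n::finite + 'n) ^ ('n + 'n) \<Rightarrow> complex ^ 'n ^ 'n \<Rightarrow> complex ^ 'n ^ 'n" where
  "autfac M Z = cmat (blkC M) ** Z + cmat (blkD M)"

definition moebius :: "real ^ ('n::finite + 'n) ^ ('n + 'n) \<Rightarrow> complex ^ 'n ^ 'n \<Rightarrow> complex ^ 'n ^ 'n" where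
  "moebius M Z = (cmat (blkA M) ** Z + cmat (blkB M)) ** matrix_inv (autfac M Z)"

definition Heis_real :: "((real ^ 'n ^ 'm) \<times> (real ^ 'n ^ 'm) \<times> (real ^ 'm ^ 'm)) set" where
  "Heis_real = {(lam, mu, kap). transpose (kap + mu ** transpose lam) = kap + mu ** transpose lam}"

definition Heis_int :: "((real ^ 'n ^ 'm) \<times> (real ^ 'n ^ 'm) \<times> (real ^ 'm ^ 'm)) set" where
  "Heis_int = {(lam, mu, kap) \<in> Heis_real. integral_mat lam \<and> integral_mat mu \<and> integral_mat kap}"

text \<open>Underlying set of the semidirect product; its group law is not needed below.\<close>

definition Gamma_J ::
  "((real ^ ('n::finite + 'n) ^ ('n + 'n)) \<times> (real ^ 'n ^ 'm) \<times> (real ^ 'n ^ 'm) \<times> (real ^ 'm ^ 'm)) set"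
where
  "Gamma_J = Gamma \<times> Heis_int"


section \<open>Finite dimensional complex vector spaces\<close>

text \<open>
  A finite dimensional complex vector space is a finitely spanned subspace \<open>V\<close> of a type
  \<open>'v\<close> with scalar multiplication \<open>sm\<close>. Linear maps out of \<open>V\<close> are extended
  by \<open>0\<close>, so that \<open>hom_space\<close> is a subspace of the function type.
\<close>

definition findim_space :: "(complex \<Rightarrow> 'v::ab_group_add \<Rightarrow> 'v) \<Rightarrow> 'v set \<Rightarrow> bool" where
  "findim_space sm V \<longleftrightarrow>
     vector_space sm \<and> (\<exists>B. finite B \<and> V = module.span sm B)"

definition linear_on ::
  "(complex \<Rightarrow> 'v::ab_group_add \<Rightarrow> 'v) \<Rightarrow> 'v set \<Rightarrow>
   (complex \<Rightarrow> 'w::ab_group_add \<Rightarrow> 'w) \<Rightarrow> 'w set \<Rightarrow> ('v \<Rightarrow> 'w) \<Rightarrow> bool"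
where
  "linear_on s1 V s2 W h \<longleftrightarrow>
     (\<forall>x\<in>V. h x \<in> W) \<and>
     (\<forall>x\<in>V. \<forall>y\<in>V. h (x + y) = h x + h y) \<and>
     (\<forall>c. \<forall>x\<in>V. h (s1 c x) = s2 c (h x))"

definition hom_space ::
  "(complex \<Rightarrow> 'v::ab_group_add \<Rightarrow> 'v) \<Rightarrow> 'v set \<Rightarrow>
   (complex \<Rightarrow> 'w::ab_group_add \<Rightarrow> 'w) \<Rightarrow> 'w set \<Rightarrow> ('v \<Rightarrow> 'w) set"
where
  "hom_space s1 V s2 W = {h. linear_on s1 V s2 W h \<and> (\<forall>x. x \<notin> V \<longrightarrow> h x = 0)}"

definition dual_space ::
  "(complex \<Rightarrow> 'v::ab_group_add \<Rightarrow> 'v) \<Rightarrow> 'v set \<Rightarrow> ('v \<Rightarrow> complex) set"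
where
  "dual_space sm V = hom_space sm V (*) UNIV"

definition fun_scale :: "(complex \<Rightarrow> 'w \<Rightarrow> 'w) \<Rightarrow> complex \<Rightarrow> ('v \<Rightarrow> 'w) \<Rightarrow> 'v \<Rightarrow> 'w" where
  "fun_scale sm c h = (\<lambda>x. sm c (h x))"

text \<open>
  \<open>V*\<otimes>W = Hom(V, W)\<close> through \<open>(\<zeta> \<otimes> w)(x) = \<zeta>(x) w\<close>; a representation \<open>\<pi>\<close>
  on \<open>V*\<close> and a representation \<open>\<rho>\<close> on \<open>W\<close> give \<open>\<pi> \<otimes> \<rho>\<close>, which is determined by its
  values on the pure tensors, as these span \<open>Hom(V, W)\<close> for finite dimensional \<open>V\<close>.
\<close>

definition pure_tensor :: "(complex \<Rightarrow> 'w \<Rightarrow> 'w) \<Rightarrow> ('v \<Rightarrow> complex) \<Rightarrow> 'w \<Rightarrow> 'v \<Rightarrow> 'w" where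
  "pure_tensor s2 \<zeta> w = (\<lambda>x. s2 (\<zeta> x) w)"

definition tensor_rep ::
  "(complex \<Rightarrow> 'v::ab_group_add \<Rightarrow> 'v) \<Rightarrow> 'v set \<Rightarrow>
   (complex \<Rightarrow> 'w::ab_group_add \<Rightarrow> 'w) \<Rightarrow> 'w set \<Rightarrow>
   ('g \<Rightarrow> ('v \<Rightarrow> complex) \<Rightarrow> ('v \<Rightarrow> complex)) \<Rightarrow> ('g \<Rightarrow> 'w \<Rightarrow> 'w) \<Rightarrow>
   'g \<Rightarrow> ('v \<Rightarrow> 'w) \<Rightarrow> ('v \<Rightarrow> 'w)"
where
  "tensor_rep s1 V s2 W \<pi> \<rho> g =
     (THE L. L \<in> hom_space (fun_scale s2) (hom_space s1 V s2 W) (fun_scale s2) (hom_space s1 V s2 W) \<and>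
        (\<forall>\<zeta>\<in>dual_space s1 V. \<forall>w\<in>W.
           L (pure_tensor s2 \<zeta> w) = pure_tensor s2 (\<pi> g \<zeta>) (\<rho> g w)))"


section \<open>Analysis with values in finite dimensional spaces\<close>

text \<open>
  Holomorphy, sums and derivatives of \<open>V\<close>-valued functions are tested on linear functionals,
  equivalently on coordinates. The derivative is a Frechet derivative within \<open>D\<close>, as \<open>siegel\<close>
  is open only in the space of symmetric matrices; \<open>dsm\<close> is the multiplication by complex
  scalars on the domain.
\<close>

definition holomorphic_into ::
  "(complex \<Rightarrow> 'a \<Rightarrow> 'a) \<Rightarrow> (complex \<Rightarrow> 'v::ab_group_add \<Rightarrow> 'v) \<Rightarrow> 'v set \<Rightarrow>
   'a::real_normed_vector set \<Rightarrow> ('a \<Rightarrow> 'v) \<Rightarrow> bool"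
where
  "holomorphic_into dsm sm V D f \<longleftrightarrow>
     (\<forall>x\<in>D. f x \<in> V) \<and>
     (\<forall>l\<in>dual_space sm V. \<forall>x\<in>D. \<exists>L.
        ((\<lambda>y. l (f y)) has_derivative L) (at x within D) \<and> (\<forall>c v. L (dsm c v) = c * L v))"

definition has_sum_into ::
  "(complex \<Rightarrow> 'v::ab_group_add \<Rightarrow> 'v) \<Rightarrow> 'v set \<Rightarrow> ('i \<Rightarrow> 'v) \<Rightarrow> 'v \<Rightarrow> 'i set \<Rightarrow> bool"
where
  "has_sum_into sm V F v X \<longleftrightarrow> (\<forall>l\<in>dual_space sm V. ((\<lambda>x. l (F x)) has_sum l v) X)"


section \<open>Polynomials in the entries of a matrix\<close>

text \<open>The variable \<open>W\<^sub>k\<^sub>l\<close> is indexed by \<open>(k, l)\<close>.\<close>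

type_synonym 'i cpoly = "('i \<Rightarrow>\<^sub>0 nat) \<Rightarrow>\<^sub>0 complex"

definition pconst :: "complex \<Rightarrow> 'i cpoly" where
  "pconst c = Poly_Mapping.single 0 c"

definition pvar :: "'i \<Rightarrow> 'i cpoly" where
  "pvar i = Poly_Mapping.single (Poly_Mapping.single i 1) 1"

definition pscale :: "complex \<Rightarrow> 'i cpoly \<Rightarrow> 'i cpoly" where
  "pscale c P = pconst c * P"

definition peval :: "(complex \<Rightarrow> 'r) \<Rightarrow> ('i::finite \<Rightarrow> 'r) \<Rightarrow> 'i cpoly \<Rightarrow> 'r::comm_ring_1" where
  "peval h x P = (\<Sum>\<alpha>\<in>Poly_Mapping.keys P.
      h (Poly_Mapping.lookup P \<alpha>) * (\<Prod>i\<in>UNIV. x i ^ Poly_Mapping.lookup \<alpha> i))"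

definition poly_fun :: "('m::finite \<times> 'n::finite) cpoly \<Rightarrow> complex ^ 'n ^ 'm \<Rightarrow> complex" where
  "poly_fun P W = peval (\<lambda>c. c) (\<lambda>(k, l). W $ k $ l) P"

text \<open>\<open>(\<tau>(A)P)(W) = P(WA)\<close>, by substitution of the entries of \<open>WA\<close> for the variables\<close>

definition tau :: "complex ^ 'n ^ 'n \<Rightarrow> ('m::finite \<times> 'n::finite) cpoly \<Rightarrow> ('m \<times> 'n) cpoly" where
  "tau A P = peval pconst (\<lambda>(k, l). \<Sum>j\<in>UNIV. pvar (k, j) * pconst (A $ j $ l)) P"

definition partial ::
  "'m \<times> 'n \<Rightarrow> (complex ^ 'n ^ 'm \<Rightarrow> complex) \<Rightarrow> complex ^ 'n ^ 'm \<Rightarrow> complex"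
where
  "partial i g W = deriv (\<lambda>z. g (W + (\<chi> k l. if (k, l) = i then z else 0))) 0"

text \<open>
  The variables are enumerated in an arbitrary order, which does not matter for holomorphic
  functions.
\<close>

definition mixed_partial ::
  "(('m \<times> 'n) \<Rightarrow>\<^sub>0 nat) \<Rightarrow> (complex ^ 'n ^ 'm \<Rightarrow> complex) \<Rightarrow> complex ^ 'n ^ 'm \<Rightarrow> complex"
where
  "mixed_partial \<alpha> =
     foldr (\<lambda>i. partial i ^^ Poly_Mapping.lookup \<alpha> i) (SOME is. distinct is \<and> set is = UNIV)"

text \<open>\<open>P(\<partial>\<^sub>W)\<close>\<close>

definition diff_op ::
  "('m::finite \<times> 'n::finite) cpoly \<Rightarrow> (complex ^ 'n ^ 'm \<Rightarrow> complex) \<Rightarrow> complex ^ 'n ^ 'm \<Rightarrow> complex"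
where
  "diff_op P g W =
     (\<Sum>\<alpha>\<in>Poly_Mapping.keys P. Poly_Mapping.lookup P \<alpha> * mixed_partial \<alpha> g W)"

definition diff_op_into ::
  "(complex \<Rightarrow> 'v::ab_group_add \<Rightarrow> 'v) \<Rightarrow> 'v set \<Rightarrow>
   ('m::finite \<times> 'n::finite) cpoly \<Rightarrow> (complex ^ 'n ^ 'm \<Rightarrow> 'v) \<Rightarrow> complex ^ 'n ^ 'm \<Rightarrow> 'v"
where
  "diff_op_into sm V P g W =
     (THE v. v \<in> V \<and> (\<forall>l\<in>dual_space sm V. l v = diff_op P (\<lambda>X. l (g X)) W))"

definition pluriharmonic :: "real ^ 'm ^ 'm \<Rightarrow> ('m::finite \<times> 'n::finite) cpoly set" where
  "pluriharmonic S = {P. \<forall>i j W.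
     (\<Sum>p\<in>UNIV. \<Sum>q\<in>UNIV. complex_of_real (matrix_inv S $ p $ q) *
        partial (p, i) (partial (q, j) (poly_fun P)) W) = 0}"

definition invariant_subspace :: "('m::finite \<times> 'n::finite) cpoly set \<Rightarrow> bool" where
  "invariant_subspace V \<longleftrightarrow>
     module.subspace pscale V \<and> (\<forall>A. invertible A \<longrightarrow> (\<forall>P\<in>V. tau A P \<in> V))"

definition irreducible_subspace :: "('m::finite \<times> 'n::finite) cpoly set \<Rightarrow> bool" where
  "irreducible_subspace V \<longleftrightarrow> invariant_subspace V \<and> V \<noteq> {0} \<and>
     (\<forall>U. invariant_subspace U \<and> U \<subseteq> V \<longrightarrow> U = {0} \<or> U = V)"

text \<open>
  \<open>\<tau>^(A)\<close> on \<open>V*\<close> is the inverse of the operator \<open>\<zeta> \<mapsto> \<zeta> \<circ> \<tau>(\<^sup>tA\<^sup>-\<^sup>1)\<close>.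
\<close>

definition tau_hat ::
  "('m::finite \<times> 'n::finite) cpoly set \<Rightarrow> complex ^ 'n ^ 'n \<Rightarrow>
   (('m \<times> 'n) cpoly \<Rightarrow> complex) \<Rightarrow> (('m \<times> 'n) cpoly \<Rightarrow> complex)"
where
  "tau_hat V A = inv_into (dual_space pscale V)
     (\<lambda>\<zeta> P. if P \<in> V then \<zeta> (tau (transpose (matrix_inv A)) P) else 0)"


section \<open>Representations, modular forms and Jacobi forms\<close>

definition rational_rep ::
  "(complex \<Rightarrow> 'v::ab_group_add \<Rightarrow> 'v) \<Rightarrow> 'v set \<Rightarrow> (complex ^ 'n ^ 'n \<Rightarrow> 'v \<Rightarrow> 'v) \<Rightarrow> bool"
where
  "rational_rep sm V \<rho> \<longleftrightarrow>
     findim_space sm V \<and>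
     (\<forall>A. invertible A \<longrightarrow> linear_on sm V sm V (\<rho> A)) \<and>
     (\<forall>v\<in>V. \<rho> (mat 1) v = v) \<and>
     (\<forall>A B. invertible A \<longrightarrow> invertible B \<longrightarrow> (\<forall>v\<in>V. \<rho> (A ** B) v = \<rho> A (\<rho> B v))) \<and>
     (\<forall>v\<in>V. \<forall>l\<in>dual_space sm V. \<exists>p q :: ('n \<times> 'n) cpoly. \<forall>A. invertible A \<longrightarrow>
        poly_fun q A \<noteq> 0 \<and> l (\<rho> A v) = poly_fun p A / poly_fun q A)"

text \<open>
  \<open>[\<Gamma>\<^sub>n, \<pi>]\<close>, for \<open>\<pi>\<close> on \<open>V\<close>. For \<open>n = 1\<close>, \<open>trace Z\<close> is the only entry of \<open>Z\<close>.
\<close>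

definition modular_forms ::
  "(complex \<Rightarrow> 'v::ab_group_add \<Rightarrow> 'v) \<Rightarrow> 'v set \<Rightarrow>
   (complex ^ 'n ^ 'n \<Rightarrow> 'v \<Rightarrow> 'v) \<Rightarrow> (complex ^ 'n::finite ^ 'n \<Rightarrow> 'v) set"
where
  "modular_forms sm V \<pi> = {g.
     holomorphic_into mscale sm V siegel g \<and>
     (\<forall>Z\<in>siegel. \<forall>M\<in>Gamma. g (moebius M Z) = \<pi> (autfac M Z) (g Z)) \<and>
     (CARD('n) = 1 \<longrightarrow> (\<exists>a :: nat \<Rightarrow> 'v. (\<forall>t. a t \<in> V) \<and>
        (\<forall>Z\<in>siegel. has_sum_into sm V
           (\<lambda>t. sm (exp (2 * pi * \<i> * of_nat t * trace Z)) (a t)) (g Z) UNIV)))}"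

definition slash ::
  "(complex \<Rightarrow> 'v \<Rightarrow> 'v) \<Rightarrow> (complex ^ 'n ^ 'n \<Rightarrow> 'v \<Rightarrow> 'v) \<Rightarrow> real ^ 'm ^ 'm \<Rightarrow>
   ((complex ^ 'n ^ 'n) \<times> (complex ^ 'n ^ 'm) \<Rightarrow> 'v) \<Rightarrow>
   (real ^ ('n::finite + 'n) ^ ('n + 'n)) \<times> (real ^ 'n ^ 'm) \<times> (real ^ 'n ^ 'm) \<times> (real ^ 'm ^ 'm) \<Rightarrow>
   (complex ^ 'n ^ 'n) \<times> (complex ^ 'n ^ 'm) \<Rightarrow> 'v"
where
  "slash sm \<rho> MM f = (\<lambda>(M, lam, mu, kap) (Z, W).
     let X = W + cmat lam ** Z + cmat mu; Y = matrix_inv (autfac M Z) in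
     sm
       (exp (- 2 * pi * \<i> * trace (quad (cmat MM) X ** Y ** cmat (blkC M))) *
        exp (2 * pi * \<i> * trace (cmat MM **
          (cmat lam ** Z ** transpose (cmat lam) + 2 *\<^sub>R (cmat lam ** transpose W) +
           (cmat kap + cmat mu ** transpose (cmat lam))))))
       (\<rho> Y (f (moebius M Z, X ** Y))))"

definition jacobi_forms ::
  "(complex \<Rightarrow> 'v::ab_group_add \<Rightarrow> 'v) \<Rightarrow> 'v set \<Rightarrow>
   (complex ^ 'n ^ 'n \<Rightarrow> 'v \<Rightarrow> 'v) \<Rightarrow> real ^ 'm ^ 'm \<Rightarrow>
   ((complex ^ 'n::finite ^ 'n) \<times> (complex ^ 'n ^ 'm) \<Rightarrow> 'v) set"
where
  "jacobi_forms sm V \<rho> MM = {f.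
     holomorphic_into (\<lambda>c (Z, W). (mscale c Z, mscale c W)) sm V (siegel \<times> UNIV) f \<and>
     (\<forall>\<gamma>\<in>Gamma_J. \<forall>x\<in>siegel \<times> UNIV. slash sm \<rho> MM f \<gamma> x = f x) \<and>
     (\<exists>c :: real ^ 'n ^ 'n \<Rightarrow> int ^ 'm ^ 'n \<Rightarrow> 'v.
        (\<forall>T R. c T R \<in> V) \<and>
        (\<forall>T R. c T R \<noteq> 0 \<longrightarrow>
           pos_semidef (block_mat T ((1/2) *\<^sub>R map_matrix real_of_int R)
             ((1/2) *\<^sub>R transpose (map_matrix real_of_int R)) MM)) \<and>
        (\<forall>Z\<in>siegel. \<forall>W. has_sum_into sm V
           (\<lambda>(T, R). sm (exp (2 * pi * \<i> * trace (cmat T ** Z)) *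
                             exp (2 * pi * \<i> * trace (map_matrix of_int R ** W))) (c T R))
           (f (Z, W)) ({T. half_integral T \<and> pos_semidef T} \<times> UNIV)))}"

definition f_tau ::
  "(complex \<Rightarrow> 'v::ab_group_add \<Rightarrow> 'v) \<Rightarrow> 'v set \<Rightarrow> ('m::finite \<times> 'n::finite) cpoly set \<Rightarrow>
   ((complex ^ 'n ^ 'n) \<times> (complex ^ 'n ^ 'm) \<Rightarrow> 'v) \<Rightarrow>
   complex ^ 'n ^ 'n \<Rightarrow> ('m \<times> 'n) cpoly \<Rightarrow> 'v"
where
  "f_tau sm V V\<tau> f Z P =
     (if P \<in> V\<tau> then diff_op_into sm V P (\<lambda>W. f (Z, W)) 0 else 0)"

end

theory Submission
  imports Defs "HOL-Complex_Analysis.Cauchy_Integral_Formula"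
begin

text \<open>
  Fix \<open>M = (A, B; C, D) \<in> \<Gamma>\<^sub>n\<close> and \<open>P \<in> V\<^sub>\<tau>\<close>, and write \<open>Y = CZ + D\<close>. The transformation law of \<open>f\<close> under
  \<open>(M, (0, 0, 0))\<close> reads \<open>f(M<Z>, W) = exp(Q(W)) \<rho>(Y) f(Z, WY)\<close> with
  \<open>Q(W) = 2 \<pi> i \<sigma>(\<M>[W] C \<^sup>tY)\<close> (\<open>jacobi_transform\<close>). Applying \<open>P(\<partial>\<^sub>W)\<close> at \<open>W = 0\<close>, two things
  happen.

  The factor \<open>exp Q\<close> disappears. Commuting \<open>P(\<partial>)\<close> with the multiplication by a coordinate
  differentiates \<open>P\<close>, so at the origin multiplication by \<open>W\<^sub>a\<close> is adjoint to \<open>\<partial>\<^sub>a\<close> acting on \<open>P\<close>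
  (\<open>diff_op_coord_mult\<close>). Hence \<open>P(\<partial>)(Q g)(0) = (Q(\<partial>)P)(\<partial>)g(0)\<close>, and \<open>Q(\<partial>)P = 0\<close> because \<open>P\<close> is
  pluriharmonic with respect to \<open>(2\<M>)\<^sup>-\<^sup>1\<close> and \<open>Q\<close> is a combination of the forms
  \<open>\<Sum> \<M>\<^sub>p\<^sub>q W\<^sub>p\<^sub>i W\<^sub>q\<^sub>j\<close> (\<open>diff_op_harmonic\<close>). As \<open>exp Q = 1 + Q \<phi>(Q)\<close> with \<open>\<phi>\<close> entire, only the constant
  term \<open>1\<close> contributes (\<open>diff_op_exp_mult\<close>).

  The substitution \<open>W \<mapsto> WY\<close> becomes \<open>\<tau>(\<^sup>tY)\<close>. On an exponential \<open>exp(\<langle>v, W\<rangle>)\<close> the operator \<open>P(\<partial>)\<close> is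
  multiplication by \<open>P(v)\<close>, and \<open>\<langle>v, WY\<rangle> = \<langle>v \<^sup>tY, W\<rangle>\<close>. Since \<open>f(Z, _)\<close> is a series of exponentials, by its
  Fourier expansion, and such series may be differentiated term by term (\<open>has_sum_diff_op\<close>), this settles
  the chain rule for all \<open>P\<close> at once (\<open>diff_op_comp_right_mult\<close>).

  Together, \<open>f\<^sub>\<tau>(M<Z>)(P) = \<rho>(Y) f\<^sub>\<tau>(Z)(\<tau>(\<^sup>tY)P)\<close>, which is the action of \<open>\<tau>^ \<otimes> \<rho>\<close> on
  \<open>Hom(V\<^sub>\<tau>, V\<^sub>\<rho>)\<close> (\<open>tau_hat_eq\<close>, \<open>tensor_rep_eq\<close>). The identification needs \<open>V\<^sub>\<tau>\<close> to be finite dimensional: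
  its elements of bounded degree form an invariant subspace, so irreducibility bounds the degree
  (\<open>irreducible_findim\<close>).

  Holomorphy of \<open>f\<^sub>\<tau>\<close> says that \<open>W\<close>-derivatives of a function holomorphic in \<open>(Z, W)\<close> are again
  holomorphic in \<open>(Z, W)\<close>. This follows from Cauchy's formula for a directional derivative by differentiation
  under the integral sign (\<open>holo_dir_deriv\<close>). For \<open>n \<ge> 2\<close> the Siegel half space has empty interior
  among all complex matrices, so \<open>f\<close> is first pulled back along \<open>Z \<mapsto> (Z + \<^sup>tZ)/2\<close> to an open set.

  For \<open>n = 1\<close>, differentiating the Fourier expansion of \<open>f\<close> term by term and summing over \<open>R\<close> for fixed
  \<open>T\<close> gives the expansion of \<open>f\<^sub>\<tau>\<close> at the cusp (\<open>f_tau_cusp\<close>).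

  All statements about \<open>V\<^sub>\<rho>\<close>-valued functions are reduced to scalar ones by the functionals in the
  dual space, which separate points (\<open>dual_separates\<close>).
\<close>

section \<open>Holomorphic functions of several variables\<close>

text \<open>
  The scalar multiplication \<open>sc\<close> is a parameter: vector spaces over \<open>\<complex>\<close> appear here as real Euclidean
  spaces, and both matrices and pairs of matrices are needed.
\<close>

definition holo ::
  "(complex \<Rightarrow> 'a \<Rightarrow> 'a) \<Rightarrow> 'a::real_normed_vector set \<Rightarrow> ('a \<Rightarrow> complex) \<Rightarrow> bool" where
  "holo sc U F \<longleftrightarrow> (\<forall>x\<in>U. \<exists>L. (F has_derivative L) (at x) \<and> (\<forall>c v. L (sc c v) = c * L v))"

definition dir_deriv ::
  "(complex \<Rightarrow> 'a \<Rightarrow> 'a) \<Rightarrow> 'a::real_normed_vector \<Rightarrow> ('a \<Rightarrow> complex) \<Rightarrow> 'a \<Rightarrow> complex" where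
  "dir_deriv sc v F x = deriv (\<lambda>z. F (x + sc z v)) 0"

lemma holo_along_line:
  assumes "(F has_derivative L) (at (x + sc z v))" and "\<forall>c v. L (sc c v) = c * L v"
    and "bounded_linear (\<lambda>c. sc c v)"
  shows "((\<lambda>z. F (x + sc z v)) has_field_derivative L v) (at z)"
proof -
  have "((\<lambda>z. x + sc z v) has_derivative (\<lambda>h. sc h v)) (at z)"
    by (auto intro!: derivative_eq_intros bounded_linear_imp_has_derivative assms(3))
  from diff_chain_at[OF this assms(1)] show ?thesis
    using assms(2) by (simp add: has_field_derivative_def o_def mult.commute[of _ "L v"])
qed

lemma dir_deriv_eq:
  assumes "(F has_derivative L) (at x)" and "\<forall>c v. L (sc c v) = c * L v"
    and "bounded_linear (\<lambda>c. sc c v)"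
  shows "dir_deriv sc v F x = L v"
proof -
  interpret bounded_linear "\<lambda>c. sc c v" by fact
  show ?thesis
    unfolding dir_deriv_def using holo_along_line[of F L x sc 0 v] assms by (simp add: zero DERIV_imp_deriv)
qed

lemma holo_imp_continuous_on:
  assumes "holo sc U F" shows "continuous_on U F"
  using assms unfolding holo_def
  by (meson continuous_at_imp_continuous_on has_derivative_continuous)

definition circ :: "real \<Rightarrow> real \<Rightarrow> complex" where
  "circ r t = of_real r * exp (2 * of_real pi * \<i> * of_real t)"

lemma norm_circ [simp]: "norm (circ r t) = \<bar>r\<bar>"
  by (simp add: circ_def norm_mult)

lemma continuous_circ [continuous_intros]: "continuous_on T (circ r)"
  unfolding circ_def by (intro continuous_intros)

text \<open>
  Cauchy's formula \<open>g'(0) = (2 \<pi> i)\<^sup>-\<^sup>1 \<integral> g(\<zeta>) \<zeta>\<^sup>-\<^sup>2 d\<zeta>\<close> on a circle, as an integral over \<open>[0, 1]\<close>.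
  In this form the rules for parameter integrals apply to it.
\<close>

lemma Cauchy_deriv_integral:
  assumes "g holomorphic_on ball 0 s" and "0 < r" "r < s"
  shows "deriv g 0 = integral {0..1} (\<lambda>t. g (circ r t) / circ r t)"
proof -
  have g: "continuous_on (cball 0 r) g" "g holomorphic_on ball 0 r"
    using assms by (auto intro: holomorphic_on_subset[OF assms(1)]
        intro!: holomorphic_on_imp_continuous_on)
  have vd: "vector_derivative (circlepath 0 r) (at t within {0..1}) = 2 * pi * \<i> * circlepath 0 r t"
    if "t \<in> {0..1}" for t
    using that by (subst vector_derivative_circlepath01) (auto simp: circlepath)
  have "((\<lambda>u. g u / (u-0) ^ (Suc 1)) has_contour_integral ((2 * pi * \<i>) / (fact 1) * (deriv ^^ 1) g 0))
           (circlepath 0 r)"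
    by (rule Cauchy_has_contour_integral_higher_derivative_circlepath[OF g]) (use assms in auto)
  hence "((\<lambda>t. g (circlepath 0 r t) / (circlepath 0 r t)^2 * (2 * pi * \<i> * circlepath 0 r t))
      has_integral (2 * pi * \<i> * deriv g 0)) {0..1}"
    unfolding has_contour_integral_def
    by (rule has_integral_eq_rhs[OF has_integral_eq[rotated]])
       (auto simp: vd power2_eq_square)
  hence "((\<lambda>t. 1 / (2 * pi * \<i>) * (g (circlepath 0 r t) / (circlepath 0 r t)^2 * (2 * pi * \<i> * circlepath 0 r t)))
      has_integral 1 / (2 * pi * \<i>) * (2 * pi * \<i> * deriv g 0)) {0..1}"
    by (rule has_integral_mult_right)
  hence "((\<lambda>t. g (circ r t) / circ r t) has_integral deriv g 0) {0..1}"
    by (rule has_integral_eq_rhs[OF has_integral_eq[rotated]])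
       (use assms in \<open>auto simp: circlepath circ_def power2_eq_square field_simps\<close>)
  thus ?thesis by (simp add: integral_unique)
qed

locale complex_scaling =
  fixes sc :: "complex \<Rightarrow> 'a::euclidean_space \<Rightarrow> 'a"
  assumes bounded_linear_scale: "bounded_linear (\<lambda>c. sc c v)"
begin

lemma scale_continuous: "continuous_on T f \<Longrightarrow> continuous_on T (\<lambda>x. sc (f x) v)"
  by (rule bounded_linear.continuous_on[OF bounded_linear_scale])

text \<open>
  The radius of the circle can be kept fixed while the base point varies in a small ball.
  The same ball and radius serve all holomorphic functions on \<open>U\<close>, so the formula can be applied to a function
  and to its derivatives simultaneously.
\<close>

lemma dir_deriv_integral_locally:
  assumes "open U" "x0 \<in> U"
  obtains e r where "e > 0" "r > 0"
    "\<And>x t. x \<in> ball x0 e \<Longrightarrow> x + sc (circ r t) v \<in> U"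
    "\<And>G x. holo sc U G \<Longrightarrow> x \<in> ball x0 e \<Longrightarrow>
       dir_deriv sc v G x = integral (cbox 0 1) (\<lambda>t. G (x + sc (circ r t) v) / circ r t)"
proof -
  obtain e where e: "e > 0" "ball x0 (2*e) \<subseteq> U"
    using assms open_contains_ball[of U]
    by (metis mult.commute nonzero_mult_div_cancel_right times_divide_eq_left zero_less_divide_iff zero_less_numeral zero_neq_numeral)
  obtain K where K: "K > 0" "\<And>c. norm (sc c v) \<le> norm c * K"
    using bounded_linear.pos_bounded[OF bounded_linear_scale] by blast
  define s where "s = e / K"
  have s: "s > 0" using e K by (simp add: s_def)
  have in_U: "x + sc z v \<in> U" if "x \<in> ball x0 e" "norm z < s" for x z
  proof -
    have "norm (sc z v) < e"
      using K(2)[of z] that(2) K(1) by (simp add: s_def field_simps)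
    hence "x + sc z v \<in> ball x0 (2*e)"
      using that(1) norm_triangle_ineq4[of "x0 - x" "sc z v"]
      by (simp add: dist_norm algebra_simps)
    thus ?thesis using e(2) by blast
  qed
  show thesis
  proof (rule that[of e "s/2"])
    show "e > 0" "s/2 > 0" using e s by auto
    show "x + sc (circ (s/2) t) v \<in> U" if "x \<in> ball x0 e" for x t
      by (rule in_U[OF that]) (use s in auto)
    fix G x assume G: "holo sc U G" and x: "x \<in> ball x0 e"
    have "(\<lambda>z. G (x + sc z v)) holomorphic_on ball 0 s"
    proof (rule holomorphic_onI)
      fix z assume "z \<in> ball (0::complex) s"
      hence "x + sc z v \<in> U" using in_U[OF x] by auto
      then obtain L where "(G has_derivative L) (at (x + sc z v))" "\<forall>c v. L (sc c v) = c * L v"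
        using G unfolding holo_def by blast
      from holo_along_line[OF this bounded_linear_scale]
      show "(\<lambda>z. G (x + sc z v)) field_differentiable at z within ball 0 s"
        using field_differentiable_def field_differentiable_at_within by blast
    qed
    from Cauchy_deriv_integral[OF this, of "s/2"] s
    show "dir_deriv sc v G x = integral (cbox 0 1) (\<lambda>t. G (x + sc (circ (s/2) t) v) / circ (s/2) t)"
      by (simp add: dir_deriv_def)
  qed
qed

lemma continuous_on_circle_family:
  assumes "continuous_on U G" "r > 0"
    "\<And>x t. x \<in> B \<Longrightarrow> x + sc (circ r t) v \<in> U"
  shows "continuous_on (B \<times> T) (\<lambda>(x, t). G (x + sc (circ r t) v) / circ r t)"
proof -
  have c: "continuous_on (B \<times> T) (\<lambda>p. circ r (snd p))"
    by (rule continuous_on_compose2[OF continuous_circ]) (auto intro!: continuous_intros)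
  have "continuous_on (B \<times> T) (\<lambda>p. G (fst p + sc (circ r (snd p)) v))"
    by (rule continuous_on_compose2[OF assms(1)])
       (use assms(3) in \<open>auto intro!: continuous_intros scale_continuous c\<close>)
  hence "continuous_on (B \<times> T) (\<lambda>p. G (fst p + sc (circ r (snd p)) v) / circ r (snd p))"
    by (rule continuous_on_divide[OF _ c]) (use assms(2) in \<open>auto simp: circ_def\<close>)
  thus ?thesis by (simp add: case_prod_unfold)
qed

text \<open>
  Complex differentiability at each point gives continuity of the derivative, because Cauchy's formula
  expresses the derivative by the values of the function, which is continuous.
\<close>

lemma continuous_on_dir_deriv:
  assumes "open U" "holo sc U F"
  shows "continuous_on U (dir_deriv sc v F)"
proof (rule continuous_at_imp_continuous_on, rule ballI)
  fix x0 assume "x0 \<in> U"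
  from dir_deriv_integral_locally[OF assms(1) this, of v] obtain e r where er: "e > 0" "r > 0"
    "\<And>x t. x \<in> ball x0 e \<Longrightarrow> x + sc (circ r t) v \<in> U"
    "\<And>G x. holo sc U G \<Longrightarrow> x \<in> ball x0 e \<Longrightarrow>
       dir_deriv sc v G x = integral (cbox 0 1) (\<lambda>t. G (x + sc (circ r t) v) / circ r t)"
    by blast
  have "continuous_on (ball x0 e) (\<lambda>x. integral (cbox 0 1) (\<lambda>t. F (x + sc (circ r t) v) / circ r t))"
    by (rule integral_continuous_on_param,
        rule continuous_on_circle_family[OF holo_imp_continuous_on[OF assms(2)]]) (use er in auto)
  hence "continuous_on (ball x0 e) (dir_deriv sc v F)"
    by (rule continuous_on_eq) (use er(4)[OF assms(2)] in auto)
  thus "isCont (dir_deriv sc v F) x0"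
    using er(1) by (simp add: continuous_on_eq_continuous_at)
qed

text \<open>
  Differentiation of Cauchy's formula under the integral sign. The Leibniz rule asks for a derivative that is
  jointly continuous in operator norm; in finite dimension it suffices to check this on basis vectors, where
  it is the continuity of directional derivatives.
\<close>

lemma holo_dir_deriv:
  assumes "open U" "holo sc U F"
  shows "holo sc U (dir_deriv sc v F)"
  unfolding holo_def
proof
  fix x0 assume x0: "x0 \<in> U"
  from dir_deriv_integral_locally[OF assms(1) this, of v] obtain e r where er: "e > 0" "r > 0"
    "\<And>x t. x \<in> ball x0 e \<Longrightarrow> x + sc (circ r t) v \<in> U"
    "\<And>G x. holo sc U G \<Longrightarrow> x \<in> ball x0 e \<Longrightarrow>
       dir_deriv sc v G x = integral (cbox 0 1) (\<lambda>t. G (x + sc (circ r t) v) / circ r t)"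
    by blast
  obtain L where L: "\<And>x. x \<in> U \<Longrightarrow> (F has_derivative L x) (at x)"
     "\<And>x c v. x \<in> U \<Longrightarrow> L x (sc c v) = c * L x v"
    using assms(2) unfolding holo_def by metis
  have Lv: "L x w = dir_deriv sc w F x" if "x \<in> U" for x w
    using dir_deriv_eq[OF L(1)[OF that]] L(2)[OF that] bounded_linear_scale by metis
  define D where "D = (\<lambda>x t. Blinfun (\<lambda>w. L (x + sc (circ r t) v) w / circ r t))"
  have D: "blinfun_apply (D x t) = (\<lambda>w. L (x + sc (circ r t) v) w / circ r t)"
    if "x \<in> ball x0 e" for x t
  proof -
    have "bounded_linear (L (x + sc (circ r t) v))"
      using L(1)[OF er(3)[OF that]] has_derivative_bounded_linear by blast
    hence "bounded_linear (\<lambda>w. L (x + sc (circ r t) v) w / circ r t)"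
      unfolding divide_inverse by (rule bounded_linear_mult_const)
    thus ?thesis unfolding D_def by (rule bounded_linear_Blinfun_apply)
  qed
  have "((\<lambda>x. integral (cbox 0 1) (\<lambda>t. F (x + sc (circ r t) v) / circ r t))
         has_derivative integral (cbox 0 1) (D x0)) (at x0 within ball x0 e)"
  proof (rule leibniz_rule)
    fix x t assume x: "x \<in> ball x0 e"
    have "((\<lambda>x. x + sc (circ r t) v) has_derivative (\<lambda>h. h)) (at x within ball x0 e)"
      by (rule has_derivative_add_const[OF has_derivative_ident])
    from has_derivative_compose[OF this L(1)[OF er(3)[OF x]]]
    have "((\<lambda>x. F (x + sc (circ r t) v)) has_derivative L (x + sc (circ r t) v)) (at x within ball x0 e)"
      by simp
    hence "((\<lambda>x. F (x + sc (circ r t) v) * inverse (circ r t)) has_derivative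
         (\<lambda>w. L (x + sc (circ r t) v) w * inverse (circ r t))) (at x within ball x0 e)"
      by (rule has_derivative_mult_left)
    thus "((\<lambda>x. F (x + sc (circ r t) v) / circ r t) has_derivative blinfun_apply (D x t)) (at x within ball x0 e)"
      by (simp add: D[OF x] divide_inverse)
  next
    fix x assume x: "x \<in> ball x0 e"
    have "continuous_on ({x} \<times> cbox 0 1) (\<lambda>(x, t). F (x + sc (circ r t) v) / circ r t)"
      by (rule continuous_on_circle_family[OF holo_imp_continuous_on[OF assms(2)]]) (use er x in auto)
    hence "continuous_on (cbox 0 1) (\<lambda>t. (\<lambda>(x, t). F (x + sc (circ r t) v) / circ r t) (x, t))"
      by (rule continuous_on_compose2) (auto intro!: continuous_intros)
    thus "(\<lambda>t. F (x + sc (circ r t) v) / circ r t) integrable_on cbox 0 1"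
      by (intro integrable_continuous) simp
  next
    show "continuous_on (ball x0 e \<times> cbox 0 1) (\<lambda>(x, t). D x t)"
    proof (rule continuous_on_blinfun_componentwise)
      fix w :: 'a
      have "continuous_on (ball x0 e \<times> cbox 0 1) (\<lambda>(x, t). dir_deriv sc w F (x + sc (circ r t) v) / circ r t)"
        by (rule continuous_on_circle_family[OF continuous_on_dir_deriv[OF assms]]) (use er in auto)
      thus "continuous_on (ball x0 e \<times> cbox 0 1) (\<lambda>p. blinfun_apply (case p of (x, t) \<Rightarrow> D x t) w)"
        by (rule continuous_on_eq) (use er in \<open>auto simp: D Lv\<close>)
    qed
  qed (use er in auto)
  hence der: "(dir_deriv sc v F has_derivative integral (cbox 0 1) (D x0)) (at x0)"
    using er(1) er(4)[OF assms(2)]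
    by (subst (asm) at_within_open) (auto intro: has_derivative_transform_within_open[where s = "ball x0 e"])
  have int: "D x0 integrable_on cbox 0 1"
  proof (rule integrable_continuous, rule continuous_on_blinfun_componentwise)
    fix w :: 'a
    have "continuous_on ({x0} \<times> cbox 0 1) (\<lambda>(x, t). dir_deriv sc w F (x + sc (circ r t) v) / circ r t)"
      by (rule continuous_on_circle_family[OF continuous_on_dir_deriv[OF assms]]) (use er in auto)
    hence "continuous_on (cbox 0 1) (\<lambda>t. (\<lambda>(x, t). dir_deriv sc w F (x + sc (circ r t) v) / circ r t) (x0, t))"
      by (rule continuous_on_compose2) (auto intro!: continuous_intros)
    thus "continuous_on (cbox 0 1) (\<lambda>t. blinfun_apply (D x0 t) w)"
      by (rule continuous_on_eq) (use er in \<open>auto simp: D Lv\<close>)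
  qed
  have app: "blinfun_apply (integral (cbox 0 1) (D x0)) w =
        integral (cbox 0 1) (\<lambda>t. L (x0 + sc (circ r t) v) w / circ r t)" for w
  proof -
    have "integral (cbox 0 1) ((\<lambda>B. blinfun_apply B w) \<circ> D x0) = blinfun_apply (integral (cbox 0 1) (D x0)) w"
      by (rule integral_linear[OF int]) (intro bounded_linear_intros bounded_linear_ident)
    thus ?thesis using er(1) by (simp add: D o_def)
  qed
  have "blinfun_apply (integral (cbox 0 1) (D x0)) (sc c w) =
        c * blinfun_apply (integral (cbox 0 1) (D x0)) w" for c w
    unfolding app using er(1,3) L(2) by (simp flip: integral_mult_right times_divide_eq_right)
  with der show "\<exists>L. (dir_deriv sc v F has_derivative L) (at x0) \<and> (\<forall>c v. L (sc c v) = c * L v)"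
    by blast
qed

end

lemma holo_const:
  "holo sc U (\<lambda>_. a)"
  unfolding holo_def by (auto intro!: exI[of _ "\<lambda>_. 0"])

lemma holo_add:
  assumes "holo sc U F" "holo sc U G" shows "holo sc U (\<lambda>x. F x + G x)"
  unfolding holo_def
proof
  fix x assume "x \<in> U"
  with assms obtain L M where "(F has_derivative L) (at x)" "\<forall>c v. L (sc c v) = c * L v"
    "(G has_derivative M) (at x)" "\<forall>c v. M (sc c v) = c * M v" unfolding holo_def by meson
  thus "\<exists>L. ((\<lambda>x. F x + G x) has_derivative L) (at x) \<and> (\<forall>c v. L (sc c v) = c * L v)"
    by (intro exI[of _ "\<lambda>v. L v + M v"]) (auto intro!: derivative_eq_intros simp: algebra_simps)
qed

lemma holo_mult:
  assumes "holo sc U F" "holo sc U G" shows "holo sc U (\<lambda>x. F x * G x)"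
  unfolding holo_def
proof
  fix x assume "x \<in> U"
  with assms obtain L M where "(F has_derivative L) (at x)" "\<forall>c v. L (sc c v) = c * L v"
    "(G has_derivative M) (at x)" "\<forall>c v. M (sc c v) = c * M v" unfolding holo_def by meson
  thus "\<exists>L. ((\<lambda>x. F x * G x) has_derivative L) (at x) \<and> (\<forall>c v. L (sc c v) = c * L v)"
    by (intro exI[of _ "\<lambda>v. F x * M v + L v * G x"]) (auto intro!: derivative_eq_intros simp: algebra_simps)
qed

lemma holo_sum:
  assumes "\<And>i. i \<in> I \<Longrightarrow> holo sc U (F i)" shows "holo sc U (\<lambda>x. \<Sum>i\<in>I. F i x)"
  using assms by (induction I rule: infinite_finite_induct) (auto intro: holo_const holo_add)

lemma holo_outer:
  assumes "holo sc U F" "h holomorphic_on UNIV" shows "holo sc U (\<lambda>x. h (F x))"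
  unfolding holo_def
proof
  fix x assume "x \<in> U"
  with assms obtain L where L: "(F has_derivative L) (at x)" "\<forall>c v. L (sc c v) = c * L v"
    unfolding holo_def by meson
  have "(h has_field_derivative deriv h (F x)) (at (F x))"
    using assms(2) holomorphic_derivI open_UNIV by blast
  hence "((\<lambda>x. h (F x)) has_derivative (\<lambda>v. deriv h (F x) * L v)) (at x)"
    using has_derivative_compose[OF L(1)] unfolding has_field_derivative_def by blast
  thus "\<exists>L. ((\<lambda>x. h (F x)) has_derivative L) (at x) \<and> (\<forall>c v. L (sc c v) = c * L v)"
    using L(2) by (intro exI[of _ "\<lambda>v. deriv h (F x) * L v"]) auto
qed

lemma holo_inner:
  assumes "holo sc V F" "bounded_linear h" "\<And>c v. h (sc' c v) = sc c (h v)" "\<And>x. x \<in> U \<Longrightarrow> h x \<in> V"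
  shows "holo sc' U (\<lambda>x. F (h x))"
  unfolding holo_def
proof
  fix x assume "x \<in> U"
  with assms obtain L where L: "(F has_derivative L) (at (h x))" "\<forall>c v. L (sc c v) = c * L v"
    unfolding holo_def by meson
  have "((\<lambda>x. F (h x)) has_derivative (\<lambda>v. L (h v))) (at x)"
    using has_derivative_compose[OF bounded_linear_imp_has_derivative[OF assms(2)] L(1)] .
  thus "\<exists>L. ((\<lambda>x. F (h x)) has_derivative L) (at x) \<and> (\<forall>c v. L (sc' c v) = c * L v)"
    using L(2) assms(3) by (intro exI[of _ "\<lambda>v. L (h v)"]) auto
qed

section \<open>Polynomials and their evaluation\<close>

text \<open>
  Everything that is additive in the polynomial need only be checked on monomials. This replaces manipulations
  of sums over the support, which changes under addition.
\<close>

lemma cpoly_induct [case_names zero single add]: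
  fixes P :: "'i cpoly"
  assumes "Q 0" "\<And>\<alpha> c. Q (Poly_Mapping.single \<alpha> c)" "\<And>P R. Q P \<Longrightarrow> Q R \<Longrightarrow> Q (P + R)"
  shows "Q P"
proof -
  have "P = (\<Sum>\<alpha>\<in>Poly_Mapping.keys P. Poly_Mapping.single \<alpha> (Poly_Mapping.lookup P \<alpha>))"
    by (rule poly_mapping_eqI)
       (auto simp: lookup_sum lookup_single when_def in_keys_iff sum.delta)
  moreover have "Q (\<Sum>\<alpha>\<in>A. Poly_Mapping.single \<alpha> (Poly_Mapping.lookup P \<alpha>))" for A
    by (induction A rule: infinite_finite_induct) (auto intro: assms)
  ultimately show ?thesis by metis
qed

definition coord :: "'m \<times> 'n \<Rightarrow> complex ^ 'n ^ 'm \<Rightarrow> complex" where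
  "coord i W = W $ fst i $ snd i"

text \<open>
  The increment along which \<open>partial\<close> differentiates.
\<close>

definition unit_mat :: "'m \<times> 'n \<Rightarrow> complex \<Rightarrow> complex ^ 'n ^ 'm" where
  "unit_mat i z = (\<chi> k l. if (k, l) = i then z else 0)"

lemma coord_simps [simp]:
  "coord i (V + W) = coord i V + coord i W"
  "coord i (unit_mat j z) = (if i = j then z else 0)"
  "coord i 0 = 0"
  by (auto simp: coord_def unit_mat_def)

lemma partial_eq: "partial i g W = deriv (\<lambda>z. g (W + unit_mat i z)) 0"
  by (simp add: partial_def unit_mat_def)

lemma poly_fun_eq:
  "poly_fun P W = (\<Sum>\<alpha>\<in>Poly_Mapping.keys P. Poly_Mapping.lookup P \<alpha> *
     (\<Prod>i\<in>UNIV. coord i W ^ Poly_Mapping.lookup \<alpha> i))"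
  by (simp add: poly_fun_def peval_def coord_def case_prod_unfold)

lemma poly_fun_zero [simp]: "poly_fun 0 W = 0"
  by (simp add: poly_fun_eq)

lemma poly_fun_single:
  "poly_fun (Poly_Mapping.single \<alpha> c) W = c * (\<Prod>i\<in>UNIV. coord i W ^ Poly_Mapping.lookup \<alpha> i)"
  by (cases "c = 0") (auto simp: poly_fun_eq)

lemma poly_fun_add [simp]: "poly_fun (P + Q) W = poly_fun P W + poly_fun Q W"
  unfolding poly_fun_eq by (rule setsum_keys_plus_distrib) (auto simp: algebra_simps)

lemma poly_fun_sum: "poly_fun (\<Sum>i\<in>I. P i) W = (\<Sum>i\<in>I. poly_fun (P i) W)"
  by (induction I rule: infinite_finite_induct) auto

lemma poly_fun_mult [simp]: "poly_fun (P * Q) W = poly_fun P W * poly_fun Q W"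
proof (induction P rule: cpoly_induct)
  case (single \<alpha> c)
  show ?case
    by (induction Q rule: cpoly_induct)
       (auto simp: mult_single poly_fun_single lookup_add power_add prod.distrib algebra_simps)
qed (auto simp: algebra_simps)

lemma poly_fun_pconst [simp]: "poly_fun (pconst c) W = c"
  by (simp add: pconst_def poly_fun_single)

lemma poly_fun_one [simp]: "poly_fun 1 W = 1"
  using poly_fun_pconst[of 1 W] by (simp add: pconst_def)

lemma poly_fun_pvar [simp]: "poly_fun (pvar (k, l)) W = W $ k $ l"
  by (simp add: pvar_def poly_fun_single lookup_single when_def if_distrib[of "\<lambda>e. _ ^ e"] coord_def
      cong: if_cong)

lemma poly_fun_power: "poly_fun (P ^ k) W = poly_fun P W ^ k"
  by (induction k) auto

lemma poly_fun_prod: "poly_fun (\<Prod>i\<in>I. P i) W = (\<Prod>i\<in>I. poly_fun (P i) W)"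
  by (induction I rule: infinite_finite_induct) auto

lemma poly_fun_tau: "poly_fun (tau A P) W = poly_fun P (W ** A)"
  by (simp add: tau_def peval_def poly_fun_sum poly_fun_prod poly_fun_power case_prod_unfold
      poly_fun_eq[of P] matrix_matrix_mult_def coord_def)

section \<open>Formal derivatives\<close>

text \<open>
  For exponents with \<open>\<alpha>\<^sub>a = 0\<close> the truncated difference is \<open>\<alpha>\<close> itself, but then the coefficient vanishes.
\<close>

definition formal_partial :: "'i \<Rightarrow> 'i cpoly \<Rightarrow> 'i cpoly" where
  "formal_partial a P = (\<Sum>\<alpha>\<in>Poly_Mapping.keys P.
     Poly_Mapping.single (\<alpha> - Poly_Mapping.single a 1)
       (Poly_Mapping.lookup P \<alpha> * of_nat (Poly_Mapping.lookup \<alpha> a)))"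

lemma formal_partial_zero [simp]: "formal_partial a 0 = 0"
  by (simp add: formal_partial_def)

lemma formal_partial_single:
  "formal_partial a (Poly_Mapping.single \<alpha> c) =
     Poly_Mapping.single (\<alpha> - Poly_Mapping.single a 1) (c * of_nat (Poly_Mapping.lookup \<alpha> a))"
  by (cases "c = 0") (auto simp: formal_partial_def)

lemma formal_partial_add: "formal_partial a (P + Q) = formal_partial a P + formal_partial a Q"
  unfolding formal_partial_def by (rule setsum_keys_plus_distrib) (auto simp: algebra_simps single_add)

lemma lookup_formal_partial:
  "Poly_Mapping.lookup (formal_partial a P) \<beta> =
     of_nat (Suc (Poly_Mapping.lookup \<beta> a)) * Poly_Mapping.lookup P (\<beta> + Poly_Mapping.single a 1)"
proof (induction P rule: cpoly_induct)
  case (single \<alpha> c)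
  show ?case
  proof (cases "\<alpha> = \<beta> + Poly_Mapping.single a 1")
    case True
    thus ?thesis by (simp add: formal_partial_single lookup_add)
  next
    case False
    have "Poly_Mapping.lookup \<alpha> a = 0" if "\<alpha> - Poly_Mapping.single a 1 = \<beta>"
    proof (rule ccontr)
      assume "Poly_Mapping.lookup \<alpha> a \<noteq> 0"
      hence "\<alpha> = \<alpha> - Poly_Mapping.single a 1 + Poly_Mapping.single a 1"
        by (intro poly_mapping_eqI) (auto simp: lookup_add lookup_minus lookup_single when_def)
      with that False show False by simp
    qed
    with False show ?thesis by (auto simp: formal_partial_single lookup_single when_def)
  qed
qed (auto simp: formal_partial_add lookup_add algebra_simps)

lemma has_field_derivative_poly_fun:
  "((\<lambda>z. poly_fun P (W + unit_mat a z)) has_field_derivative poly_fun (formal_partial a P) W) (at 0)"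
proof (induction P rule: cpoly_induct)
  case (single \<alpha> c)
  define k where "k = Poly_Mapping.lookup \<alpha> a"
  define C where "C = (\<Prod>i\<in>UNIV-{a}. coord i W ^ Poly_Mapping.lookup \<alpha> i)"
  have 1: "poly_fun (Poly_Mapping.single \<alpha> c) (W + unit_mat a z) = c * ((coord a W + z) ^ k * C)" for z
    unfolding poly_fun_single by (subst prod.remove[of _ a]) (auto simp: C_def k_def intro!: prod.cong)
  have 2: "poly_fun (formal_partial a (Poly_Mapping.single \<alpha> c)) W = c * of_nat k * (coord a W ^ (k - 1) * C)"
    unfolding formal_partial_single poly_fun_single
    by (subst prod.remove[of _ a])
       (auto simp: C_def k_def lookup_minus lookup_single when_def intro!: prod.cong)
  show ?case unfolding 1 2
    by (auto intro!: derivative_eq_intros)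
qed (auto intro!: derivative_eq_intros simp: formal_partial_add)

lemma partial_poly_fun: "partial a (poly_fun P) = poly_fun (formal_partial a P)"
  using has_field_derivative_poly_fun[of P _ a] by (auto simp: partial_eq intro!: ext DERIV_imp_deriv)

text \<open>
  All formal derivatives of \<open>P\<close> vanish as functions too, so every coefficient is, up to a nonzero factor, the
  constant coefficient of an iterated derivative; hence induction on the total degree of the exponent.
\<close>

lemma poly_fun_eq_0_imp:
  assumes "\<And>W. poly_fun P W = 0" shows "P = 0"
proof (rule poly_mapping_eqI)
  fix \<beta>
  have "Poly_Mapping.lookup P \<beta> = 0"
    using assms
  proof (induction "\<Sum>i\<in>UNIV. Poly_Mapping.lookup \<beta> i" arbitrary: P \<beta>)
    case 0
    hence "\<beta> = 0" by (intro poly_mapping_eqI) auto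
    have "poly_fun P 0 = (\<Sum>\<alpha>\<in>Poly_Mapping.keys P. if \<alpha> = 0 then Poly_Mapping.lookup P \<alpha> else 0)"
      unfolding poly_fun_eq
    proof (rule sum.cong[OF refl])
      fix \<alpha> :: "'b \<times> 'a \<Rightarrow>\<^sub>0 nat"
      have "(\<Prod>i\<in>UNIV. coord i 0 ^ Poly_Mapping.lookup \<alpha> i) = (if \<alpha> = 0 then 1 else 0::complex)"
      proof (cases "\<alpha> = 0")
        case False
        then obtain i where "Poly_Mapping.lookup \<alpha> i \<noteq> 0"
          by (metis lookup_zero poly_mapping_eqI)
        with False show ?thesis by (auto simp: prod_zero_iff intro!: exI[of _ i] simp flip: split_paired_Ex)
      qed simp
      thus "Poly_Mapping.lookup P \<alpha> * (\<Prod>i\<in>UNIV. coord i 0 ^ Poly_Mapping.lookup \<alpha> i) =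
         (if \<alpha> = 0 then Poly_Mapping.lookup P \<alpha> else 0)" by simp
    qed
    with 0 \<open>\<beta> = 0\<close> show ?case by (auto simp: sum.delta in_keys_iff split: if_splits)
  next
    case (Suc d)
    then obtain a where a: "Poly_Mapping.lookup \<beta> a > 0"
      by (metis (no_types, lifting) Zero_not_Suc bot_nat_0.not_eq_extremum sum.neutral)
    define \<gamma> where "\<gamma> = \<beta> - Poly_Mapping.single a 1"
    have \<beta>: "\<beta> = \<gamma> + Poly_Mapping.single a 1"
      using a unfolding \<gamma>_def
      by (intro poly_mapping_eqI) (auto simp: lookup_add lookup_minus lookup_single when_def)
    have "(\<Sum>i\<in>UNIV. Poly_Mapping.lookup \<beta> i) = (\<Sum>i\<in>UNIV. Poly_Mapping.lookup \<gamma> i) + 1"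
      unfolding \<beta> by (simp add: lookup_add sum.distrib lookup_single when_def)
    hence d: "d = (\<Sum>i\<in>UNIV. Poly_Mapping.lookup \<gamma> i)" using Suc.hyps(2) by simp
    have "poly_fun (formal_partial a P) W = 0" for W
      using Suc.prems by (simp add: partial_eq flip: partial_poly_fun)
    from Suc.hyps(1)[OF d this] show ?case
      unfolding \<beta> lookup_formal_partial by (simp del: of_nat_Suc)
  qed
  thus "Poly_Mapping.lookup P \<beta> = Poly_Mapping.lookup 0 \<beta>" by simp
qed

text \<open>
  Turns identities between formal polynomials, in particular the representation property of \<open>tau\<close>, into
  identities between functions.
\<close>

lemma poly_fun_inject:
  assumes "\<And>W. poly_fun P W = poly_fun Q W" shows "P = Q"
proof -
  have "poly_fun (P + pconst (-1) * Q) W = 0" for W using assms by simp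
  hence "P + pconst (-1) * Q = 0" by (rule poly_fun_eq_0_imp)
  moreover have "pconst (-1) * Q = - Q" by (simp add: pconst_def single_uminus)
  ultimately show ?thesis by simp
qed

lemma poly_fun_pscale [simp]: "poly_fun (pscale c P) W = c * poly_fun P W"
  by (simp add: pscale_def)

lemma tau_add: "tau A (P + Q) = tau A P + tau A Q"
  by (rule poly_fun_inject) (simp add: poly_fun_tau)

lemma tau_pscale: "tau A (pscale c P) = pscale c (tau A P)"
  by (rule poly_fun_inject) (simp add: poly_fun_tau)

lemma tau_tau: "tau A (tau B P) = tau (A ** B) P"
  by (rule poly_fun_inject) (simp add: poly_fun_tau matrix_mul_assoc)

lemma tau_mat_1 [simp]: "tau (mat 1) P = P"
  by (rule poly_fun_inject) (simp add: poly_fun_tau)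

lemma vector_space_pscale: "vector_space pscale"
  by standard
     (auto simp: pscale_def pconst_def algebra_simps single_add mult_single simp flip: mult.assoc)

section \<open>Constant coefficient differential operators\<close>

abbreviation entire :: "(complex ^ 'n::finite ^ 'm::finite \<Rightarrow> complex) \<Rightarrow> bool" where
  "entire \<equiv> holo mscale UNIV"

lemma mscale_nth [simp]: "mscale c A $ i $ j = c * A $ i $ j"
  by (simp add: mscale_def)

lemma complex_scaling_mscale:
  "complex_scaling (mscale :: complex \<Rightarrow> complex ^ 'n::finite ^ 'm::finite \<Rightarrow> _)"
proof (rule complex_scaling.intro)
  fix v :: "complex ^ 'n ^ 'm"
  have "linear (\<lambda>c. mscale c v)"
    by (rule linearI) (auto simp: vec_eq_iff algebra_simps)
  thus "bounded_linear (\<lambda>c. mscale c v)" by (simp add: linear_conv_bounded_linear)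
qed

lemma mscale_unit_mat: "mscale z (unit_mat i 1) = unit_mat i z"
  by (simp add: vec_eq_iff unit_mat_def)

lemma unit_mat_0 [simp]: "unit_mat i 0 = 0"
  by (simp add: vec_eq_iff unit_mat_def)

lemma partial_eq_dir_deriv: "partial i = dir_deriv mscale (unit_mat i 1)"
  by (simp add: fun_eq_iff partial_eq dir_deriv_def mscale_unit_mat)

lemma entire_partial: "entire g \<Longrightarrow> entire (partial i g)"
  unfolding partial_eq_dir_deriv by (rule complex_scaling.holo_dir_deriv[OF complex_scaling_mscale]) auto

lemma bounded_linear_coord: "bounded_linear (coord i)"
  unfolding coord_def[abs_def] by (rule bounded_linear_compose[OF bounded_linear_vec_nth bounded_linear_vec_nth])

lemma entire_coord: "entire (coord i)"
  unfolding holo_def using bounded_linear_imp_has_derivative[OF bounded_linear_coord, of i]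
  by (auto intro!: exI[of _ "coord i"] simp: coord_def)

lemma entire_line:
  assumes "entire g"
  shows "((\<lambda>z. g (W + unit_mat i z)) has_field_derivative partial i g W) (at 0)"
proof -
  obtain L where L: "(g has_derivative L) (at (W + mscale 0 (unit_mat i 1)))" "\<forall>c v. L (mscale c v) = c * L v"
    using assms unfolding holo_def by blast
  from holo_along_line[OF L complex_scaling.bounded_linear_scale[OF complex_scaling_mscale]]
  have "((\<lambda>z. g (W + unit_mat i z)) has_field_derivative L (unit_mat i 1)) (at 0)"
    by (simp add: mscale_unit_mat)
  thus ?thesis unfolding partial_eq by (simp add: DERIV_imp_deriv)
qed

lemma partial_add:
  assumes "entire f" "entire g" shows "partial i (\<lambda>W. f W + g W) = (\<lambda>W. partial i f W + partial i g W)"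
  by (rule ext, subst partial_eq, rule DERIV_imp_deriv)
     (auto intro!: derivative_eq_intros entire_line assms)

lemma partial_cmult:
  assumes "entire f" shows "partial i (\<lambda>W. c * f W) = (\<lambda>W. c * partial i f W)"
  by (rule ext, subst partial_eq, rule DERIV_imp_deriv)
     (auto intro!: derivative_eq_intros entire_line assms)

lemma partial_coord_mult:
  assumes "entire f"
  shows "partial i (\<lambda>W. coord a W * f W) = (\<lambda>W. coord a W * partial i f W + (if i = a then f W else 0))"
proof (rule ext, subst partial_eq, rule DERIV_imp_deriv)
  fix W
  have "((\<lambda>z. coord a (W + unit_mat i z)) has_field_derivative (if i = a then 1 else 0)) (at 0)"
    by (auto intro!: derivative_eq_intros)
  from DERIV_mult[OF this entire_line[OF assms]]
  show "((\<lambda>z. coord a (W + unit_mat i z) * f (W + unit_mat i z)) has_field_derivative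
     coord a W * partial i f W + (if i = a then f W else 0)) (at 0)"
    by (rule DERIV_cong) auto
qed

lemma entire_partial_pow: "entire g \<Longrightarrow> entire ((partial i ^^ k) g)"
  by (induction k) (auto intro: entire_partial)

lemma partial_pow_add:
  assumes "entire f" "entire g"
  shows "(partial i ^^ k) (\<lambda>W. f W + g W) = (\<lambda>W. (partial i ^^ k) f W + (partial i ^^ k) g W)"
  by (induction k) (auto simp: partial_add entire_partial_pow assms)

lemma partial_pow_cmult:
  assumes "entire f"
  shows "(partial i ^^ k) (\<lambda>W. c * f W) = (\<lambda>W. c * (partial i ^^ k) f W)"
  by (induction k) (auto simp: partial_cmult entire_partial_pow assms)

text \<open>
  The commutator relation \<open>[\<partial>\<^sub>i\<^sup>k, W\<^sub>i] = k \<partial>\<^sub>i\<^sup>k\<^sup>-\<^sup>1\<close>.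
\<close>

lemma partial_pow_coord_mult:
  assumes "entire f"
  shows "(partial i ^^ k) (\<lambda>W. coord a W * f W) = (\<lambda>W. coord a W * (partial i ^^ k) f W +
           (if i = a then of_nat k * (partial i ^^ (k - 1)) f W else 0))"
proof (induction k)
  case (Suc k)
  have e: "entire (\<lambda>W. coord a W * (partial i ^^ k) f W)"
    by (intro holo_mult entire_coord entire_partial_pow assms)
  show ?case
  proof (cases "i = a \<and> k > 0")
    case False
    then consider "i \<noteq> a" | "i = a" "k = 0" by auto
    thus ?thesis
    proof cases
      case 1
      with Suc have "(partial i ^^ k) (\<lambda>W. coord a W * f W) = (\<lambda>W. coord a W * (partial i ^^ k) f W)"
        by simp
      with 1 show ?thesis by (simp add: partial_coord_mult entire_partial_pow assms)
    next
      case 2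
      thus ?thesis by (simp add: partial_coord_mult assms)
    qed
  next
    case True
    then obtain j where k: "k = Suc j" by (cases k) auto
    have "(partial i ^^ k) (\<lambda>W. coord a W * f W) =
       (\<lambda>W. coord a W * (partial i ^^ k) f W + of_nat k * (partial i ^^ j) f W)"
      using Suc True by (simp add: k del: funpow.simps)
    hence "(partial i ^^ Suc k) (\<lambda>W. coord a W * f W) =
       partial i (\<lambda>W. coord a W * (partial i ^^ k) f W + of_nat k * (partial i ^^ j) f W)"
      by simp
    also have "\<dots> = (\<lambda>W. coord a W * partial i ((partial i ^^ k) f) W + (partial i ^^ k) f W +
        of_nat k * partial i ((partial i ^^ j) f) W)"
      using True by (subst partial_add[OF e holo_mult[OF holo_const entire_partial_pow[OF assms]]])
        (simp add: partial_coord_mult partial_cmult entire_partial_pow assms)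
    also have "\<dots> = (\<lambda>W. coord a W * (partial i ^^ Suc k) f W + of_nat (Suc k) * (partial i ^^ k) f W)"
      by (simp add: k algebra_simps)
    finally show ?thesis using True by simp
  qed
qed auto

text \<open>
  \<open>mixed_partial\<close> with the enumeration of the variables made explicit, for inductions over the list. The
  exponents are arbitrary functions, so that one of them can be lowered by an update.
\<close>

definition iter_partial ::
  "('m::finite \<times> 'n::finite) list \<Rightarrow> ('m \<times> 'n \<Rightarrow> nat) \<Rightarrow> (complex ^ 'n ^ 'm \<Rightarrow> complex) \<Rightarrow> complex ^ 'n ^ 'm \<Rightarrow> complex"
  where "iter_partial is e = foldr (\<lambda>i. partial i ^^ e i) is"

lemma iter_partial_simps [simp]:
  "iter_partial [] e g = g"
  "iter_partial (i # is) e g = (partial i ^^ e i) (iter_partial is e g)"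
  by (auto simp: iter_partial_def)

lemma entire_iter_partial: "entire g \<Longrightarrow> entire (iter_partial is e g)"
  by (induction "is") (auto intro: entire_partial_pow)

lemma iter_partial_add:
  assumes "entire f" "entire g"
  shows "iter_partial is e (\<lambda>W. f W + g W) = (\<lambda>W. iter_partial is e f W + iter_partial is e g W)"
  by (induction "is") (auto simp: partial_pow_add entire_iter_partial assms)

lemma iter_partial_cmult:
  assumes "entire f"
  shows "iter_partial is e (\<lambda>W. c * f W) = (\<lambda>W. c * iter_partial is e f W)"
  by (induction "is") (auto simp: partial_pow_cmult entire_iter_partial assms)

lemma iter_partial_upd: "a \<notin> set is \<Longrightarrow> iter_partial is (e(a := x)) = iter_partial is e"
  unfolding iter_partial_def by (induction "is") auto

text \<open>
  As the list has no repetitions, \<open>W\<^sub>a\<close> meets \<open>\<partial>\<^sub>a\<close> in one block only and commutes with the other blocks.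
  In particular the order of the partial derivatives never has to be changed.
\<close>

lemma iter_partial_coord_mult:
  assumes "entire f" "distinct is"
  shows "iter_partial is e (\<lambda>W. coord a W * f W) = (\<lambda>W. coord a W * iter_partial is e f W +
           (if a \<in> set is then of_nat (e a) * iter_partial is (e(a := e a - 1)) f W else 0))"
  using assms(2)
proof (induction "is")
  case (Cons i "is")
  show ?case
  proof (cases "i = a")
    case True
    with Cons show ?thesis
      by (simp add: partial_pow_coord_mult entire_iter_partial assms(1) iter_partial_upd)
  next
    case False
    have e: "entire (\<lambda>W. coord a W * iter_partial is e f W)"
      by (intro holo_mult entire_coord entire_iter_partial assms)
    have e2: "entire (\<lambda>W. if a \<in> set is then of_nat (e a) * iter_partial is (e(a := e a - 1)) f W else 0)"
      by (cases "a \<in> set is") (simp_all add: holo_mult holo_const entire_iter_partial assms)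
    have IH: "iter_partial is e (\<lambda>W. coord a W * f W) = (\<lambda>W. coord a W * iter_partial is e f W +
           (if a \<in> set is then of_nat (e a) * iter_partial is (e(a := e a - 1)) f W else 0))"
      using Cons by simp
    show ?thesis
    proof (cases "a \<in> set is")
      case True
      with e2 have e2: "entire (\<lambda>W. of_nat (e a) * iter_partial is (e(a := e a - 1)) f W)" by simp
      from True False IH show ?thesis
        by (simp add: partial_pow_add[OF e e2] partial_pow_coord_mult partial_pow_cmult entire_iter_partial assms(1)
            del: One_nat_def)
    next
      case F: False
      with False IH show ?thesis
        by (simp add: partial_pow_coord_mult entire_iter_partial assms(1))
    qed
  qed
qed auto

definition enum_vars :: "('m::finite \<times> 'n::finite) list" where
  "enum_vars = (SOME is. distinct is \<and> set is = UNIV)"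

lemma enum_vars: "distinct (enum_vars :: ('m::finite \<times> 'n::finite) list)" "set (enum_vars :: ('m \<times> 'n) list) = UNIV"
proof -
  have "\<exists>is :: ('m \<times> 'n) list. distinct is \<and> set is = UNIV"
    using finite_distinct_list[of "UNIV :: ('m \<times> 'n) set"] by auto
  from someI_ex[OF this] show "distinct (enum_vars :: ('m \<times> 'n) list)" "set (enum_vars :: ('m \<times> 'n) list) = UNIV"
    by (auto simp: enum_vars_def)
qed

lemma mixed_partial_eq: "mixed_partial \<alpha> = iter_partial enum_vars (Poly_Mapping.lookup \<alpha>)"
  by (simp add: mixed_partial_def iter_partial_def enum_vars_def)

lemma mixed_partial_coord_mult:
  assumes "entire f"
  shows "mixed_partial \<alpha> (\<lambda>W. coord a W * f W) W = coord a W * mixed_partial \<alpha> f W +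
      of_nat (Poly_Mapping.lookup \<alpha> a) * mixed_partial (\<alpha> - Poly_Mapping.single a 1) f W"
proof -
  have "Poly_Mapping.lookup (\<alpha> - Poly_Mapping.single a 1) = (Poly_Mapping.lookup \<alpha>)(a := Poly_Mapping.lookup \<alpha> a - 1)"
    by (auto simp: fun_eq_iff lookup_minus lookup_single when_def)
  thus ?thesis
    unfolding mixed_partial_eq iter_partial_coord_mult[OF assms enum_vars(1)]
    by (simp add: enum_vars(2))
qed

lemma diff_op_zero [simp]: "diff_op 0 g W = 0"
  by (simp add: diff_op_def)

lemma diff_op_single: "diff_op (Poly_Mapping.single \<alpha> c) g W = c * mixed_partial \<alpha> g W"
  by (cases "c = 0") (auto simp: diff_op_def)

lemma diff_op_add: "diff_op (P + Q) g W = diff_op P g W + diff_op Q g W"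
  unfolding diff_op_def by (rule setsum_keys_plus_distrib) (auto simp: algebra_simps)

lemma diff_op_pscale: "diff_op (pscale c P) g W = c * diff_op P g W"
proof (induction P rule: cpoly_induct)
  case (add P R)
  thus ?case by (simp add: pscale_def distrib_left diff_op_add)
qed (auto simp: pscale_def pconst_def mult_single diff_op_single)

lemma diff_op_sum: "diff_op (\<Sum>i\<in>I. P i) g W = (\<Sum>i\<in>I. diff_op (P i) g W)"
  by (induction I rule: infinite_finite_induct) (auto simp: diff_op_add)

lemma diff_op_fun_add:
  assumes "entire f" "entire g"
  shows "diff_op P (\<lambda>W. f W + g W) W = diff_op P f W + diff_op P g W"
  by (simp add: diff_op_def mixed_partial_eq iter_partial_add assms algebra_simps sum.distrib)

lemma diff_op_fun_cmult:
  assumes "entire f"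
  shows "diff_op P (\<lambda>W. c * f W) W = c * diff_op P f W"
  by (simp add: diff_op_def mixed_partial_eq iter_partial_cmult assms algebra_simps sum_distrib_left)

lemma diff_op_fun_sum:
  assumes "\<And>i. i \<in> I \<Longrightarrow> entire (f i)"
  shows "diff_op P (\<lambda>W. \<Sum>i\<in>I. f i W) W = (\<Sum>i\<in>I. diff_op P (f i) W)"
  using assms
proof (induction I rule: infinite_finite_induct)
  case (insert i I)
  thus ?case by (simp add: diff_op_fun_add holo_sum)
qed (use diff_op_fun_cmult[OF holo_const, of P 0 0] in auto)

text \<open>
  The adjointness of multiplication and differentiation: \<open>[P(\<partial>), W\<^sub>a] = (\<partial>\<^sub>aP)(\<partial>)\<close>.
\<close>

lemma diff_op_coord_mult:
  assumes "entire f"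
  shows "diff_op P (\<lambda>W. coord a W * f W) W = coord a W * diff_op P f W + diff_op (formal_partial a P) f W"
  by (induction P rule: cpoly_induct)
     (auto simp: diff_op_add diff_op_single formal_partial_add formal_partial_single mixed_partial_coord_mult assms distrib_left mult.assoc)

text \<open>
  Moving the two coordinates of each term to \<open>P\<close> turns the quadratic form into the differential operator that
  annihilates \<open>P\<close>. The matrix \<open>K\<close> is arbitrary, since the operator vanishes for every pair \<open>(i, j)\<close>.
\<close>

lemma diff_op_harmonic:
  fixes c :: "'m::finite \<Rightarrow> 'm \<Rightarrow> complex" and K :: "'n::finite \<Rightarrow> 'n \<Rightarrow> complex"
  assumes "entire f"
    and "\<And>i j W. (\<Sum>p\<in>UNIV. \<Sum>q\<in>UNIV. c p q * partial (p, i) (partial (q, j) (poly_fun P)) W) = 0"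
  shows "diff_op P (\<lambda>W. (\<Sum>i\<in>UNIV. \<Sum>j\<in>UNIV. K i j * (\<Sum>p\<in>UNIV. \<Sum>q\<in>UNIV. c p q * (W $ p $ i * W $ q $ j))) * f W) 0 = 0"
proof -
  have dP: "(\<Sum>p\<in>UNIV. \<Sum>q\<in>UNIV. pscale (c p q) (formal_partial (p, i) (formal_partial (q, j) P))) = 0" for i j
    by (rule poly_fun_eq_0_imp) (use assms(2) in \<open>simp add: poly_fun_sum partial_poly_fun\<close>)
  note e = holo_mult[OF holo_const] holo_mult[OF entire_coord] holo_sum assms(1)
  have 1: "diff_op P (\<lambda>W. coord (p, i) W * (coord (q, j) W * f W)) 0 = diff_op (formal_partial (q, j) (formal_partial (p, i) P)) f 0" for p i q j
    by (simp add: diff_op_coord_mult e)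
  have comm: "formal_partial a (formal_partial b P) = formal_partial b (formal_partial a P)" for a b
    by (rule poly_mapping_eqI) (simp add: lookup_formal_partial lookup_add lookup_single when_def add_ac mult_ac)
  have "diff_op P (\<lambda>W. (\<Sum>i\<in>UNIV. \<Sum>j\<in>UNIV. K i j * (\<Sum>p\<in>UNIV. \<Sum>q\<in>UNIV. c p q * (W $ p $ i * W $ q $ j))) * f W) 0 =
    diff_op P (\<lambda>W. \<Sum>i\<in>UNIV. \<Sum>j\<in>UNIV. K i j * (\<Sum>p\<in>UNIV. \<Sum>q\<in>UNIV. c p q * (coord (p, i) W * (coord (q, j) W * f W)))) 0"
    by (simp add: coord_def sum_distrib_right mult.assoc)
  also have "\<dots> = (\<Sum>i\<in>UNIV. \<Sum>j\<in>UNIV. K i j * (\<Sum>p\<in>UNIV. \<Sum>q\<in>UNIV. c p q * diff_op (formal_partial (q, j) (formal_partial (p, i) P)) f 0))"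
    by (simp add: diff_op_fun_sum diff_op_fun_cmult e 1)
  also have "\<dots> = (\<Sum>i\<in>UNIV. \<Sum>j\<in>UNIV. K i j * diff_op (\<Sum>p\<in>UNIV. \<Sum>q\<in>UNIV. pscale (c p q) (formal_partial (p, i) (formal_partial (q, j) P))) f 0)"
    by (simp add: diff_op_sum diff_op_pscale comm)
  also have "\<dots> = 0" by (simp add: dP)
  finally show ?thesis .
qed

text \<open>
  The hypothesis on \<open>Q\<close> covers every entire multiple of \<open>Q\<close>. Writing \<open>exp z = 1 + z \<phi>(z)\<close> with the entire
  function \<open>\<phi>(z) = (exp z - 1)/z\<close> therefore disposes of all of \<open>exp Q - 1\<close> in one step, without expanding
  the exponential series.
\<close>

lemma diff_op_exp_mult:
  assumes "entire f" "entire Q" "\<And>g. entire g \<Longrightarrow> diff_op P (\<lambda>W. Q W * g W) 0 = 0"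
  shows "diff_op P (\<lambda>W. exp (Q W) * f W) 0 = diff_op P f 0"
proof -
  \<comment> \<open>The value of \<open>(exp z - 1)/z\<close> at the removable singularity is filled in by the derivative.\<close>
  define \<phi> where "\<phi> = (\<lambda>z::complex. if z = 0 then deriv exp 0 else (exp z - exp 0) / (z - 0))"
  have \<phi>: "\<phi> holomorphic_on UNIV"
    unfolding \<phi>_def by (rule pole_lemma_open) (auto intro: holomorphic_intros)
  have e: "entire (\<lambda>W. \<phi> (Q W) * f W)"
    by (intro holo_mult holo_outer[OF _ \<phi>] assms)
  have "exp z = 1 + z * \<phi> z" for z by (simp add: \<phi>_def)
  hence "(\<lambda>W. exp (Q W) * f W) = (\<lambda>W. f W + Q W * (\<phi> (Q W) * f W))"
    by (simp add: algebra_simps)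
  thus ?thesis
    using diff_op_fun_add[OF assms(1) holo_mult[OF assms(2) e]] assms(3)[OF e] by simp
qed

section \<open>Series of exponentials\<close>

text \<open>
  Convergence for all complex \<open>z\<close> is much stronger than convergence on a line: on the unit disc,
  \<open>|exp(c z)| \<le> exp(|Re c| + |Im c|)\<close>, and the right hand side is attained at one of the points
  \<open>\<plusminus>1 \<plusminus> i\<close>. The sum of the absolute values of the four series at these points is thus a
  summable majorant, and the Weierstrass theorem on locally uniform limits gives the derivative.
\<close>

lemma exp_series_deriv:
  fixes b c :: "'x \<Rightarrow> complex"
  assumes "\<And>z. ((\<lambda>x. b x * exp (c x * z)) has_sum G z) X"
  shows "((\<lambda>x. c x * b x) has_sum deriv G 0) X"
proof -
  define M where "M = (\<lambda>x. \<Sum>z\<in>{Complex 1 1, Complex 1 (-1), Complex (-1) 1, Complex (-1) (-1)}. norm (b x * exp (c x * z)))"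
  have M: "M summable_on X"
  proof -
    have "(\<lambda>x. norm (b x * exp (c x * z))) summable_on X" for z
      using has_sum_imp_summable[OF assms, of z] summable_on_iff_abs_summable_on_complex[of "\<lambda>x. b x * exp (c x * z)" X] by blast
    thus ?thesis unfolding M_def by (simp add: summable_on_add)
  qed
  have bound: "norm (b x * exp (c x * z)) \<le> M x" if "z \<in> cball 0 1" for x z
  proof -
    have z: "\<bar>Re z\<bar> \<le> 1" "\<bar>Im z\<bar> \<le> 1"
      using that abs_Re_le_cmod[of z] abs_Im_le_cmod[of z] by auto
    have "\<bar>Re (c x) * Re z\<bar> \<le> \<bar>Re (c x)\<bar>" "\<bar>Im (c x) * Im z\<bar> \<le> \<bar>Im (c x)\<bar>"
      using z mult_left_mono[of "\<bar>Re z\<bar>" 1 "\<bar>Re (c x)\<bar>"] mult_left_mono[of "\<bar>Im z\<bar>" 1 "\<bar>Im (c x)\<bar>"]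
      by (auto simp: abs_mult)
    hence le: "Re (c x * z) \<le> \<bar>Re (c x)\<bar> + \<bar>Im (c x)\<bar>" by simp
    obtain w where w: "w \<in> {Complex 1 1, Complex 1 (-1), Complex (-1) 1, Complex (-1) (-1)}"
      "Re (c x * w) = \<bar>Re (c x)\<bar> + \<bar>Im (c x)\<bar>"
    proof
      show "Complex (if Re (c x) \<ge> 0 then 1 else -1) (if Im (c x) \<ge> 0 then -1 else 1) \<in>
         {Complex 1 1, Complex 1 (-1), Complex (-1) 1, Complex (-1) (-1)}" by auto
    qed auto
    have "norm (b x * exp (c x * z)) \<le> norm (b x * exp (c x * w))"
      unfolding norm_mult norm_exp_eq_Re using le w(2) by (intro mult_left_mono) auto
    also have "\<dots> \<le> M x"
      unfolding M_def using w(1) by (rule member_le_sum) auto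
    finally show ?thesis .
  qed
  define f where "f = (\<lambda>A z. \<Sum>x\<in>A. b x * exp (c x * z))"
  define f' where "f' = (\<lambda>A z. \<Sum>x\<in>A. b x * (exp (c x * z) * c x))"
  have lim: "uniform_limit (cball 0 1) f G (finite_subsets_at_top X)"
    unfolding f_def by (rule Weierstrass_m_test_general'[OF bound assms M]) auto
  have der: "(f A has_field_derivative f' A w) (at w)" for A w
    unfolding f_def f'_def by (auto intro!: derivative_eq_intros sum.cong)
  have cont: "continuous_on (cball 0 1) (f A)" for A
    unfolding f_def by (intro continuous_intros)
  obtain g' where "\<And>w. w \<in> ball 0 1 \<Longrightarrow> (G has_field_derivative (g' w)) (at w) \<and>
      ((\<lambda>A. f' A w) \<longlongrightarrow> g' w) (finite_subsets_at_top X)"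
    by (rule has_complex_derivative_uniform_limit[of 0 1 f f' "finite_subsets_at_top X" G])
       (use lim der cont in auto)
  from this[of 0] have "deriv G 0 = g' 0" "((\<lambda>A. f' A 0) \<longlongrightarrow> g' 0) (finite_subsets_at_top X)"
    by (auto intro: DERIV_imp_deriv)
  thus ?thesis by (simp add: f'_def has_sum_def mult.commute)
qed

text \<open>
  The bilinear pairing \<open>\<sigma>(\<^sup>tV W)\<close> of matrices, without complex conjugation.
\<close>

definition entry_pairing :: "complex ^ 'n ^ 'm \<Rightarrow> complex ^ 'n::finite ^ 'm::finite \<Rightarrow> complex" where
  "entry_pairing V W = (\<Sum>i\<in>UNIV. coord i V * coord i W)"

lemma entry_pairing_double_sum: "entry_pairing V W = (\<Sum>k\<in>UNIV. \<Sum>l\<in>UNIV. V $ k $ l * W $ k $ l)"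
  by (simp add: entry_pairing_def coord_def sum.cartesian_product case_prod_unfold flip: UNIV_Times_UNIV)

lemma entry_pairing_unit_mat: "entry_pairing V (W + unit_mat i z) = entry_pairing V W + coord i V * z"
  by (simp add: entry_pairing_def distrib_left sum.distrib if_distrib[of "\<lambda>x. _ * x"] cong: if_cong)

definition exp_series ::
  "('x \<Rightarrow> complex) \<Rightarrow> ('x \<Rightarrow> complex ^ 'n::finite ^ 'm::finite) \<Rightarrow> 'x set \<Rightarrow> (complex ^ 'n ^ 'm \<Rightarrow> complex) \<Rightarrow> bool" where
  "exp_series a v X g \<longleftrightarrow> (\<forall>W. ((\<lambda>x. a x * exp (entry_pairing (v x) W)) has_sum g W) X)"

lemma exp_series_partial:
  assumes "exp_series a v X g"
  shows "exp_series (\<lambda>x. coord i (v x) * a x) v X (partial i g)"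
  unfolding exp_series_def
proof
  fix W
  have "((\<lambda>x. (a x * exp (entry_pairing (v x) W)) * exp (coord i (v x) * z)) has_sum g (W + unit_mat i z)) X" for z
    using assms[unfolded exp_series_def, rule_format, of "W + unit_mat i z"]
    by (simp add: entry_pairing_unit_mat exp_add mult.assoc)
  from exp_series_deriv[OF this]
  show "((\<lambda>x. coord i (v x) * a x * exp (entry_pairing (v x) W)) has_sum partial i g W) X"
    by (simp add: partial_eq mult.assoc)
qed

lemma exp_series_partial_pow:
  assumes "exp_series a v X g"
  shows "exp_series (\<lambda>x. coord i (v x) ^ k * a x) v X ((partial i ^^ k) g)"
proof (induction k)
  case (Suc k)
  from exp_series_partial[OF this] show ?case by (simp add: mult.assoc)
qed (use assms in simp)

lemma exp_series_iter_partial: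
  assumes "exp_series a v X g" "distinct is"
  shows "exp_series (\<lambda>x. (\<Prod>i\<in>set is. coord i (v x) ^ e i) * a x) v X (iter_partial is e g)"
  using assms(2)
proof (induction "is")
  case (Cons i "is")
  hence "exp_series (\<lambda>x. (\<Prod>i\<in>set is. coord i (v x) ^ e i) * a x) v X (iter_partial is e g)" by simp
  from exp_series_partial_pow[OF this] Cons.prems show ?case by (simp add: mult.assoc)
qed (use assms in simp)

text \<open>
  \<open>P(\<partial>\<^sub>W) exp(\<langle>v, W\<rangle>) = P(v) exp(\<langle>v, W\<rangle>)\<close>, termwise.
\<close>

lemma has_sum_diff_op:
  assumes "exp_series a v X g"
  shows "((\<lambda>x. poly_fun P (v x) * a x * exp (entry_pairing (v x) W)) has_sum diff_op P g W) X"
proof (induction P rule: cpoly_induct)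
  case (single \<alpha> c)
  from exp_series_iter_partial[OF assms enum_vars(1), unfolded exp_series_def, rule_format]
  have "((\<lambda>x. (\<Prod>i\<in>UNIV. coord i (v x) ^ Poly_Mapping.lookup \<alpha> i) * a x * exp (entry_pairing (v x) W))
    has_sum mixed_partial \<alpha> g W) X"
    unfolding mixed_partial_eq enum_vars(2) .
  from has_sum_cmult_right[OF this, of c] show ?case
    by (simp add: poly_fun_single diff_op_single mult.assoc)
next
  case (add P Q)
  from has_sum_add[OF this] show ?case by (simp add: diff_op_add distrib_right)
qed auto

lemma entry_pairing_mult: "entry_pairing V (W ** A) = entry_pairing (V ** transpose A) W"
proof -
  have "entry_pairing V (W ** A) = (\<Sum>k\<in>UNIV. \<Sum>l\<in>UNIV. \<Sum>j\<in>UNIV. V $ k $ l * (W $ k $ j * A $ j $ l))"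
    by (simp add: entry_pairing_double_sum matrix_matrix_mult_def sum_distrib_left)
  also have "\<dots> = (\<Sum>k\<in>UNIV. \<Sum>j\<in>UNIV. \<Sum>l\<in>UNIV. V $ k $ l * (W $ k $ j * A $ j $ l))"
    by (intro sum.cong refl sum.swap)
  also have "\<dots> = entry_pairing (V ** transpose A) W"
    by (simp add: entry_pairing_double_sum matrix_matrix_mult_def transpose_def sum_distrib_left sum_distrib_right mult_ac)
  finally show ?thesis .
qed

text \<open>
  Both sides are \<open>\<Sum> P(v\<^sub>x \<^sup>tA) a\<^sub>x\<close>.
\<close>

lemma diff_op_comp_right_mult:
  assumes "exp_series a v X g"
  shows "diff_op P (\<lambda>W. g (W ** A)) 0 = diff_op (tau (transpose A) P) g 0"
proof -
  have "exp_series a (\<lambda>x. v x ** transpose A) X (\<lambda>W. g (W ** A))"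
    using assms unfolding exp_series_def by (auto simp flip: entry_pairing_mult)
  from has_sum_diff_op[OF this, of P 0] has_sum_diff_op[OF assms, of "tau (transpose A) P" 0]
  show ?thesis by (auto simp: poly_fun_tau entry_pairing_def dest: has_sum_unique)
qed

section \<open>Finite dimensional spaces, duals and tensor products\<close>

lemma linear_on_zero:
  assumes "linear_on s1 V s2 W h" "0 \<in> V" shows "h 0 = 0"
  using assms unfolding linear_on_def by (metis add_cancel_right_right)

lemma linear_on_sum:
  assumes "linear_on s1 V s2 W h" "0 \<in> V" "\<And>x y. x \<in> V \<Longrightarrow> y \<in> V \<Longrightarrow> x + y \<in> V"
    and "\<And>i. i \<in> I \<Longrightarrow> x i \<in> V"
  shows "(\<Sum>i\<in>I. x i) \<in> V \<and> h (\<Sum>i\<in>I. x i) = (\<Sum>i\<in>I. h (x i))"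
  using assms(4)
proof (induction I rule: infinite_finite_induct)
  case (insert i I)
  thus ?case using assms(1,3) by (simp add: linear_on_def)
qed (use linear_on_zero[OF assms(1,2)] assms(2) in auto)

lemma findim_subspace:
  assumes "findim_space sm V"
  shows "0 \<in> V" "\<And>x y. x \<in> V \<Longrightarrow> y \<in> V \<Longrightarrow> x + y \<in> V" "\<And>c x. x \<in> V \<Longrightarrow> sm c x \<in> V"
proof -
  interpret vector_space sm using assms by (simp add: findim_space_def)
  obtain B where "V = span B" using assms by (auto simp: findim_space_def)
  thus "0 \<in> V" "\<And>x y. x \<in> V \<Longrightarrow> y \<in> V \<Longrightarrow> x + y \<in> V" "\<And>c x. x \<in> V \<Longrightarrow> sm c x \<in> V"
    by (auto intro: span_zero span_add span_scale)
qed

lemma linear_on_combination: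
  assumes "findim_space s1 V" "linear_on s1 V s2 W h" "\<And>i. i \<in> I \<Longrightarrow> x i \<in> V"
  shows "h (\<Sum>i\<in>I. s1 (c i) (x i)) = (\<Sum>i\<in>I. s2 (c i) (h (x i)))"
proof -
  note sub = findim_subspace[OF assms(1)]
  have "h (\<Sum>i\<in>I. s1 (c i) (x i)) = (\<Sum>i\<in>I. h (s1 (c i) (x i)))"
    using linear_on_sum[OF assms(2) sub(1,2), of I "\<lambda>i. s1 (c i) (x i)"] assms(3) sub(3) by blast
  also have "\<dots> = (\<Sum>i\<in>I. s2 (c i) (h (x i)))"
    using assms(2,3) by (intro sum.cong) (auto simp: linear_on_def)
  finally show ?thesis .
qed

text \<open>
  A basis with its coordinate functionals, extended by \<open>0\<close> as \<open>dual_space\<close> demands.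
\<close>

lemma findim_coordinates:
  assumes "findim_space sm V"
  obtains B e where "finite B" "B \<subseteq> V" "\<And>b. b \<in> B \<Longrightarrow> e b \<in> dual_space sm V"
    "\<And>v. v \<in> V \<Longrightarrow> (\<Sum>b\<in>B. sm (e b v) b) = v"
proof -
  interpret vector_space sm using assms by (simp add: findim_space_def)
  obtain B0 where B0: "finite B0" "V = span B0" using assms by (auto simp: findim_space_def)
  obtain B where B: "B \<subseteq> B0" "independent B" "B0 \<subseteq> span B"
    using maximal_independent_subset[of B0] by blast
  have V: "V = span B"
    unfolding B0(2) using B by (metis span_mono span_span subset_antisym)
  have fin: "finite B" using B(1) B0(1) finite_subset by blast
  define e where "e = (\<lambda>b v. if v \<in> V then representation B v b else 0)"
  show thesis
  proof (rule that[of B e])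
    show "finite B" "B \<subseteq> V" using fin V span_superset by auto
    show "e b \<in> dual_space sm V" for b
      using B(2) findim_subspace[OF assms]
      by (auto simp: dual_space_def hom_space_def linear_on_def e_def V representation_add representation_scale
          span_add span_scale)
    show "(\<Sum>b\<in>B. sm (e b v) b) = v" if "v \<in> V" for v
      using sum_representation_eq[OF B(2) _ fin order_refl] that by (simp add: e_def V)
  qed
qed

lemma dual_space_linear: "l \<in> dual_space sm V \<Longrightarrow> linear_on sm V (*) UNIV l"
  by (simp add: dual_space_def hom_space_def)

lemma dual_separates:
  assumes "findim_space sm V" "v \<in> V" "w \<in> V" "\<And>l. l \<in> dual_space sm V \<Longrightarrow> l v = l w"
  shows "v = w"
proof -
  obtain B e where "finite B" "B \<subseteq> V" "\<And>b. b \<in> B \<Longrightarrow> e b \<in> dual_space sm V"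
    "\<And>v. v \<in> V \<Longrightarrow> (\<Sum>b\<in>B. sm (e b v) b) = v"
    by (rule findim_coordinates[OF assms(1)]) (rule that; assumption)
  note B = this
  have "(\<Sum>b\<in>B. sm (e b v) b) = (\<Sum>b\<in>B. sm (e b w) b)"
    by (intro sum.cong refl) (simp add: assms(4)[OF B(3)])
  thus ?thesis unfolding B(4)[OF assms(2)] B(4)[OF assms(3)] .
qed

lemma hom_space_zero:
  assumes "findim_space s2 W" shows "0 \<in> hom_space s1 V s2 W"
proof -
  interpret vector_space s2 using assms by (simp add: findim_space_def)
  show ?thesis using findim_subspace[OF assms] by (simp add: hom_space_def linear_on_def)
qed

lemma hom_space_add:
  assumes W: "findim_space s2 W" and "g \<in> hom_space s1 V s2 W" "h \<in> hom_space s1 V s2 W"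
  shows "g + h \<in> hom_space s1 V s2 W"
proof -
  interpret W: vector_space s2 using W by (simp add: findim_space_def)
  show ?thesis using assms(2,3) findim_subspace[OF W]
    by (auto simp: hom_space_def linear_on_def algebra_simps W.scale_right_distrib)
qed

lemma pure_tensor_hom:
  assumes "findim_space s2 W" "z \<in> dual_space s1 V" "w \<in> W"
  shows "pure_tensor s2 z w \<in> hom_space s1 V s2 W"
proof -
  interpret vector_space s2 using assms by (simp add: findim_space_def)
  show ?thesis using assms findim_subspace[OF assms(1)]
    by (auto simp: hom_space_def linear_on_def pure_tensor_def dual_space_def scale_left_distrib)
qed

text \<open>
  \<open>h = \<Sum> e\<^sub>b \<otimes> h(b)\<close>: the pure tensors span \<open>Hom(V, W)\<close> when \<open>V\<close> has a finite basis.
\<close>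

lemma hom_expand:
  assumes "findim_space s1 V" "findim_space s2 W" "h \<in> hom_space s1 V s2 W"
    "finite B" "B \<subseteq> V" "\<And>b. b \<in> B \<Longrightarrow> e b \<in> dual_space s1 V"
    "\<And>v. v \<in> V \<Longrightarrow> (\<Sum>b\<in>B. s1 (e b v) b) = v"
  shows "h = (\<Sum>b\<in>B. pure_tensor s2 (e b) (h b))"
proof
  fix x
  interpret vector_space s2 using assms by (simp add: findim_space_def)
  have sum_app: "(\<Sum>b\<in>B. pure_tensor s2 (e b) (h b)) x = (\<Sum>b\<in>B. s2 (e b x) (h b))"
    by (induction B rule: infinite_finite_induct) (auto simp: pure_tensor_def)
  show "h x = (\<Sum>b\<in>B. pure_tensor s2 (e b) (h b)) x"
  proof (cases "x \<in> V")
    case True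
    have lin: "linear_on s1 V s2 W h" using assms(3) by (simp add: hom_space_def)
    have "h x = h (\<Sum>b\<in>B. s1 (e b x) b)" using assms(7)[OF True] by simp
    also have "\<dots> = (\<Sum>b\<in>B. s2 (e b x) (h b))"
      by (rule linear_on_combination[OF assms(1) lin]) (use assms(5) in auto)
    finally show ?thesis using sum_app by simp
  next
    case False
    hence "e b x = 0" if "b \<in> B" for b using assms(6)[OF that] by (simp add: dual_space_def hom_space_def)
    with False assms(3) sum_app show ?thesis by (simp add: hom_space_def)
  qed
qed

text \<open>
  On a pure tensor, \<open>\<rho>(g) \<circ> (\<zeta> \<otimes> w) \<circ> T = (\<zeta> \<circ> T) \<otimes> \<rho>(g)w\<close>, so the operator
  \<open>h \<mapsto> \<rho>(g) \<circ> h \<circ> T\<close> satisfies the condition that characterizes the tensor product representation.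
  It is the only one, as pure tensors span.
\<close>

lemma tensor_rep_eq:
  assumes V: "findim_space s1 V" and W: "findim_space s2 W"
    and pi: "\<And>z. z \<in> dual_space s1 V \<Longrightarrow> \<pi> g z = (\<lambda>x. if x \<in> V then z (T x) else 0)"
    and T: "linear_on s1 V s1 V T" and R: "linear_on s2 W s2 W (\<rho> g)"
    and h: "h \<in> hom_space s1 V s2 W"
  shows "tensor_rep s1 V s2 W \<pi> \<rho> g h = (\<lambda>x. if x \<in> V then \<rho> g (h (T x)) else 0)"
proof -
  interpret W: vector_space s2 using W by (simp add: findim_space_def)
  note subV = findim_subspace[OF V] and subW = findim_subspace[OF W]
  let ?H = "hom_space s1 V s2 W"
  define L where "L = (\<lambda>h. if h \<in> ?H then (\<lambda>x. if x \<in> V then \<rho> g (h (T x)) else 0) else 0)"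
  have "tensor_rep s1 V s2 W \<pi> \<rho> g = L"
    unfolding tensor_rep_def
  proof (rule the_equality, intro conjI ballI)
    have R0: "\<rho> g 0 = 0" by (rule linear_on_zero[OF R subW(1)])
    note add = hom_space_add[OF W, of _ s1 V]
    have scale: "fun_scale s2 c f \<in> ?H" if "f \<in> ?H" for f c
      using that subW by (auto simp: hom_space_def linear_on_def fun_scale_def W.scale_right_distrib mult.commute)
    have LH: "L f \<in> ?H" if "f \<in> ?H" for f
      using that T R subV by (auto simp: L_def hom_space_def linear_on_def)
    show "L \<in> hom_space (fun_scale s2) ?H (fun_scale s2) ?H"
      unfolding hom_space_def[of "fun_scale s2"] linear_on_def
    proof (intro CollectI conjI ballI allI impI)
      fix f k assume fk: "f \<in> ?H" "k \<in> ?H"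
      hence "f x \<in> W" "k x \<in> W" if "x \<in> V" for x using that by (auto simp: hom_space_def linear_on_def)
      with fk add[OF fk] T R show "L (f + k) = L f + L k"
        by (auto simp: L_def fun_eq_iff linear_on_def)
    next
      fix f c assume f: "f \<in> ?H"
      hence "f x \<in> W" if "x \<in> V" for x using that by (auto simp: hom_space_def linear_on_def)
      with f scale[OF f, of c] T R show "L (fun_scale s2 c f) = fun_scale s2 c (L f)"
        by (auto simp: L_def fun_eq_iff linear_on_def fun_scale_def)
    qed (use LH in \<open>auto simp: L_def\<close>)
    show "L (pure_tensor s2 z w) = pure_tensor s2 (\<pi> g z) (\<rho> g w)" if "z \<in> dual_space s1 V" "w \<in> W" for z w
      using pure_tensor_hom[OF W that] pi[OF that(1)] that R
      by (auto simp: L_def pure_tensor_def fun_eq_iff linear_on_def)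
    fix L'
    assume L': "L' \<in> hom_space (fun_scale s2) ?H (fun_scale s2) ?H \<and>
        (\<forall>\<zeta>\<in>dual_space s1 V. \<forall>w\<in>W. L' (pure_tensor s2 \<zeta> w) = pure_tensor s2 (\<pi> g \<zeta>) (\<rho> g w))"
    have L: "L \<in> hom_space (fun_scale s2) ?H (fun_scale s2) ?H" by fact
    obtain B e where B: "finite B" "B \<subseteq> V" "\<And>b. b \<in> B \<Longrightarrow> e b \<in> dual_space s1 V"
      "\<And>v. v \<in> V \<Longrightarrow> (\<Sum>b\<in>B. s1 (e b v) b) = v"
        by (rule findim_coordinates[OF V]) (rule that; assumption)
    note zeroH = hom_space_zero[OF W, of s1 V]
    show "L' = L"
    proof
      fix h
      show "L' h = L h"
      proof (cases "h \<in> ?H")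
        case True
        have hb: "h b \<in> W" if "b \<in> B" for b
          using True that B(2) by (auto simp: hom_space_def linear_on_def)
        have pt: "pure_tensor s2 (e b) (h b) \<in> ?H" if "b \<in> B" for b
          using pure_tensor_hom[OF W B(3) hb] that by blast
        have "L' (\<Sum>b\<in>B. pure_tensor s2 (e b) (h b)) = (\<Sum>b\<in>B. L' (pure_tensor s2 (e b) (h b)))"
          using linear_on_sum[of "fun_scale s2" ?H "fun_scale s2" ?H L' B] L' add zeroH pt
          by (auto simp: hom_space_def[of "fun_scale s2"])
        also have "\<dots> = (\<Sum>b\<in>B. L (pure_tensor s2 (e b) (h b)))"
          using L' hb B(3) \<open>\<And>w z. \<lbrakk>z \<in> dual_space s1 V; w \<in> W\<rbrakk> \<Longrightarrow> L (pure_tensor s2 z w) = pure_tensor s2 (\<pi> g z) (\<rho> g w)\<close>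
          by (intro sum.cong) auto
        also have "\<dots> = L (\<Sum>b\<in>B. pure_tensor s2 (e b) (h b))"
          using linear_on_sum[of "fun_scale s2" ?H "fun_scale s2" ?H L B] L add zeroH pt
          by (auto simp: hom_space_def[of "fun_scale s2"])
        finally show ?thesis by (simp only: hom_expand[OF V W True B, symmetric])
      next
        case False
        with L' show ?thesis by (simp add: L_def hom_space_def[of "fun_scale s2"])
      qed
    qed
  qed
  with h show ?thesis by (simp add: L_def)
qed

section \<open>Inverse matrices\<close>

lemma matrix_inv_mult:
  assumes "invertible A"
  shows "A ** matrix_inv A = mat 1" "matrix_inv A ** A = mat 1"
  using someI_ex[OF assms[unfolded invertible_def]] by (auto simp: matrix_inv_def)

lemma invertible_matrix_inv: "invertible A \<Longrightarrow> invertible (matrix_inv A)"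
  using matrix_inv_mult unfolding invertible_def by blast

lemma invertible_transpose:
  fixes A :: "complex ^ 'n::finite ^ 'n"
  assumes "invertible A" shows "invertible (transpose A)"
  using assms unfolding invertible_def by (metis matrix_transpose_mul transpose_mat)

section \<open>Polynomials of bounded degree\<close>

definition total_degree :: "('i::finite \<Rightarrow>\<^sub>0 nat) \<Rightarrow> nat" where
  "total_degree \<alpha> = (\<Sum>i\<in>UNIV. Poly_Mapping.lookup \<alpha> i)"

definition deg_le :: "nat \<Rightarrow> 'i::finite cpoly \<Rightarrow> bool" where
  "deg_le d P \<longleftrightarrow> (\<forall>\<alpha>\<in>Poly_Mapping.keys P. total_degree \<alpha> \<le> d)"

lemma total_degree_add: "total_degree (\<alpha> + \<beta>) = total_degree \<alpha> + total_degree \<beta>"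
  by (simp add: total_degree_def lookup_add sum.distrib)

lemma deg_le_add:
  assumes "deg_le d P" "deg_le d Q" shows "deg_le d (P + Q)"
  using assms subsetD[OF keys_add[of P Q]] by (auto simp: deg_le_def)

lemma deg_le_sum: "(\<And>i. i \<in> I \<Longrightarrow> deg_le d (P i)) \<Longrightarrow> deg_le d (\<Sum>i\<in>I. P i)"
  by (induction I rule: infinite_finite_induct) (simp_all add: deg_le_add, simp_all add: deg_le_def)

lemma deg_le_mult:
  assumes "deg_le d P" "deg_le d' Q" shows "deg_le (d + d') (P * Q)"
  unfolding deg_le_def
proof
  fix \<gamma> assume "\<gamma> \<in> Poly_Mapping.keys (P * Q)"
  then obtain \<alpha> \<beta> where "\<gamma> = \<alpha> + \<beta>" "\<alpha> \<in> Poly_Mapping.keys P" "\<beta> \<in> Poly_Mapping.keys Q"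
    using keys_mult[of P Q] by blast
  with assms show "total_degree \<gamma> \<le> d + d'" by (simp add: deg_le_def total_degree_add add_mono)
qed

lemma deg_le_pconst: "deg_le 0 (pconst c)"
  by (simp add: deg_le_def pconst_def total_degree_def)

lemma deg_le_pvar: "deg_le 1 (pvar i)"
  by (simp add: deg_le_def pvar_def total_degree_def lookup_single when_def)

lemma deg_le_one: "deg_le 0 1"
  using deg_le_pconst[of 1] by (simp add: pconst_def)

lemma deg_le_power: "deg_le d P \<Longrightarrow> deg_le (k * d) (P ^ k)"
  by (induction k) (simp_all add: deg_le_one deg_le_mult)

lemma deg_le_prod: "(\<And>i. i \<in> I \<Longrightarrow> deg_le (d i) (P i)) \<Longrightarrow> deg_le (\<Sum>i\<in>I. d i) (\<Prod>i\<in>I. P i)"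
  by (induction I rule: infinite_finite_induct) (simp_all add: deg_le_one deg_le_mult)

lemma deg_le_pscale: "deg_le d P \<Longrightarrow> deg_le d (pscale c P)"
  using deg_le_mult[OF deg_le_pconst] by (auto simp: pscale_def)

lemma deg_le_mono: "deg_le d P \<Longrightarrow> d \<le> d' \<Longrightarrow> deg_le d' P"
  by (auto simp: deg_le_def)

text \<open>
  The variables are replaced by linear forms.
\<close>

lemma deg_le_tau:
  fixes P :: "('m::finite \<times> 'n::finite) cpoly"
  assumes "deg_le d P" shows "deg_le d (tau A P)"
proof -
  define X :: "'m \<times> 'n \<Rightarrow> ('m \<times> 'n) cpoly" where "X = (\<lambda>(k, l). \<Sum>j\<in>UNIV. pvar (k, j) * pconst (A $ j $ l))"
  have X: "deg_le 1 (X i)" for i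
    unfolding X_def case_prod_unfold
    using deg_le_mult[OF deg_le_pvar deg_le_pconst] by (intro deg_le_sum) simp
  have "deg_le d (pconst (Poly_Mapping.lookup P \<alpha>) * (\<Prod>i\<in>UNIV. X i ^ Poly_Mapping.lookup \<alpha> i))"
    if \<alpha>: "\<alpha> \<in> Poly_Mapping.keys P" for \<alpha>
  proof -
    have "deg_le (\<Sum>i\<in>UNIV. Poly_Mapping.lookup \<alpha> i * 1) (\<Prod>i\<in>UNIV. X i ^ Poly_Mapping.lookup \<alpha> i)"
      by (intro deg_le_prod deg_le_power X)
    from deg_le_mult[OF deg_le_pconst this]
    have "deg_le (total_degree \<alpha>) (pconst (Poly_Mapping.lookup P \<alpha>) * (\<Prod>i\<in>UNIV. X i ^ Poly_Mapping.lookup \<alpha> i))"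
      by (simp add: total_degree_def)
    thus ?thesis by (rule deg_le_mono) (use assms \<alpha> in \<open>simp add: deg_le_def\<close>)
  qed
  thus ?thesis
    unfolding tau_def peval_def X_def[symmetric] by (intro deg_le_sum)
qed

lemma finite_total_degree_le: "finite {\<alpha> :: 'i::finite \<Rightarrow>\<^sub>0 nat. total_degree \<alpha> \<le> d}"
proof (rule finite_imageD)
  have le: "Poly_Mapping.lookup \<alpha> i \<le> total_degree \<alpha>" for \<alpha> :: "'i \<Rightarrow>\<^sub>0 nat" and i
    unfolding total_degree_def by (rule member_le_sum) simp_all
  have "Poly_Mapping.lookup ` {\<alpha> :: 'i \<Rightarrow>\<^sub>0 nat. total_degree \<alpha> \<le> d} \<subseteq> (UNIV \<rightarrow>\<^sub>E {..d})"
  proof (rule image_subsetI)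
    fix \<alpha> :: "'i \<Rightarrow>\<^sub>0 nat" assume "\<alpha> \<in> {\<alpha>. total_degree \<alpha> \<le> d}"
    hence "Poly_Mapping.lookup \<alpha> i \<le> d" for i using le[of \<alpha> i] by simp
    thus "Poly_Mapping.lookup \<alpha> \<in> UNIV \<rightarrow>\<^sub>E {..d}"
      by (intro PiE_I) (simp_all only: atMost_iff UNIV_I not_True_eq_False)
  qed
  moreover have "finite (UNIV \<rightarrow>\<^sub>E {..d} :: ('i \<Rightarrow> nat) set)" by (rule finite_PiE) simp_all
  ultimately show "finite (Poly_Mapping.lookup ` {\<alpha> :: 'i \<Rightarrow>\<^sub>0 nat. total_degree \<alpha> \<le> d})"
    by (rule finite_subset)
  show "inj_on Poly_Mapping.lookup {\<alpha> :: 'i \<Rightarrow>\<^sub>0 nat. total_degree \<alpha> \<le> d}"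
    by (rule inj_onI) (simp only: poly_mapping_eq_iff)
qed

text \<open>
  If \<open>V\<close> contains a nonzero polynomial of degree \<open>d\<close>, its elements of degree at most \<open>d\<close> form a nonzero
  invariant subspace, hence all of \<open>V\<close>; and there are only finitely many monomials of degree at most \<open>d\<close>.
\<close>

lemma irreducible_findim:
  fixes V :: "('m::finite \<times> 'n::finite) cpoly set"
  assumes "irreducible_subspace V"
  shows "findim_space pscale V"
proof -
  interpret vector_space "pscale :: complex \<Rightarrow> ('m \<times> 'n) cpoly \<Rightarrow> _" by (rule vector_space_pscale)
  have V: "subspace V" "\<And>A P. invertible A \<Longrightarrow> P \<in> V \<Longrightarrow> tau A P \<in> V" "V \<noteq> {0}"
    "\<And>U. invariant_subspace U \<Longrightarrow> U \<subseteq> V \<Longrightarrow> U = {0} \<or> U = V"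
    using assms by (auto simp: irreducible_subspace_def invariant_subspace_def)
  obtain P where P: "P \<in> V" "P \<noteq> 0" using V(1,3) subspace_0 by blast
  define d where "d = Max (total_degree ` Poly_Mapping.keys P)"
  define U where "U = {Q \<in> V. deg_le d Q}"
  have "P \<in> U" using P by (auto simp: U_def deg_le_def d_def)
  have "subspace U"
    using V(1) by (auto simp: U_def subspace_def deg_le_add deg_le_pscale) (simp add: deg_le_def)
  hence "invariant_subspace U"
    using V(2) by (auto simp: invariant_subspace_def U_def deg_le_tau)
  hence UV: "U = V" using V(4)[of U] P \<open>P \<in> U\<close> by (auto simp: U_def)
  define M :: "('m \<times> 'n) cpoly set" where "M = (\<lambda>\<alpha>. Poly_Mapping.single \<alpha> (1::complex)) ` {\<alpha>. total_degree \<alpha> \<le> d}"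
  have "Q \<in> span M" if "Q \<in> V" for Q
  proof -
    have "Q = (\<Sum>\<alpha>\<in>Poly_Mapping.keys Q. pscale (Poly_Mapping.lookup Q \<alpha>) (Poly_Mapping.single \<alpha> 1))"
      by (rule poly_mapping_eqI)
       (auto simp: lookup_sum pscale_def pconst_def mult_single lookup_single when_def in_keys_iff sum.delta)
    also have "\<dots> \<in> span M"
      using that unfolding UV[symmetric] by (intro span_sum span_scale span_base) (auto simp: U_def deg_le_def M_def)
    finally show ?thesis .
  qed
  moreover obtain B where B: "B \<subseteq> V" "independent B" "V \<subseteq> span B"
    using maximal_independent_subset[of V] by blast
  moreover have "finite M" by (simp add: M_def finite_total_degree_le)
  ultimately have "finite B" using independent_span_bound[of M B] by blast
  moreover have "V = span B" using B V(1) by (metis span_minimal subset_antisym)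
  ultimately show ?thesis using vector_space_pscale by (auto simp: findim_space_def)
qed

text \<open>
  The inverse of \<open>\<zeta> \<mapsto> \<zeta> \<circ> \<tau>(\<^sup>tA\<^sup>-\<^sup>1)\<close> is \<open>\<zeta> \<mapsto> \<zeta> \<circ> \<tau>(\<^sup>tA)\<close>, as \<open>\<tau>\<close> is multiplicative.
\<close>

lemma tau_hat_eq:
  fixes V :: "('m::finite \<times> 'n::finite) cpoly set"
  assumes "invariant_subspace V" "invertible A" "z \<in> dual_space pscale V"
  shows "tau_hat V A z = (\<lambda>P. if P \<in> V then z (tau (transpose A) P) else 0)"
proof -
  let ?F = "\<lambda>B z P. if P \<in> V then z (tau B P) else 0"
  interpret vector_space "pscale :: complex \<Rightarrow> ('m \<times> 'n) cpoly \<Rightarrow> _" by (rule vector_space_pscale)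
  have V: "subspace V" and inv: "\<And>A P. invertible A \<Longrightarrow> P \<in> V \<Longrightarrow> tau A P \<in> V"
    using assms by (auto simp: invariant_subspace_def)
  have A: "invertible (transpose A)" "invertible (transpose (matrix_inv A))"
    using assms(2) by (simp_all add: invertible_matrix_inv invertible_transpose)
  have one: "transpose A ** transpose (matrix_inv A) = mat 1" "transpose (matrix_inv A) ** transpose A = mat 1"
    using assms(2) by (simp_all add: matrix_inv_mult flip: matrix_transpose_mul)
  have dual: "?F B z \<in> dual_space pscale V" if "invertible B" "z \<in> dual_space pscale V" for B z
    using that V inv[OF that(1)]
    by (auto simp: dual_space_def hom_space_def linear_on_def tau_add tau_pscale subspace_add subspace_scale)
  have F: "?F (transpose (matrix_inv A)) (?F (transpose A) z) = z"
     "?F (transpose A) (?F (transpose (matrix_inv A)) z) = z" if "z \<in> dual_space pscale V" for z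
    using that inv[OF A(1)] inv[OF A(2)]
    by (auto simp: fun_eq_iff tau_tau one dual_space_def hom_space_def)
  show ?thesis
    unfolding tau_hat_def
  proof (rule inv_into_f_eq)
    show "inj_on (?F (transpose (matrix_inv A))) (dual_space pscale V)"
      by (rule inj_on_inverseI[where g = "?F (transpose A)"]) (rule F(2))
    show "?F (transpose A) z \<in> dual_space pscale V" by (rule dual[OF A(1) assms(3)])
    show "?F (transpose (matrix_inv A)) (?F (transpose A) z) = z" by (rule F(1)[OF assms(3)])
  qed
qed

section \<open>The symplectic action\<close>

lemma sum_UNIV_sum: "(\<Sum>i\<in>(UNIV :: ('a::finite + 'b::finite) set). h i) = (\<Sum>a\<in>UNIV. h (Inl a)) + (\<Sum>b\<in>UNIV. h (Inr b))"
  using sum.Plus[of "UNIV :: 'a set" "UNIV :: 'b set" h] by (simp add: UNIV_Plus_UNIV)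

lemma block_mat_mult:
  fixes A A' :: "real ^ 'n::finite ^ 'n" and D D' :: "real ^ 'n ^ 'n"
  shows "block_mat A B C D ** block_mat A' B' C' D' =
     block_mat (A ** A' + B ** C') (A ** B' + B ** D') (C ** A' + D ** C') (C ** B' + D ** D')"
  by (simp add: block_mat_def matrix_matrix_mult_def sum_UNIV_sum vec_eq_iff split: sum.split)

lemma block_mat_transpose:
  fixes A :: "real ^ 'n::finite ^ 'n"
  shows "transpose (block_mat A B C D) = block_mat (transpose A) (transpose C) (transpose B) (transpose D)"
  by (simp add: block_mat_def transpose_def vec_eq_iff split: sum.split)

lemma block_mat_inject:
  "block_mat A B C D = block_mat A' B' C' D' \<longleftrightarrow> A = A' \<and> B = B' \<and> C = C' \<and> D = D'"
proof
  assume *: "block_mat A B C D = block_mat A' B' C' D'"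
  have "block_mat A B C D $ i $ j = block_mat A' B' C' D' $ i $ j" for i j by (simp add: *)
  from this[of "Inl _" "Inl _"] this[of "Inl _" "Inr _"] this[of "Inr _" "Inl _"] this[of "Inr _" "Inr _"]
  show "A = A' \<and> B = B' \<and> C = C' \<and> D = D'"
    by (auto simp: block_mat_def vec_eq_iff)
qed auto

lemma block_mat_blk: "block_mat (blkA M) (blkB M) (blkC M) (blkD M) = M"
  by (simp add: block_mat_def blkA_def blkB_def blkC_def blkD_def vec_eq_iff split: sum.split)

lemma matrix_minus_mult:
  fixes A :: "'a::ring_1 ^ 'n::finite ^ 'm::finite"
  shows "(- A) ** B = - (A ** B)" "C ** (- D) = - (C ** (D :: 'a ^ 'n ^ 'm))"
  by (simp_all add: matrix_matrix_mult_def vec_eq_iff sum_negf)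

lemma matrix_add_distrib_right:
  fixes A B :: "'a::semiring_1 ^ 'n::finite ^ 'm::finite"
  shows "(A + B) ** C = A ** C + B ** C"
  by (simp add: matrix_matrix_mult_def vec_eq_iff sum.distrib distrib_right)

lemma Sp_real_blocks:
  assumes "M \<in> Sp_real"
  shows "transpose (blkA M) ** blkC M = transpose (blkC M) ** blkA M"
    and "transpose (blkB M) ** blkD M = transpose (blkD M) ** blkB M"
    and "transpose (blkA M) ** blkD M - transpose (blkC M) ** blkB M = mat 1"
    and "transpose (blkD M) ** blkA M - transpose (blkB M) ** blkC M = mat 1"
proof -
  define A B C D where "A = blkA M" "B = blkB M" "C = blkC M" "D = blkD M"
  note defs = this
  have "transpose (block_mat A B C D) ** Jmat ** block_mat A B C D = Jmat"
    using assms by (simp add: Sp_real_def defs block_mat_blk)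
  hence *: "transpose A ** C - transpose C ** A = 0" "transpose A ** D - transpose C ** B = mat 1"
     "transpose B ** C - transpose D ** A = - mat 1" "transpose B ** D - transpose D ** B = 0"
    by (simp_all add: Jmat_def block_mat_transpose block_mat_mult block_mat_inject matrix_minus_mult)
  show "transpose (blkA M) ** blkC M = transpose (blkC M) ** blkA M"
    "transpose (blkB M) ** blkD M = transpose (blkD M) ** blkB M"
    "transpose (blkA M) ** blkD M - transpose (blkC M) ** blkB M = mat 1"
    using * by (simp_all add: defs)
  show "transpose (blkD M) ** blkA M - transpose (blkB M) ** blkC M = mat 1"
    using *(3) unfolding defs by (metis minus_diff_eq minus_minus)
qed

lemma cmat_mult: "cmat (A ** B) = cmat A ** cmat (B :: real ^ 'l::finite ^ 'k::finite)"
  by (simp add: matrix_matrix_mult_def vec_eq_iff)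

lemma cmat_transpose: "cmat (transpose A) = transpose (cmat A)"
  by (simp add: transpose_def vec_eq_iff)

lemma cmat_diff: "cmat (A - B) = cmat A - cmat B"
  by (simp add: vec_eq_iff)

lemma cmat_mat_1: "cmat (mat 1) = mat 1"
  by (simp add: vec_eq_iff mat_def)

lemma cmat_0 [simp]: "cmat 0 = 0"
  by (simp add: vec_eq_iff)

lemma transpose_add: "transpose (A + B) = transpose A + transpose (B :: 'a::plus ^ 'n ^ 'm)"
  by (simp add: transpose_def vec_eq_iff)

definition moebius_numer :: "real ^ ('n::finite + 'n) ^ ('n + 'n) \<Rightarrow> complex ^ 'n ^ 'n \<Rightarrow> complex ^ 'n ^ 'n" where
  "moebius_numer M Z = cmat (blkA M) ** Z + cmat (blkB M)"

text \<open>
  The source of all facts about the action. For \<open>Z' = Z\<close> it gives the symmetry of \<open>M<Z>\<close>; with the complex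
  conjugate of a symmetric \<open>Z'\<close> in place of \<open>Z\<close> it becomes the Hermitian identity that compares the
  imaginary parts of \<open>Z'\<close> and \<open>M<Z'>\<close>.
\<close>

lemma symplectic_identity:
  assumes M: "M \<in> Sp_real" and Z: "transpose Z = Z"
  shows "transpose (moebius_numer M Z) ** autfac M Z' - transpose (autfac M Z) ** moebius_numer M Z' = Z - Z'"
proof -
  define A B C D where defs: "A = cmat (blkA M)" "B = cmat (blkB M)" "C = cmat (blkC M)" "D = cmat (blkD M)"
  have 1: "transpose A ** C = transpose C ** A"
    using arg_cong[OF Sp_real_blocks(1)[OF M], of cmat] by (simp add: cmat_mult cmat_transpose defs)
  have 2: "transpose B ** D = transpose D ** B"
    using arg_cong[OF Sp_real_blocks(2)[OF M], of cmat] by (simp add: cmat_mult cmat_transpose defs)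
  have 3: "transpose A ** D = mat 1 + transpose C ** B"
    using arg_cong[OF Sp_real_blocks(3)[OF M], of cmat]
    by (simp add: cmat_mult cmat_transpose defs cmat_diff cmat_mat_1 algebra_simps)
  have 4: "transpose D ** A = mat 1 + transpose B ** C"
    using arg_cong[OF Sp_real_blocks(4)[OF M], of cmat]
    by (simp add: cmat_mult cmat_transpose defs cmat_diff cmat_mat_1 algebra_simps)
  have "transpose (A ** Z + B) ** (C ** Z' + D) =
      Z ** (transpose A ** C) ** Z' + Z ** (transpose A ** D) + transpose B ** C ** Z' + transpose B ** D"
    by (simp add: transpose_add matrix_transpose_mul Z matrix_add_ldistrib matrix_add_distrib_right matrix_mul_assoc add_ac)
  moreover have "transpose (C ** Z + D) ** (A ** Z' + B) =
      Z ** (transpose C ** A) ** Z' + Z ** (transpose C ** B) + (transpose D ** A) ** Z' + transpose D ** B"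
    by (simp add: transpose_add matrix_transpose_mul Z matrix_add_ldistrib matrix_add_distrib_right matrix_mul_assoc add_ac)
  ultimately show ?thesis
    unfolding moebius_numer_def autfac_def defs[symmetric] 1 2 3 4
    by (simp add: matrix_add_ldistrib matrix_add_distrib_right)
qed

definition vdot :: "complex ^ 'n \<Rightarrow> complex ^ 'n::finite \<Rightarrow> complex" where
  "vdot x y = (\<Sum>i\<in>UNIV. x $ i * y $ i)"

lemma vdot_transpose: "vdot x ((transpose A ** B) *v y) = vdot (A *v x) (B *v y)"
proof -
  have "vdot x (transpose A *v w) = vdot (A *v x) w" for w
  proof -
    have "vdot x (transpose A *v w) = (\<Sum>i\<in>UNIV. \<Sum>j\<in>UNIV. x $ i * (A $ j $ i * w $ j))"
      by (simp add: vdot_def matrix_vector_mult_def transpose_def sum_distrib_left)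
    also have "\<dots> = (\<Sum>j\<in>UNIV. \<Sum>i\<in>UNIV. x $ i * (A $ j $ i * w $ j))" by (rule sum.swap)
    also have "\<dots> = vdot (A *v x) w"
      by (simp add: vdot_def matrix_vector_mult_def sum_distrib_left sum_distrib_right mult_ac)
    finally show ?thesis .
  qed
  thus ?thesis by (simp flip: matrix_vector_mul_assoc)
qed

definition vec_cnj :: "complex ^ 'n \<Rightarrow> complex ^ 'n" where "vec_cnj x = (\<chi> i. cnj (x $ i))"

lemma vec_cnj_vdot: "vdot (vec_cnj x) (vec_cnj y) = cnj (vdot x y)"
  by (simp add: vdot_def vec_cnj_def)

lemma vec_cnj_mult: "vec_cnj (A *v x) = map_matrix cnj A *v vec_cnj x"
  by (simp add: vec_cnj_def matrix_vector_mult_def vec_eq_iff)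

lemma map_cnj_moebius_numer: "map_matrix cnj (moebius_numer M Z) = moebius_numer M (map_matrix cnj Z)"
  by (simp add: moebius_numer_def matrix_matrix_mult_def vec_eq_iff)

lemma map_cnj_autfac: "map_matrix cnj (autfac M Z) = autfac M (map_matrix cnj Z)"
  by (simp add: autfac_def matrix_matrix_mult_def vec_eq_iff)

text \<open>
  A real symmetric positive definite form stays positive as a Hermitian form: at \<open>a + ib\<close> it takes the value
  \<open>S[a] + S[b]\<close>, since the mixed terms cancel by symmetry.
\<close>

lemma hermitian_form_pos:
  assumes "Z \<in> siegel" "v \<noteq> 0"
  obtains q where "q > 0" "vdot (vec_cnj v) ((map_matrix cnj Z - Z) *v v) = - 2 * \<i> * of_real q"
proof -
  define S where "S = map_matrix Im Z"
  define a b where "a = (\<chi> i. Re (v $ i))" and "b = (\<chi> i. Im (v $ i))"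
  have S: "transpose S = S" "\<And>x. x \<noteq> 0 \<Longrightarrow> x \<bullet> (S *v x) > 0"
    using assms(1) by (auto simp: siegel_def pos_def_def S_def)
  have nn: "x \<bullet> (S *v x) \<ge> 0" for x using S(2)[of x] by (cases "x = 0") auto
  have "a \<noteq> 0 \<or> b \<noteq> 0" using assms(2) by (auto simp: a_def b_def vec_eq_iff complex_eq_iff)
  hence q: "a \<bullet> (S *v a) + b \<bullet> (S *v b) > 0"
    using S(2) nn by (metis add.commute add_pos_nonneg)
  have "a \<bullet> (S *v b) = b \<bullet> (S *v a)"
    by (metis S(1) dot_lmul_matrix inner_commute vector_transpose_matrix)
  have ab: "(\<Sum>i\<in>UNIV. \<Sum>j\<in>UNIV. a $ i * (S $ i $ j * b $ j)) = (\<Sum>i\<in>UNIV. \<Sum>j\<in>UNIV. b $ i * (S $ i $ j * a $ j))"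
    using \<open>a \<bullet> (S *v b) = b \<bullet> (S *v a)\<close>
    by (simp add: inner_vec_def matrix_vector_mult_def sum_distrib_left)
  have v: "v $ i = Complex (a $ i) (b $ i)" for i by (simp add: a_def b_def)
  have ZS: "cnj (Z $ i $ j) - Z $ i $ j = - 2 * \<i> * of_real (S $ i $ j)" for i j
    by (simp add: S_def complex_eq_iff)
  have "vdot (vec_cnj v) ((map_matrix cnj Z - Z) *v v) = - 2 * \<i> *
     (\<Sum>i\<in>UNIV. \<Sum>j\<in>UNIV. cnj (v $ i) * (of_real (S $ i $ j) * v $ j))"
    by (simp add: vdot_def vec_cnj_def matrix_vector_mult_def ZS sum_distrib_left mult_ac)
  also have "(\<Sum>i\<in>UNIV. \<Sum>j\<in>UNIV. cnj (v $ i) * (of_real (S $ i $ j) * v $ j)) =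
     of_real (a \<bullet> (S *v a) + b \<bullet> (S *v b))"
    using ab
    by (simp add: complex_eq_iff v inner_vec_def matrix_vector_mult_def sum_distrib_left
        sum.distrib sum_subtractf algebra_simps)
  finally show thesis using q that by blast
qed

lemma siegel_cnj: "Z \<in> siegel \<Longrightarrow> transpose (map_matrix cnj Z) = map_matrix cnj Z"
  by (auto simp: siegel_def transpose_def vec_eq_iff)

lemma symplectic_hermitian:
  assumes M: "M \<in> Sp_real" and Z: "Z \<in> siegel"
  shows "cnj (vdot (moebius_numer M Z *v v) (vec_cnj (autfac M Z *v v))) - vdot (vec_cnj (autfac M Z *v v)) (moebius_numer M Z *v v) =
     vdot (vec_cnj v) ((map_matrix cnj Z - Z) *v v)"
proof -
  define X Y X' Y' where "X = moebius_numer M Z" "Y = autfac M Z"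
    "X' = moebius_numer M (map_matrix cnj Z)" "Y' = autfac M (map_matrix cnj Z)"
  note defs = this
  have cc: "vec_cnj (vec_cnj w) = w" for w by (simp add: vec_cnj_def vec_eq_iff)
  have c: "X' *v vec_cnj v = vec_cnj (X *v v)" "Y' *v vec_cnj v = vec_cnj (Y *v v)"
    by (simp_all add: defs vec_cnj_mult map_cnj_moebius_numer map_cnj_autfac)
  have "vdot (vec_cnj v) ((map_matrix cnj Z - Z) *v v) = vdot (vec_cnj v) ((transpose X' ** Y - transpose Y' ** X) *v v)"
    unfolding defs symplectic_identity[OF M siegel_cnj[OF Z], of Z] ..
  also have "\<dots> = vdot (vec_cnj v) ((transpose X' ** Y) *v v) - vdot (vec_cnj v) ((transpose Y' ** X) *v v)"
    by (simp add: vdot_def matrix_vector_mult_diff_rdistrib right_diff_distrib sum_subtractf)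
  also have "\<dots> = vdot (vec_cnj (X *v v)) (vec_cnj (vec_cnj (Y *v v))) - vdot (vec_cnj (Y *v v)) (X *v v)"
    by (simp add: vdot_transpose c cc)
  finally show ?thesis by (simp add: vec_cnj_vdot defs)
qed

text \<open>
  If \<open>(CZ + D)v = 0\<close> then the left hand side of \<open>symplectic_hermitian\<close> vanishes, which contradicts the
  positivity of the imaginary part of \<open>Z\<close> unless \<open>v = 0\<close>.
\<close>

lemma invertible_autfac:
  assumes M: "M \<in> Sp_real" and Z: "Z \<in> siegel"
  shows "invertible (autfac M Z)"
  unfolding invertible_left_inverse matrix_left_invertible_ker
proof (intro allI impI, rule ccontr)
  fix v assume v: "autfac M Z *v v = 0" "v \<noteq> 0"
  obtain q where q: "q > 0" "vdot (vec_cnj v) ((map_matrix cnj Z - Z) *v v) = - 2 * \<i> * of_real q"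
    using hermitian_form_pos[OF Z v(2)] .
  have "vec_cnj (autfac M Z *v v) = 0" by (simp add: v(1) vec_cnj_def vec_eq_iff)
  with symplectic_hermitian[OF M Z, of v] q show False
    by (simp add: vdot_def)
qed

lemma moebius_eq: "moebius M Z = moebius_numer M Z ** matrix_inv (autfac M Z)"
  by (simp add: moebius_def moebius_numer_def)

text \<open>
  For real \<open>x \<noteq> 0\<close> put \<open>w = (CZ + D)\<^sup>-\<^sup>1 x\<close>. Then the quadratic form of \<open>Im M<Z>\<close> at \<open>x\<close> equals the Hermitian
  form of \<open>Im Z\<close> at \<open>w\<close>.
\<close>

lemma moebius_siegel:
  assumes M: "M \<in> Sp_real" and Z: "Z \<in> siegel"
  shows "moebius M Z \<in> siegel"
proof -
  define X Y Y' where "X = moebius_numer M Z" and "Y = autfac M Z" and "Y' = matrix_inv Y"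
  have YY: "Y ** Y' = mat 1" "Y' ** Y = mat 1"
    using matrix_inv_mult[OF invertible_autfac[OF M Z]] by (auto simp: Y_def Y'_def)
  have N: "moebius M Z = X ** Y'" by (simp add: moebius_eq X_def Y_def Y'_def)
  have "transpose X ** Y = transpose Y ** X"
    using symplectic_identity[OF M, of Z Z] Z by (simp add: siegel_def X_def Y_def)
  have sym: "transpose (X ** Y') = X ** Y'"
  proof -
    have "transpose (X ** Y') = transpose Y' ** (transpose X ** Y) ** Y'"
      by (simp add: matrix_transpose_mul YY flip: matrix_mul_assoc)
    also have "\<dots> = transpose (Y ** Y') ** X ** Y'"
      unfolding \<open>transpose X ** Y = transpose Y ** X\<close> by (simp add: matrix_transpose_mul matrix_mul_assoc)
    finally show ?thesis by (simp add: YY)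
  qed
  have pos: "x \<bullet> (map_matrix Im (X ** Y') *v x) > 0" if "x \<noteq> 0" for x
  proof -
    define x' w where "x' = (\<chi> i. complex_of_real (x $ i))" and "w = Y' *v x'"
    have Yw: "Y *v w = x'" by (simp add: w_def matrix_vector_mul_assoc YY)
    have "x' \<noteq> 0" using that by (auto simp: x'_def vec_eq_iff)
    hence "w \<noteq> 0" using Yw by auto
    then obtain q where q: "q > 0" "vdot (vec_cnj w) ((map_matrix cnj Z - Z) *v w) = - 2 * \<i> * of_real q"
      using hermitian_form_pos[OF Z] by blast
    have cx: "vec_cnj x' = x'" by (simp add: x'_def vec_cnj_def vec_eq_iff)
    have comm: "vdot (X *v w) x' = vdot x' (X *v w)" by (simp add: vdot_def mult.commute)
    have "cnj (vdot x' (X *v w)) - vdot x' (X *v w) = - 2 * \<i> * of_real q"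
      using symplectic_hermitian[OF M Z, of w] q(2) Yw cx comm by (simp add: X_def[symmetric] Y_def[symmetric])
    hence "Im (vdot x' (X *v w)) = q"
      by (simp add: complex_eq_iff)
    moreover have "x \<bullet> (map_matrix Im (X ** Y') *v x) = Im (vdot x' ((X ** Y') *v x'))"
      by (simp add: vdot_def x'_def inner_vec_def matrix_vector_mult_def sum_distrib_left algebra_simps)
    ultimately show ?thesis using q(1) by (simp add: w_def matrix_vector_mul_assoc)
  qed
  have "transpose (map_matrix Im (X ** Y')) = map_matrix Im (X ** Y')"
    using sym by (simp add: transpose_def vec_eq_iff)
  with sym pos show ?thesis by (simp add: N siegel_def pos_def_def)
qed

section \<open>Symmetrization\<close>

definition symmetrize :: "complex ^ 'n ^ 'n \<Rightarrow> complex ^ 'n::finite ^ 'n" where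
  "symmetrize Z = (\<chi> i j. (Z $ i $ j + Z $ j $ i) / 2)"

text \<open>
  An open set of arbitrary matrices that contains the Siegel half space and retracts onto it linearly.
\<close>

definition siegel_hull :: "(complex ^ 'n::finite ^ 'n) set" where
  "siegel_hull = {Z. symmetrize Z \<in> siegel}"

lemma symmetrize_siegel: "Z \<in> siegel \<Longrightarrow> symmetrize Z = Z"
  by (auto simp: symmetrize_def siegel_def transpose_def vec_eq_iff)

lemma siegel_subset_hull: "siegel \<subseteq> siegel_hull"
  by (auto simp: siegel_hull_def symmetrize_siegel)

lemma symmetrize_form: "x \<bullet> (map_matrix Im (symmetrize Z) *v x) = (\<Sum>i\<in>UNIV. \<Sum>j\<in>UNIV. x $ i * (Im (Z $ i $ j) * x $ j))"
proof -
  have "(\<Sum>i\<in>UNIV. \<Sum>j\<in>UNIV. x $ i * (Im (Z $ j $ i) * x $ j)) = (\<Sum>j\<in>UNIV. \<Sum>i\<in>UNIV. x $ i * (Im (Z $ j $ i) * x $ j))"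
    by (rule sum.swap)
  hence "(\<Sum>i\<in>UNIV. \<Sum>j\<in>UNIV. x $ i * (Im (Z $ j $ i) * x $ j)) = (\<Sum>i\<in>UNIV. \<Sum>j\<in>UNIV. x $ i * (Im (Z $ i $ j) * x $ j))"
    by (simp add: mult_ac)
  thus ?thesis
    by (simp add: symmetrize_def inner_vec_def matrix_vector_mult_def sum_distrib_left add_divide_distrib
        distrib_left distrib_right sum.distrib flip: sum_divide_distrib)
qed

text \<open>
  The complement is the projection of a closed set along the compact unit sphere.
\<close>

lemma open_siegel_hull: "open (siegel_hull :: (complex ^ 'n::finite ^ 'n) set)"
proof -
  define q :: "real ^ 'n \<Rightarrow> complex ^ 'n ^ 'n \<Rightarrow> real" where "q = (\<lambda>x Z. x \<bullet> (map_matrix Im (symmetrize Z) *v x))"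
  have scale: "q (c *\<^sub>R x) Z = c^2 * q x Z" for c x Z
    by (simp add: q_def symmetrize_form sum_distrib_left power2_eq_square mult_ac)
  have hull: "siegel_hull = - {Z. \<exists>x. x \<in> sphere 0 1 \<and> (x, Z) \<in> {(x, Z). q x Z \<le> 0}}"
  proof (intro set_eqI iffI)
    fix Z :: "complex ^ 'n ^ 'n"
    assume "Z \<in> - {Z. \<exists>x. x \<in> sphere 0 1 \<and> (x, Z) \<in> {(x, Z). q x Z \<le> 0}}"
    hence *: "q x Z > 0" if "norm x = 1" for x using that by (auto simp: not_le)
    have "q x Z > 0" if "x \<noteq> 0" for x
      using *[of "(1 / norm x) *\<^sub>R x"] that by (simp add: scale zero_less_mult_iff zero_less_divide_iff del: scaleR_eq_0_iff)
    thus "Z \<in> siegel_hull"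
      by (auto simp: siegel_hull_def siegel_def pos_def_def q_def)
         (auto simp: symmetrize_def transpose_def vec_eq_iff add.commute)
  next
    fix Z :: "complex ^ 'n ^ 'n" assume "Z \<in> siegel_hull"
    hence "q x Z > 0" if "x \<noteq> 0" for x using that by (auto simp: siegel_hull_def siegel_def pos_def_def q_def)
    hence "q x Z > 0" if "norm x = 1" for x using that by (metis norm_zero zero_neq_one)
    thus "Z \<in> - {Z. \<exists>x. x \<in> sphere 0 1 \<and> (x, Z) \<in> {(x, Z). q x Z \<le> 0}}" by (fastforce simp: not_le)
  qed
  have "closed {(x, Z). q x Z \<le> 0}"
    unfolding q_def symmetrize_form case_prod_unfold
    by (intro closed_Collect_le continuous_intros)
  hence "closed {Z. \<exists>x. x \<in> sphere 0 1 \<and> (x, Z) \<in> {(x, Z). q x Z \<le> 0}}"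
    by (intro closed_compact_projection) auto
  thus ?thesis unfolding hull by (rule open_Compl)
qed

lemma bounded_linear_symmetrize: "bounded_linear (symmetrize :: complex ^ 'n::finite ^ 'n \<Rightarrow> _)"
proof -
  have "linear (symmetrize :: complex ^ 'n ^ 'n \<Rightarrow> _)"
  proof (rule linearI)
    have half: "(r *\<^sub>R z) / 2 = r *\<^sub>R (z / 2)" for r :: real and z :: complex by (simp add: scaleR_conv_of_real)
    show "symmetrize (r *\<^sub>R Z) = r *\<^sub>R symmetrize Z" for r :: real and Z :: "complex ^ 'n ^ 'n"
      by (simp add: symmetrize_def vec_eq_iff scaleR_add_right add_divide_distrib half)
  qed (simp add: symmetrize_def vec_eq_iff add_divide_distrib)
  thus ?thesis by (simp add: linear_conv_bounded_linear)
qed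

lemma symmetrize_mscale: "symmetrize (mscale c Z) = mscale c (symmetrize Z)"
  by (simp add: symmetrize_def mscale_def vec_eq_iff algebra_simps)

section \<open>Joint holomorphy\<close>

abbreviation pair_scale ::
  "complex \<Rightarrow> (complex ^ 'n ^ 'n) \<times> (complex ^ 'n ^ 'm) \<Rightarrow> (complex ^ 'n ^ 'n) \<times> (complex ^ 'n ^ 'm)" where
  "pair_scale \<equiv> (\<lambda>c (Z, W). (mscale c Z, mscale c W))"

lemma complex_scaling_pair:
  "complex_scaling (pair_scale :: complex \<Rightarrow> (complex ^ 'n::finite ^ 'n) \<times> (complex ^ 'n ^ 'm::finite) \<Rightarrow> _)"
proof (rule complex_scaling.intro)
  fix v :: "(complex ^ 'n ^ 'n) \<times> (complex ^ 'n ^ 'm)"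
  show "bounded_linear (\<lambda>c. pair_scale c v)"
    unfolding case_prod_unfold
    by (intro bounded_linear_Pair complex_scaling.bounded_linear_scale complex_scaling_mscale)
qed

lemma mscale_zero [simp]: "mscale c 0 = 0"
  by (simp add: vec_eq_iff)

lemma holo_partial_snd:
  fixes G :: "complex ^ 'n::finite ^ 'n \<Rightarrow> complex ^ 'n ^ 'm::finite \<Rightarrow> complex"
  assumes "open U" "holo pair_scale (U \<times> UNIV) (\<lambda>(Z, W). G Z W)"
  shows "holo pair_scale (U \<times> UNIV) (\<lambda>(Z, W). partial i (G Z) W)"
proof -
  have "dir_deriv pair_scale (0, unit_mat i 1) (\<lambda>(Z, W). G Z W) = (\<lambda>(Z, W). partial i (G Z) W)"
    by (simp add: fun_eq_iff dir_deriv_def partial_eq mscale_unit_mat)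
  thus ?thesis
    using complex_scaling.holo_dir_deriv[OF complex_scaling_pair open_Times[OF assms(1) open_UNIV] assms(2),
        of "(0, unit_mat i 1)"] by simp
qed

lemma holo_iter_partial_snd:
  fixes G :: "complex ^ 'n::finite ^ 'n \<Rightarrow> complex ^ 'n ^ 'm::finite \<Rightarrow> complex"
  assumes "open U" "holo pair_scale (U \<times> UNIV) (\<lambda>(Z, W). G Z W)"
  shows "holo pair_scale (U \<times> UNIV) (\<lambda>(Z, W). iter_partial is e (G Z) W)"
proof (induction "is")
  case (Cons i "is")
  have "holo pair_scale (U \<times> UNIV) (\<lambda>(Z, W). (partial i ^^ k) (iter_partial is e (G Z)) W)" for k
    by (induction k) (use Cons holo_partial_snd[OF assms(1)] in simp_all)
  thus ?case by simp
qed (use assms(2) in simp)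

lemma holo_diff_op_snd:
  fixes G :: "complex ^ 'n::finite ^ 'n \<Rightarrow> complex ^ 'n ^ 'm::finite \<Rightarrow> complex"
  assumes "open U" "holo pair_scale (U \<times> UNIV) (\<lambda>(Z, W). G Z W)"
  shows "holo pair_scale (U \<times> UNIV) (\<lambda>(Z, W). diff_op P (G Z) W)"
  unfolding diff_op_def mixed_partial_eq case_prod_unfold
  using holo_iter_partial_snd[OF assms] unfolding case_prod_unfold
  by (intro holo_sum holo_mult holo_const)

lemma entire_slice:
  fixes G :: "complex ^ 'n::finite ^ 'n \<Rightarrow> complex ^ 'n ^ 'm::finite \<Rightarrow> complex"
  assumes "holo pair_scale (U \<times> UNIV) (\<lambda>(Z, W). G Z W)" "Z \<in> U"
  shows "entire (G Z)"
  unfolding holo_def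
proof
  fix W
  from assms obtain L where L: "((\<lambda>(Z, W). G Z W) has_derivative L) (at (Z, W))" "\<forall>c v. L (pair_scale c v) = c * L v"
    unfolding holo_def by blast
  have "((\<lambda>W. (Z, W)) has_derivative (\<lambda>w. (0, w))) (at W)"
    by (auto intro!: derivative_eq_intros)
  from has_derivative_compose[OF this L(1)] have "(G Z has_derivative (\<lambda>w. L (0, w))) (at W)" by simp
  moreover have "L (0, mscale c w) = c * L (0, w)" for c w
    using L(2)[rule_format, of c "(0, w)"] by simp
  ultimately show "\<exists>L. (G Z has_derivative L) (at W) \<and> (\<forall>c v. L (mscale c v) = c * L v)" by blast
qed

lemma holo_fst_slice:
  fixes G :: "complex ^ 'n::finite ^ 'n \<Rightarrow> complex ^ 'n ^ 'm::finite \<Rightarrow> complex"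
  assumes "holo pair_scale (U \<times> UNIV) (\<lambda>(Z, W). G Z W)"
  shows "holo mscale U (\<lambda>Z. G Z W)"
  unfolding holo_def
proof
  fix Z assume "Z \<in> U"
  with assms obtain L where L: "((\<lambda>(Z, W). G Z W) has_derivative L) (at (Z, W))" "\<forall>c v. L (pair_scale c v) = c * L v"
    unfolding holo_def by blast
  have "((\<lambda>Z. (Z, W)) has_derivative (\<lambda>z. (z, 0))) (at Z)"
    by (auto intro!: derivative_eq_intros)
  from has_derivative_compose[OF this L(1)] have "((\<lambda>Z. G Z W) has_derivative (\<lambda>z. L (z, 0))) (at Z)" by simp
  moreover have "L (mscale c z, 0) = c * L (z, 0)" for c z
    using L(2)[rule_format, of c "(z, 0)"] by simp
  ultimately show "\<exists>L. ((\<lambda>Z. G Z W) has_derivative L) (at Z) \<and> (\<forall>c v. L (mscale c v) = c * L v)" by blast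
qed

text \<open>
  On the left, \<open>f\<close> is differentiable only within the Siegel half space; the retraction makes
  this differentiability on an open set.
\<close>

lemma holo_symmetrize:
  fixes f :: "(complex ^ 'n::finite ^ 'n) \<times> (complex ^ 'n ^ 'm::finite) \<Rightarrow> 'v::ab_group_add"
  assumes "holomorphic_into pair_scale sm V (siegel \<times> UNIV) f" "l \<in> dual_space sm V"
  shows "holo pair_scale (siegel_hull \<times> UNIV) (\<lambda>(Z, W). l (f (symmetrize Z, W)))"
  unfolding holo_def
proof
  let ?h = "\<lambda>x :: (complex ^ 'n ^ 'n) \<times> (complex ^ 'n ^ 'm). (symmetrize (fst x), snd x)"
  fix x :: "(complex ^ 'n ^ 'n) \<times> (complex ^ 'n ^ 'm)" assume x: "x \<in> siegel_hull \<times> UNIV"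
  hence "?h x \<in> siegel \<times> UNIV" by (auto simp: siegel_hull_def)
  then obtain L where L: "((\<lambda>y. l (f y)) has_derivative L) (at (?h x) within siegel \<times> UNIV)"
      "\<forall>c v. L (pair_scale c v) = c * L v"
    using assms unfolding holomorphic_into_def by blast
  have "bounded_linear ?h"
    by (intro bounded_linear_Pair bounded_linear_compose[OF bounded_linear_symmetrize] bounded_linear_fst bounded_linear_snd)
  hence h: "(?h has_derivative ?h) (at x within siegel_hull \<times> UNIV)"
    by (rule bounded_linear_imp_has_derivative)
  have "?h ` (siegel_hull \<times> UNIV) \<subseteq> siegel \<times> UNIV" by (auto simp: siegel_hull_def)
  from has_derivative_in_compose[OF h has_derivative_subset[OF L(1) this]]
  have "((\<lambda>x. l (f (?h x))) has_derivative (\<lambda>v. L (?h v))) (at x)"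
    using x at_within_open[OF x open_Times[OF open_siegel_hull open_UNIV]] by simp
  moreover have "L (?h (pair_scale c v)) = c * L (?h v)" for c v
    using L(2)[rule_format, of c "?h v"] by (simp add: case_prod_unfold symmetrize_mscale)
  ultimately show "\<exists>L. ((\<lambda>(Z, W). l (f (symmetrize Z, W))) has_derivative L) (at x) \<and> (\<forall>c v. L (pair_scale c v) = c * L v)"
    unfolding case_prod_unfold by blast
qed

section \<open>Derivatives of vector valued functions\<close>

text \<open>
  The vector with coordinates \<open>P(\<partial>)(e\<^sub>b \<circ> g)\<close> has the defining property; it is unique since functionals
  separate points.
\<close>

lemma diff_op_into_props:
  assumes V: "findim_space sm V" and g: "\<And>W. g W \<in> V" and e: "\<And>l. l \<in> dual_space sm V \<Longrightarrow> entire (\<lambda>W. l (g W))"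
  shows "diff_op_into sm V P g W \<in> V"
    and "l \<in> dual_space sm V \<Longrightarrow> l (diff_op_into sm V P g W) = diff_op P (\<lambda>X. l (g X)) W"
proof -
  obtain B c where B: "finite B" "B \<subseteq> V" "\<And>b. b \<in> B \<Longrightarrow> c b \<in> dual_space sm V"
    "\<And>v. v \<in> V \<Longrightarrow> (\<Sum>b\<in>B. sm (c b v) b) = v"
    by (rule findim_coordinates[OF V]) (rule that; assumption)
  note sub = findim_subspace[OF V]
  define v where "v = (\<Sum>b\<in>B. sm (diff_op P (\<lambda>X. c b (g X)) W) b)"
  have v: "v \<in> V \<and> (\<forall>l\<in>dual_space sm V. l v = diff_op P (\<lambda>X. l (g X)) W)"
  proof (intro conjI ballI)
    show "v \<in> V"
      unfolding v_def
      by (rule linear_on_sum[of sm V sm V "\<lambda>x. x", THEN conjunct1])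
         (use sub subsetD[OF B(2)] in \<open>simp_all add: linear_on_def\<close>)
    fix l assume l: "l \<in> dual_space sm V"
    have lin: "l (\<Sum>b\<in>B. sm (k b) b) = (\<Sum>b\<in>B. k b * l b)" for k
      using linear_on_combination[OF V dual_space_linear[OF l], of B "\<lambda>b. b" k] B(2) by auto
    have "l (g X) = (\<Sum>b\<in>B. l b * c b (g X))" for X
      using lin[of "\<lambda>b. c b (g X)"] B(4)[OF g[of X]] by (simp add: mult.commute)
    hence "diff_op P (\<lambda>X. l (g X)) W = (\<Sum>b\<in>B. l b * diff_op P (\<lambda>X. c b (g X)) W)"
      using B(3) e by (simp add: diff_op_fun_sum diff_op_fun_cmult holo_mult[OF holo_const])
    thus "l v = diff_op P (\<lambda>X. l (g X)) W"
      unfolding v_def lin by (simp add: mult.commute)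
  qed
  have "\<exists>!v. v \<in> V \<and> (\<forall>l\<in>dual_space sm V. l v = diff_op P (\<lambda>X. l (g X)) W)"
    using v by (rule ex1I) (use v in \<open>auto intro: dual_separates[OF V]\<close>)
  from theI'[OF this] show "diff_op_into sm V P g W \<in> V"
    and "l \<in> dual_space sm V \<Longrightarrow> l (diff_op_into sm V P g W) = diff_op P (\<lambda>X. l (g X)) W"
    unfolding diff_op_into_def by blast+
qed

text \<open>
  Reduces holomorphy and convergence in \<open>Hom(V, W)\<close> to scalar statements: as \<open>h = \<Sum> e\<^sub>b \<otimes> h(b)\<close>, a functional
  on \<open>Hom(V, W)\<close> depends linearly on the finitely many coordinates of the values \<open>h(b)\<close>.
\<close>

lemma dual_hom_expand:
  fixes s1 :: "complex \<Rightarrow> 'v::ab_group_add \<Rightarrow> 'v" and s2 :: "complex \<Rightarrow> 'w::ab_group_add \<Rightarrow> 'w"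
  assumes V: "findim_space s1 V" and W: "findim_space s2 W"
  obtains B and C :: "'w set" and e where "finite B" "finite C" "B \<subseteq> V" "\<And>c. c \<in> C \<Longrightarrow> e c \<in> dual_space s2 W"
    "\<And>l. l \<in> dual_space (fun_scale s2) (hom_space s1 V s2 W) \<Longrightarrow>
       \<exists>k. \<forall>h\<in>hom_space s1 V s2 W. l h = (\<Sum>b\<in>B. \<Sum>c\<in>C. e c (h b) * k b c)"
proof -
  interpret W: vector_space s2 using W by (simp add: findim_space_def)
  let ?H = "hom_space s1 V s2 W"
  obtain B e' where B: "finite B" "B \<subseteq> V" "\<And>b. b \<in> B \<Longrightarrow> e' b \<in> dual_space s1 V"
    "\<And>v. v \<in> V \<Longrightarrow> (\<Sum>b\<in>B. s1 (e' b v) b) = v"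
    by (rule findim_coordinates[OF V]) (rule that; assumption)
  obtain C e where C: "finite C" "C \<subseteq> W" "\<And>b. b \<in> C \<Longrightarrow> e b \<in> dual_space s2 W"
    "\<And>v. v \<in> W \<Longrightarrow> (\<Sum>b\<in>C. s2 (e b v) b) = v"
    by (rule findim_coordinates[OF W]) (rule that; assumption)
  have "\<exists>k. \<forall>h\<in>?H. l h = (\<Sum>b\<in>B. \<Sum>c\<in>C. e c (h b) * k b c)"
    if l: "l \<in> dual_space (fun_scale s2) ?H" for l
  proof (intro exI ballI)
    fix h assume h: "h \<in> ?H"
    have lin: "linear_on (fun_scale s2) ?H (*) UNIV l" by (rule dual_space_linear[OF l])
    have hb: "h b \<in> W" if "b \<in> B" for b using h that B(2) by (auto simp: hom_space_def linear_on_def)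
    note H = hom_space_zero[OF W, of s1 V] hom_space_add[OF W, of _ s1 V]
    have lin_tensor: "linear_on s2 W (*) UNIV (\<lambda>w. l (pure_tensor s2 (e' b) w))" if b: "b \<in> B" for b
      unfolding linear_on_def
    proof (intro conjI ballI allI)
      fix x y assume xy: "x \<in> W" "y \<in> W"
      have "pure_tensor s2 (e' b) (x + y) = pure_tensor s2 (e' b) x + pure_tensor s2 (e' b) y"
        by (simp add: pure_tensor_def fun_eq_iff W.scale_right_distrib)
      thus "l (pure_tensor s2 (e' b) (x + y)) = l (pure_tensor s2 (e' b) x) + l (pure_tensor s2 (e' b) y)"
        using lin pure_tensor_hom[OF W B(3)[OF b]] xy by (simp add: linear_on_def)
    next
      fix x c assume x: "x \<in> W"
      have "pure_tensor s2 (e' b) (s2 c x) = fun_scale s2 c (pure_tensor s2 (e' b) x)"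
        by (simp add: pure_tensor_def fun_scale_def fun_eq_iff mult.commute)
      thus "l (pure_tensor s2 (e' b) (s2 c x)) = c * l (pure_tensor s2 (e' b) x)"
        using lin pure_tensor_hom[OF W B(3)[OF b]] x by (simp add: linear_on_def)
    qed auto
    have "l h = l (\<Sum>b\<in>B. pure_tensor s2 (e' b) (h b))" by (subst (1) hom_expand[OF V W h B]) simp_all
    also have "\<dots> = (\<Sum>b\<in>B. l (pure_tensor s2 (e' b) (h b)))"
      using linear_on_sum[OF lin H, of B "\<lambda>b. pure_tensor s2 (e' b) (h b)"] pure_tensor_hom[OF W B(3) hb] by blast
    also have "\<dots> = (\<Sum>b\<in>B. \<Sum>c\<in>C. e c (h b) * l (pure_tensor s2 (e' b) c))"
    proof (rule sum.cong[OF refl])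
      fix b assume b: "b \<in> B"
      have "l (pure_tensor s2 (e' b) (h b)) = l (pure_tensor s2 (e' b) (\<Sum>c\<in>C. s2 (e c (h b)) c))"
        by (simp add: C(4)[OF hb[OF b]])
      also have "\<dots> = (\<Sum>c\<in>C. e c (h b) * l (pure_tensor s2 (e' b) c))"
        by (rule linear_on_combination[OF W lin_tensor[OF b]]) (use C(2) in auto)
      finally show "l (pure_tensor s2 (e' b) (h b)) = (\<Sum>c\<in>C. e c (h b) * l (pure_tensor s2 (e' b) c))" .
    qed
    finally show "l h = (\<Sum>b\<in>B. \<Sum>c\<in>C. e c (h b) * l (pure_tensor s2 (e' b) c))" .
  qed
  note ex = this
  show thesis
    by (rule that[of B C e]) (fact B(1) C(1) B(2) | erule C(3) ex)+
qed

section \<open>Quadratic forms and traces\<close>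

lemma matrix_inv_unique:
  fixes A :: "'a::semiring_1 ^ 'n::finite ^ 'n"
  assumes "A ** B = mat 1" "B ** A = mat 1" shows "matrix_inv A = B"
proof -
  have "invertible A" using assms unfolding invertible_def by blast
  from matrix_inv_mult(2)[OF this] show ?thesis
    by (metis assms(1) matrix_mul_assoc matrix_mul_lid matrix_mul_rid)
qed

lemma matrix_inv_inv_pos_def:
  fixes A :: "real ^ 'm::finite ^ 'm"
  assumes "pos_def A" shows "matrix_inv (matrix_inv (2 *\<^sub>R A)) = 2 *\<^sub>R A"
proof -
  have "invertible (2 *\<^sub>R A)"
    unfolding invertible_left_inverse matrix_left_invertible_ker
  proof (intro allI impI, rule ccontr)
    fix x assume x: "(2 *\<^sub>R A) *v x = 0" "x \<noteq> 0"
    have "2 *\<^sub>R (A *v x) = 0" using x(1) by (simp add: scaleR_matrix_vector_assoc)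
    hence "x \<bullet> (A *v x) = 0" by simp
    thus False using assms x(2) unfolding pos_def_def by (metis less_irrefl)
  qed
  from matrix_inv_mult[OF this] show ?thesis by (intro matrix_inv_unique)
qed

lemma trace_quad_expand:
  fixes N :: "complex ^ 'm::finite ^ 'm" and W :: "complex ^ 'n::finite ^ 'm" and K :: "complex ^ 'n ^ 'n"
  shows "trace (quad N W ** K) =
    (\<Sum>i\<in>UNIV. \<Sum>j\<in>UNIV. K $ j $ i * (\<Sum>p\<in>UNIV. \<Sum>q\<in>UNIV. N $ p $ q * (W $ p $ i * W $ q $ j)))"
proof -
  have "quad N W $ i $ j = (\<Sum>p\<in>UNIV. \<Sum>q\<in>UNIV. N $ p $ q * (W $ p $ i * W $ q $ j))" for i j
    unfolding quad_def matrix_mul_assoc[symmetric]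
    by (simp add: matrix_matrix_mult_def transpose_def sum_distrib_left mult_ac)
  thus ?thesis by (simp add: trace_def matrix_matrix_mult_def mult.commute)
qed

lemma quad_mult: "quad N (W ** A) = transpose A ** quad N W ** A"
  by (simp add: quad_def matrix_transpose_mul matrix_mul_assoc)

lemma entry_pairing_integral:
  "entry_pairing (\<chi> k j. c * of_int (R $ j $ k)) W = c * trace (map_matrix of_int R ** W)"
proof -
  have "entry_pairing (\<chi> k j. c * of_int (R $ j $ k)) W = (\<Sum>k\<in>UNIV. \<Sum>l\<in>UNIV. c * (of_int (R $ l $ k) * W $ k $ l))"
    by (simp add: entry_pairing_double_sum mult.assoc)
  also have "\<dots> = (\<Sum>l\<in>UNIV. \<Sum>k\<in>UNIV. c * (of_int (R $ l $ k) * W $ k $ l))" by (rule sum.swap)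
  also have "\<dots> = c * trace (map_matrix of_int R ** W)"
    by (simp add: trace_def matrix_matrix_mult_def sum_distrib_left)
  finally show ?thesis .
qed

section \<open>Taylor coefficients of a Jacobi form\<close>

locale jacobi_setting =
  fixes sm :: "complex \<Rightarrow> 'v::ab_group_add \<Rightarrow> 'v"
    and V :: "'v set"
    and \<rho> :: "complex ^ 'n::finite ^ 'n \<Rightarrow> 'v \<Rightarrow> 'v"
    and MM S :: "real ^ 'm::finite ^ 'm"
    and T :: "('m \<times> 'n) cpoly set"
    and f :: "(complex ^ 'n ^ 'n) \<times> (complex ^ 'n ^ 'm) \<Rightarrow> 'v"
  assumes rep: "rational_rep sm V \<rho>"
    and pos_def: "pos_def MM"
    and S: "S = matrix_inv (2 *\<^sub>R MM)"
    and irred: "irreducible_subspace T" and harmonic: "T \<subseteq> pluriharmonic S"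
    and f: "f \<in> jacobi_forms sm V \<rho> MM"
begin

lemma findim_V: "findim_space sm V"
  using rep by (simp add: rational_rep_def)

lemma findim_T: "findim_space pscale T"
  using irred by (rule irreducible_findim)

lemma inv_T: "invariant_subspace T"
  using irred by (simp add: irreducible_subspace_def)

lemma holomorphic_f: "holomorphic_into pair_scale sm V (siegel \<times> UNIV) f"
  using f unfolding jacobi_forms_def by blast

lemma f_in: "Z \<in> siegel \<Longrightarrow> f (Z, W) \<in> V"
  using holomorphic_f by (auto simp: holomorphic_into_def)

text \<open>
  The scalar components of \<open>f\<^sub>\<tau>\<close>.
\<close>

definition taylor :: "('v \<Rightarrow> complex) \<Rightarrow> ('m \<times> 'n) cpoly \<Rightarrow> complex ^ 'n ^ 'n \<Rightarrow> complex" where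
  "taylor l P Z = diff_op P (\<lambda>W. l (f (Z, W))) 0"

lemma entire_f:
  assumes "l \<in> dual_space sm V" "Z \<in> siegel"
  shows "entire (\<lambda>W. l (f (Z, W)))"
  using entire_slice[OF holo_symmetrize[OF holomorphic_f assms(1)], of Z] assms(2) siegel_subset_hull
  by (auto simp: symmetrize_siegel)

lemma taylor_differentiable:
  assumes "l \<in> dual_space sm V" "Z \<in> siegel"
  shows "\<exists>L. (taylor l P has_derivative L) (at Z within siegel) \<and> (\<forall>c v. L (mscale c v) = c * L v)"
proof -
  have "holo mscale siegel_hull (\<lambda>Z. diff_op P (\<lambda>W. l (f (symmetrize Z, W))) 0)"
    by (rule holo_fst_slice[OF holo_diff_op_snd[OF open_siegel_hull holo_symmetrize[OF holomorphic_f assms(1)]]])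
  then obtain L where L: "((\<lambda>Z. diff_op P (\<lambda>W. l (f (symmetrize Z, W))) 0) has_derivative L) (at Z)"
     "\<forall>c v. L (mscale c v) = c * L v"
    using assms(2) siegel_subset_hull unfolding holo_def by blast
  have "(taylor l P has_derivative L) (at Z within siegel)"
    by (rule has_derivative_transform[OF assms(2) _ has_derivative_at_withinI[OF L(1)]])
       (simp add: taylor_def symmetrize_siegel)
  with L(2) show ?thesis by blast
qed

lemma taylor_add: "taylor l (P + Q) Z = taylor l P Z + taylor l Q Z"
  by (simp add: taylor_def diff_op_add)

lemma taylor_pscale: "taylor l (pscale c P) Z = c * taylor l P Z"
  by (simp add: taylor_def diff_op_pscale)

lemma f_tau_in:
  assumes "Z \<in> siegel" "P \<in> T" shows "f_tau sm V T f Z P \<in> V"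
  using diff_op_into_props(1)[OF findim_V, of "\<lambda>W. f (Z, W)" P 0] entire_f f_in assms by (simp add: f_tau_def)

lemma dual_f_tau:
  assumes "Z \<in> siegel" "P \<in> T" "l \<in> dual_space sm V" shows "l (f_tau sm V T f Z P) = taylor l P Z"
  using diff_op_into_props(2)[OF findim_V, of "\<lambda>W. f (Z, W)" l P 0] entire_f f_in assms by (simp add: f_tau_def taylor_def)

text \<open>
  Both \<open>f\<^sub>\<tau>(Z)\<close> and its coefficients at the cusp are accessible only through their scalar components, which
  are visibly linear in the polynomial.
\<close>

lemma hom_from_functionals:
  assumes g: "\<And>P. P \<in> T \<Longrightarrow> g P \<in> V" "\<And>P. P \<notin> T \<Longrightarrow> g P = 0"
    and t: "\<And>l P. l \<in> dual_space sm V \<Longrightarrow> P \<in> T \<Longrightarrow> l (g P) = t l P"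
    and add: "\<And>l P Q. l \<in> dual_space sm V \<Longrightarrow> t l (P + Q) = t l P + t l Q"
    and scale: "\<And>l P c. l \<in> dual_space sm V \<Longrightarrow> t l (pscale c P) = c * t l P"
  shows "g \<in> hom_space pscale T sm V"
proof -
  note subT = findim_subspace[OF findim_T] and subV = findim_subspace[OF findim_V]
  have lin: "l (x + y) = l x + l y" "l (sm c x) = c * l x" if "l \<in> dual_space sm V" "x \<in> V" "y \<in> V" for l x y c
    using dual_space_linear[OF that(1)] that(2,3) by (simp_all add: linear_on_def)
  have "g (P + Q) = g P + g Q" if PQ: "P \<in> T" "Q \<in> T" for P Q
  proof (rule dual_separates[OF findim_V])
    fix l assume l: "l \<in> dual_space sm V"
    have "l (g (P + Q)) = t l P + t l Q" using PQ subT(2) by (simp add: t[OF l] add[OF l])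
    thus "l (g (P + Q)) = l (g P + g Q)"
      using lin(1)[OF l g(1)[OF PQ(1)] g(1)[OF PQ(2)]] by (simp add: t[OF l] PQ)
  qed (use PQ g(1) subT subV in auto)
  moreover have "g (pscale c P) = sm c (g P)" if "P \<in> T" for c P
  proof (rule dual_separates[OF findim_V])
    fix l assume l: "l \<in> dual_space sm V"
    have "l (g (pscale c P)) = c * t l P" using that subT(3) by (simp add: t[OF l] scale[OF l])
    thus "l (g (pscale c P)) = l (sm c (g P))"
      using lin(2)[OF l g(1)[OF that] subV(1)] by (simp add: t[OF l that])
  qed (use that g(1) subT subV in auto)
  ultimately show ?thesis using g by (auto simp: hom_space_def linear_on_def)
qed

lemma f_tau_hom:
  assumes "Z \<in> siegel" shows "f_tau sm V T f Z \<in> hom_space pscale T sm V"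
  by (rule hom_from_functionals[where t = "\<lambda>l P. taylor l P Z"])
     (use assms in \<open>simp_all add: f_tau_in dual_f_tau taylor_add taylor_pscale\<close>, simp add: f_tau_def)

lemma f_tau_holomorphic:
  "holomorphic_into mscale (fun_scale sm) (hom_space pscale T sm V) siegel (f_tau sm V T f)"
  unfolding holomorphic_into_def
proof (intro conjI ballI)
  let ?H = "hom_space pscale T sm V"
  fix l Z assume l: "l \<in> dual_space (fun_scale sm) ?H" and Z: "Z \<in> (siegel :: (complex ^ 'n ^ 'n) set)"
  obtain B and C :: "'v set" and e where B: "finite B" "finite C" "B \<subseteq> T" "\<And>c. c \<in> C \<Longrightarrow> e c \<in> dual_space sm V"
    "\<And>l. l \<in> dual_space (fun_scale sm) ?H \<Longrightarrow> \<exists>k. \<forall>h\<in>?H. l h = (\<Sum>b\<in>B. \<Sum>c\<in>C. e c (h b) * k b c)"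
    by (rule dual_hom_expand[OF findim_T findim_V]) (rule that; assumption)
  obtain k where k: "\<And>h. h \<in> ?H \<Longrightarrow> l h = (\<Sum>b\<in>B. \<Sum>c\<in>C. e c (h b) * k b c)"
    using B(5)[OF l] by blast
  define L where "L = (\<lambda>b c. SOME L. (taylor (e c) b has_derivative L) (at Z within siegel) \<and>
    (\<forall>x v. L (mscale x v) = x * L v))"
  have "(taylor (e c) b has_derivative L b c) (at Z within siegel) \<and> (\<forall>x v. L b c (mscale x v) = x * L b c v)"
    if "c \<in> C" for b c
    unfolding L_def by (rule someI_ex[OF taylor_differentiable[OF B(4)[OF that] Z]])
  hence L: "\<And>b c. c \<in> C \<Longrightarrow> (taylor (e c) b has_derivative L b c) (at Z within siegel)"
     "\<And>b c x v. c \<in> C \<Longrightarrow> L b c (mscale x v) = x * L b c v" by auto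
  have eq: "l (f_tau sm V T f Y) = (\<Sum>b\<in>B. \<Sum>c\<in>C. taylor (e c) b Y * k b c)" if Y: "Y \<in> siegel" for Y
    unfolding k[OF f_tau_hom[OF Y]]
    by (intro sum.cong refl arg_cong[of _ _ "\<lambda>x. x * _"] dual_f_tau[OF Y subsetD[OF B(3)] B(4)])
  have "((\<lambda>Y. \<Sum>b\<in>B. \<Sum>c\<in>C. taylor (e c) b Y * k b c) has_derivative (\<lambda>v. \<Sum>b\<in>B. \<Sum>c\<in>C. L b c v * k b c)) (at Z within siegel)"
    by (intro has_derivative_sum has_derivative_mult_left L)
  from has_derivative_transform[OF Z eq this]
  have "((\<lambda>Y. l (f_tau sm V T f Y)) has_derivative (\<lambda>v. \<Sum>b\<in>B. \<Sum>c\<in>C. L b c v * k b c)) (at Z within siegel)" .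
  moreover have "(\<Sum>b\<in>B. \<Sum>c\<in>C. L b c (mscale x v) * k b c) = x * (\<Sum>b\<in>B. \<Sum>c\<in>C. L b c v * k b c)" for x v
    by (simp add: L(2) sum_distrib_left mult.assoc)
  ultimately show "\<exists>L. ((\<lambda>Y. l (f_tau sm V T f Y)) has_derivative L) (at Z within siegel) \<and> (\<forall>c v. L (mscale c v) = c * L v)"
    by blast
qed (rule f_tau_hom)

end

section \<open>The transformation law\<close>

context jacobi_setting
begin

lemma \<rho>_linear: "invertible A \<Longrightarrow> linear_on sm V sm V (\<rho> A)"
  using rep unfolding rational_rep_def by blast

lemma \<rho>_inverse:
  assumes "invertible A" "v \<in> V" shows "\<rho> A (\<rho> (matrix_inv A) v) = v"
  using rep matrix_inv_mult[OF assms(1)] invertible_matrix_inv[OF assms(1)] assms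
  unfolding rational_rep_def by metis

text \<open>
  The slash action of \<open>(M, (0, 0, 0))\<close>, solved for \<open>f(M<Z>, W)\<close> by substituting \<open>W(CZ + D)\<close> for \<open>W\<close>. The
  trace in the automorphy factor is simplified by cyclic invariance.
\<close>

lemma jacobi_transform:
  assumes M: "M \<in> Gamma" and Z: "Z \<in> siegel"
  shows "f (moebius M Z, W) =
     sm (exp (2 * pi * \<i> * trace (quad (cmat MM) W ** (cmat (blkC M) ** transpose (autfac M Z)))))
       (\<rho> (autfac M Z) (f (Z, W ** autfac M Z)))"
proof -
  interpret vector_space sm using findim_V by (simp add: findim_space_def)
  define A Y where "A = autfac M Z" and "Y = matrix_inv A"
  have MS: "M \<in> Sp_real" using M by (simp add: Gamma_def)
  have A: "invertible A" using invertible_autfac[OF MS Z] by (simp add: A_def)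
  have AY: "A ** Y = mat 1" "Y ** A = mat 1" using matrix_inv_mult[OF A] by (simp_all add: Y_def)
  have "(M, 0, 0, 0) \<in> Gamma_J"
    using M by (auto simp: Gamma_J_def Heis_int_def Heis_real_def integral_mat_def transpose_def vec_eq_iff matrix_matrix_mult_def)
  hence "slash sm \<rho> MM f (M, 0, 0, 0) (Z, W ** A) = f (Z, W ** A)"
    using f Z unfolding jacobi_forms_def by blast
  moreover have "W ** A ** Y = W" by (simp add: AY flip: matrix_mul_assoc)
  moreover define q where "q = 2 * pi * \<i> * trace (quad (cmat MM) (W ** A) ** Y ** cmat (blkC M))"
  ultimately have *: "sm (exp (- q)) (\<rho> Y (f (moebius M Z, W))) = f (Z, W ** A)"
    by (simp add: slash_def Let_def A_def[symmetric] Y_def[symmetric] q_def trace_def)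
  have v: "f (moebius M Z, W) \<in> V" by (rule f_in[OF moebius_siegel[OF MS Z]])
  have Yv: "\<rho> Y (f (moebius M Z, W)) \<in> V"
    using \<rho>_linear[OF invertible_matrix_inv[OF A]] v by (simp add: linear_on_def Y_def)
  have "sm (exp q) (\<rho> A (f (Z, W ** A))) = sm (exp q) (sm (exp (- q)) (\<rho> A (\<rho> Y (f (moebius M Z, W)))))"
    unfolding *[symmetric] using \<rho>_linear[OF A] Yv by (simp add: linear_on_def)
  also have "\<dots> = f (moebius M Z, W)"
    by (simp add: Y_def \<rho>_inverse[OF A v] flip: exp_add)
  finally have "f (moebius M Z, W) = sm (exp q) (\<rho> A (f (Z, W ** A)))" ..
  moreover have "trace (quad (cmat MM) (W ** A) ** Y ** cmat (blkC M)) =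
      trace (quad (cmat MM) W ** (cmat (blkC M) ** transpose A))"
  proof -
    have "quad (cmat MM) (W ** A) ** Y ** cmat (blkC M) = transpose A ** (quad (cmat MM) W ** cmat (blkC M))"
      by (simp add: quad_mult AY flip: matrix_mul_assoc)
    thus ?thesis
      using trace_mul_sym[of "transpose A" "quad (cmat MM) W ** cmat (blkC M)"] by (simp add: matrix_mul_assoc)
  qed
  ultimately show ?thesis by (simp add: q_def A_def)
qed

lemma S_inv: "matrix_inv S = 2 *\<^sub>R MM"
  unfolding S by (rule matrix_inv_inv_pos_def[OF pos_def])

text \<open>
  The exponent \<open>2 \<pi> i \<^sup>tR\<close>, for which \<open>\<langle>freq R, W\<rangle> = 2 \<pi> i \<sigma>(RW)\<close>.
\<close>

definition freq :: "int ^ 'm ^ 'n \<Rightarrow> complex ^ 'n ^ 'm" where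
  "freq R = (\<chi> k j. 2 * pi * \<i> * of_int (R $ j $ k))"

lemma entry_pairing_freq: "entry_pairing (freq R) W = 2 * pi * \<i> * trace (map_matrix of_int R ** W)"
  unfolding freq_def by (rule entry_pairing_integral)

definition fourier_index :: "((real ^ 'n ^ 'n) \<times> (int ^ 'm ^ 'n)) set" where
  "fourier_index = {T. half_integral T \<and> pos_semidef T} \<times> UNIV"

definition fourier_coeff ::
  "(real ^ 'n ^ 'n \<Rightarrow> int ^ 'm ^ 'n \<Rightarrow> 'v) \<Rightarrow> ('v \<Rightarrow> complex) \<Rightarrow> complex ^ 'n ^ 'n \<Rightarrow>
    (real ^ 'n ^ 'n) \<times> (int ^ 'm ^ 'n) \<Rightarrow> complex" where
  "fourier_coeff c l Z = (\<lambda>(T, R). exp (2 * pi * \<i> * trace (cmat T ** Z)) * l (c T R))"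

text \<open>
  The Fourier expansion in the form in which it is used: for fixed \<open>Z\<close> and a functional \<open>l\<close>, the terms
  in \<open>T\<close> are absorbed into the coefficients of a series of exponentials in \<open>W\<close>.
\<close>

definition is_fourier :: "(real ^ 'n ^ 'n \<Rightarrow> int ^ 'm ^ 'n \<Rightarrow> 'v) \<Rightarrow> bool" where
  "is_fourier c \<longleftrightarrow> (\<forall>T R. c T R \<in> V) \<and> (\<forall>l\<in>dual_space sm V. \<forall>Z\<in>siegel.
     exp_series (fourier_coeff c l Z) (\<lambda>(T, R). freq R) fourier_index (\<lambda>W. l (f (Z, W))))"

lemma fourier: "\<exists>c. is_fourier c"
proof -
  from f obtain c :: "real ^ 'n ^ 'n \<Rightarrow> int ^ 'm ^ 'n \<Rightarrow> 'v" where c: "\<forall>T R. c T R \<in> V"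
    "\<forall>Z\<in>siegel. \<forall>W. has_sum_into sm V
           (\<lambda>(T, R). sm (exp (2 * pi * \<i> * trace (cmat T ** Z)) *
                             exp (2 * pi * \<i> * trace (map_matrix of_int R ** W))) (c T R))
           (f (Z, W)) ({T. half_integral T \<and> pos_semidef T} \<times> UNIV)"
    unfolding jacobi_forms_def by blast
  have "exp_series (fourier_coeff c l Z) (\<lambda>(T, R). freq R) fourier_index (\<lambda>W. l (f (Z, W)))"
    if l: "l \<in> dual_space sm V" and Z: "Z \<in> siegel" for l Z
    unfolding exp_series_def
  proof
    fix W
    have lin: "l (sm k v) = k * l v" if "v \<in> V" for k v
      using dual_space_linear[OF l] that by (simp add: linear_on_def)
    have "((\<lambda>x. l (case x of (T, R) \<Rightarrow> sm (exp (2 * pi * \<i> * trace (cmat T ** Z)) *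
               exp (2 * pi * \<i> * trace (map_matrix of_int R ** W))) (c T R))) has_sum l (f (Z, W))) fourier_index"
      using c(2) l Z unfolding has_sum_into_def fourier_index_def by blast
    moreover have "l (case x of (T, R) \<Rightarrow> sm (exp (2 * pi * \<i> * trace (cmat T ** Z)) *
               exp (2 * pi * \<i> * trace (map_matrix of_int R ** W))) (c T R)) =
        fourier_coeff c l Z x * exp (entry_pairing (case x of (T, R) \<Rightarrow> freq R) W)" for x
      using c(1) by (cases x) (simp add: lin entry_pairing_freq fourier_coeff_def)
    ultimately show "((\<lambda>x. fourier_coeff c l Z x * exp (entry_pairing (case x of (T, R) \<Rightarrow> freq R) W)) has_sum l (f (Z, W)))
             fourier_index"
      by simp
  qed
  with c(1) show ?thesis unfolding is_fourier_def by blast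
qed

text \<open>
  The exponential factor is removed by pluriharmonicity, and the substitution
  \<open>W \<mapsto> W(CZ + D)\<close> acts through \<open>\<tau>\<close>. The functional \<open>l\<close> is replaced by \<open>l \<circ> \<rho>(CZ + D)\<close> so that
  both steps deal with scalar functions.
\<close>

lemma f_tau_transform:
  assumes M: "M \<in> Gamma" and Z: "Z \<in> siegel" and P: "P \<in> T"
  shows "f_tau sm V T f (moebius M Z) P = \<rho> (autfac M Z) (f_tau sm V T f Z (tau (transpose (autfac M Z)) P))"
proof (rule dual_separates[OF findim_V])
  define A where "A = autfac M Z"
  have MS: "M \<in> Sp_real" using M by (simp add: Gamma_def)
  have A: "invertible A" using invertible_autfac[OF MS Z] by (simp add: A_def)
  have AP: "tau (transpose A) P \<in> T"
    using inv_T P invertible_transpose[OF A] by (simp add: invariant_subspace_def)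
  have MZ: "moebius M Z \<in> siegel" by (rule moebius_siegel[OF MS Z])
  note R = \<rho>_linear[OF A]
  note subV = findim_subspace[OF findim_V]
  show "f_tau sm V T f (moebius M Z) P \<in> V" by (rule f_tau_in[OF MZ P])
  show "\<rho> (autfac M Z) (f_tau sm V T f Z (tau (transpose (autfac M Z)) P)) \<in> V"
    using R f_tau_in[OF Z AP] by (simp add: linear_on_def A_def)
  fix l assume l: "l \<in> dual_space sm V"
  define l' where "l' = (\<lambda>v. if v \<in> V then l (\<rho> A v) else 0)"
  have l': "l' \<in> dual_space sm V"
    using dual_space_linear[OF l] R subV
    by (auto simp: l'_def dual_space_def hom_space_def linear_on_def)
  define g where "g = (\<lambda>W. l' (f (Z, W)))"
  define Q where "Q = (\<lambda>W. 2 * pi * \<i> * trace (quad (cmat MM) W ** (cmat (blkC M) ** transpose A)))"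
  have Q: "Q = (\<lambda>W. \<Sum>i\<in>UNIV. \<Sum>j\<in>UNIV. (pi * \<i> * (cmat (blkC M) ** transpose A) $ j $ i) *
      (\<Sum>p\<in>UNIV. \<Sum>q\<in>UNIV. complex_of_real (matrix_inv S $ p $ q) * (W $ p $ i * W $ q $ j)))"
    by (simp add: Q_def trace_quad_expand S_inv sum_distrib_left mult_ac)
  have eQ: "entire Q"
  proof -
    have "entire (\<lambda>W. W $ p $ i)" for p :: 'm and i :: 'n
      using entire_coord[of "(p, i)"] by (simp add: coord_def[abs_def])
    thus ?thesis unfolding Q by (intro holo_sum holo_mult holo_const)
  qed
  have lf: "l (f (moebius M Z, W)) = exp (Q W) * g (W ** A)" for W
  proof -
    have "\<rho> A (f (Z, W ** A)) \<in> V" using R f_in[OF Z] by (simp add: linear_on_def)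
    thus ?thesis
      using dual_space_linear[OF l] f_in[OF Z, of "W ** A"]
      by (simp add: jacobi_transform[OF M Z] linear_on_def Q_def g_def l'_def A_def)
  qed
  have eg: "entire g" unfolding g_def by (rule entire_f[OF l' Z])
  have "linear (\<lambda>W :: complex ^ 'n ^ 'm. W ** A)"
  proof (rule linearI)
    fix r and W :: "complex ^ 'n ^ 'm"
    show "(r *\<^sub>R W) ** A = r *\<^sub>R (W ** A)"
      unfolding vec_eq_iff matrix_matrix_mult_def
      by (simp only: vec_lambda_beta vector_scaleR_component mult_scaleR_left scaleR_sum_right) blast
  qed (rule matrix_add_distrib_right)
  hence "bounded_linear (\<lambda>W :: complex ^ 'n ^ 'm. W ** A)"
    by (simp only: linear_conv_bounded_linear)
  moreover have "mscale c W ** A = mscale c (W ** A)" for c and W :: "complex ^ 'n ^ 'm"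
    by (simp add: mscale_def matrix_matrix_mult_def vec_eq_iff sum_distrib_left mult.assoc)
  ultimately have egA: "entire (\<lambda>W. g (W ** A))"
    by (rule holo_inner[OF eg]) simp
  obtain c where "is_fourier c" using fourier by blast
  hence c: "exp_series (fourier_coeff c l' Z) (\<lambda>(T, R). freq R) fourier_index g"
    using l' Z unfolding is_fourier_def g_def by blast
  have "l (f_tau sm V T f (moebius M Z) P) = diff_op P (\<lambda>W. exp (Q W) * g (W ** A)) 0"
    by (simp add: dual_f_tau[OF MZ P l] taylor_def lf)
  also have "\<dots> = diff_op P (\<lambda>W. g (W ** A)) 0"
  proof (rule diff_op_exp_mult[OF egA eQ])
    fix h :: "complex ^ 'n ^ 'm \<Rightarrow> complex" assume h: "entire h"
    show "diff_op P (\<lambda>W. Q W * h W) 0 = 0"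
      unfolding Q by (rule diff_op_harmonic[OF h]) (use harmonic P in \<open>auto simp: pluriharmonic_def\<close>)
  qed
  also have "\<dots> = diff_op (tau (transpose A) P) g 0"
    by (rule diff_op_comp_right_mult[OF c])
  also have "\<dots> = l' (f_tau sm V T f Z (tau (transpose A) P))"
    by (simp add: dual_f_tau[OF Z AP l'] taylor_def g_def)
  also have "\<dots> = l (\<rho> A (f_tau sm V T f Z (tau (transpose A) P)))"
    by (simp add: l'_def f_tau_in[OF Z AP])
  finally show "l (f_tau sm V T f (moebius M Z) P) = l (\<rho> (autfac M Z) (f_tau sm V T f Z (tau (transpose (autfac M Z)) P)))"
    by (simp add: A_def)
qed

lemma f_tau_modular:
  assumes M: "M \<in> Gamma" and Z: "Z \<in> siegel"
  shows "f_tau sm V T f (moebius M Z) = tensor_rep pscale T sm V (tau_hat T) \<rho> (autfac M Z) (f_tau sm V T f Z)"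
proof -
  define A where "A = autfac M Z"
  have A: "invertible A" using invertible_autfac[OF _ Z] M by (simp add: A_def Gamma_def)
  have "linear_on pscale T pscale T (tau (transpose A))"
    using inv_T invertible_transpose[OF A] by (simp add: linear_on_def invariant_subspace_def tau_add tau_pscale)
  from tensor_rep_eq[where \<pi> = "tau_hat T" and \<rho> = \<rho> and g = A,
      OF findim_T findim_V tau_hat_eq[OF inv_T A] this \<rho>_linear[OF A] f_tau_hom[OF Z]]
  have "tensor_rep pscale T sm V (tau_hat T) \<rho> A (f_tau sm V T f Z) =
     (\<lambda>P. if P \<in> T then \<rho> A (f_tau sm V T f Z (tau (transpose A) P)) else 0)" .
  moreover have "f_tau sm V T f (moebius M Z) = \<dots>"
  proof
    fix P show "f_tau sm V T f (moebius M Z) P = (if P \<in> T then \<rho> A (f_tau sm V T f Z (tau (transpose A) P)) else 0)"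
      by (cases "P \<in> T") (simp_all add: f_tau_transform[OF M Z] A_def, simp add: f_tau_def)
  qed
  ultimately show ?thesis by (simp add: A_def)
qed

end

section \<open>The cusp condition\<close>

lemma siegel_nonempty: "(mat \<i> :: complex ^ 'n::finite ^ 'n) \<in> siegel"
proof -
  have "map_matrix Im (mat \<i> :: complex ^ 'n ^ 'n) = mat 1"
    by (simp add: vec_eq_iff mat_def)
  thus ?thesis by (simp add: siegel_def pos_def_def transpose_mat)
qed

lemma has_sum_finite_sum:
  fixes F :: "'i \<Rightarrow> 'x \<Rightarrow> complex"
  assumes "\<And>i. i \<in> I \<Longrightarrow> (F i has_sum s i) X"
  shows "((\<lambda>x. \<Sum>i\<in>I. F i x) has_sum (\<Sum>i\<in>I. s i)) X"
  using assms by (induction I rule: infinite_finite_induct) (auto intro: has_sum_add)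

lemma summable_on_slice:
  fixes F :: "'a \<times> 'b \<Rightarrow> complex"
  assumes "F summable_on (A \<times> B)" "a \<in> A"
  shows "(\<lambda>b. F (a, b)) summable_on B"
proof -
  have "F summable_on (Pair a ` B)"
    by (rule summable_on_subset_banach[OF assms(1)]) (use assms(2) in auto)
  thus ?thesis by (subst (asm) summable_on_reindex) (auto simp: inj_on_def o_def)
qed

lemma bij_half_integral_psd_one_dim:
  assumes "CARD('n::finite) = 1"
  shows "bij_betw (\<lambda>t. mat (real t)) (UNIV :: nat set) {T :: real ^ 'n ^ 'n. half_integral T \<and> pos_semidef T}"
proof -
  obtain i :: 'n where i: "UNIV = {i}" using assms card_1_singletonE by blast
  have all: "j = i" for j using i by blast
  have sum1: "(\<Sum>j\<in>UNIV. h j) = h i" for h :: "'n \<Rightarrow> real" by (subst i) simp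
  have form: "x \<bullet> (T *v x) = x $ i * (T $ i $ i * x $ i)" for x and T :: "real ^ 'n ^ 'n"
    by (simp only: inner_vec_def matrix_vector_mult_def vec_lambda_beta sum1 inner_real_def)
  have eqI: "T = T'" if "T $ i $ i = T' $ i $ i" for T T' :: "real ^ 'n ^ 'n"
  proof -
    have "T $ j $ k = T' $ j $ k" for j k unfolding all[of j] all[of k] by (rule that)
    thus ?thesis by (simp only: vec_eq_iff) blast
  qed
  have entry: "(mat r :: real ^ 'n ^ 'n) $ i $ i = r" for r by (simp add: mat_def)
  show ?thesis
  proof (rule bij_betwI')
    fix s t :: nat
    show "((mat (real s) :: real ^ 'n ^ 'n) = mat (real t)) = (s = t)"
      using entry[of "real s"] entry[of "real t"] by (metis of_nat_eq_iff)
    have "(mat (real t) :: real ^ 'n ^ 'n) $ j $ k \<in> \<int>" for j k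
      unfolding all[of j] all[of k] entry by simp
    moreover have "0 \<le> x $ i * (real t * x $ i)" for x :: "real ^ 'n"
      using mult_nonneg_nonneg[of "real t" "x $ i * x $ i"] by (simp add: mult_ac)
    ultimately show "(mat (real t) :: real ^ 'n ^ 'n) \<in> {T. half_integral T \<and> pos_semidef T}"
      by (simp add: half_integral_def pos_semidef_def transpose_mat form entry)
  next
    fix T :: "real ^ 'n ^ 'n" assume "T \<in> {T. half_integral T \<and> pos_semidef T}"
    hence T: "T $ i $ i \<in> \<int>" "(axis i 1 :: real ^ 'n) \<bullet> (T *v axis i 1) \<ge> 0"
      by (simp_all add: half_integral_def pos_semidef_def)
    have "T $ i $ i \<ge> 0" using T(2) unfolding form by (simp add: axis_def)
    with T(1) have "T $ i $ i \<in> \<nat>" by (simp add: Nats_altdef2)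
    then obtain t where "T $ i $ i = real t" by (rule Nats_cases)
    thus "\<exists>t\<in>UNIV. T = mat (real t)" using eqI[of T "mat (real t)"] entry[of "real t"] by auto
  qed
qed

context jacobi_setting
begin

text \<open>
  The coefficient \<open>a(t)(P) = \<Sum>\<^sub>R P(freq R) c(t, R)\<close> is defined through coordinates. Its series converges
  because it is, up to a nonzero factor, a slice of the absolutely convergent double series for \<open>f\<^sub>\<tau>\<close> at the
  point \<open>Z = i\<close>.
\<close>

lemma f_tau_cusp:
  assumes "CARD('n) = 1"
  shows "\<exists>a :: nat \<Rightarrow> ('m \<times> 'n) cpoly \<Rightarrow> 'v. (\<forall>t. a t \<in> hom_space pscale T sm V) \<and>
        (\<forall>Z\<in>siegel. has_sum_into (fun_scale sm) (hom_space pscale T sm V)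
           (\<lambda>t. fun_scale sm (exp (2 * pi * \<i> * of_nat t * trace Z)) (a t)) (f_tau sm V T f Z) UNIV)"
proof -
  interpret vector_space sm using findim_V by (simp add: findim_space_def)
  let ?H = "hom_space pscale T sm V"
  let ?X = "{T :: real ^ 'n ^ 'n. half_integral T \<and> pos_semidef T}"
  obtain c where "is_fourier c" using fourier by blast
  hence c: "c T R \<in> V"
    "\<And>l Z. l \<in> dual_space sm V \<Longrightarrow> Z \<in> siegel \<Longrightarrow>
       exp_series (fourier_coeff c l Z) (\<lambda>(T, R). freq R) fourier_index (\<lambda>W. l (f (Z, W)))" for T R
    unfolding is_fourier_def by blast+
  define q where "q = (\<lambda>(Z :: complex ^ 'n ^ 'n) (t::nat). exp (2 * pi * \<i> * of_nat t * trace Z) :: complex)"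
  define F where "F = (\<lambda>l P t R. poly_fun P (freq R) * l (c (mat (real t)) R) :: complex)"
  define I where "I = (\<lambda>l P t. \<Sum>\<^sub>\<infinity>R. F l P t R)"
  have bij: "bij_betw (\<lambda>t. mat (real t)) (UNIV :: nat set) ?X" by (rule bij_half_integral_psd_one_dim[OF assms])
  have tr: "exp (complex_of_real (2 * pi) * \<i> * trace (cmat (mat (real t)) ** Z)) = q Z t" for t and Z :: "complex ^ 'n ^ 'n"
  proof -
    have "cmat (mat (real t)) ** Z = mat (of_nat t) ** Z"
      by (intro arg_cong[of _ _ "\<lambda>A. A ** Z"]) (simp add: vec_eq_iff mat_def)
    moreover have "trace (mat (of_nat t) ** Z) = of_nat t * trace Z"
      by (simp add: trace_def matrix_matrix_mult_def mat_def sum_distrib_left if_distrib[of "\<lambda>x. x * _"] cong: if_cong)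
    ultimately show ?thesis by (simp add: q_def mult.assoc)
  qed
  have total: "((\<lambda>(t, R). q Z t * F l P t R) has_sum taylor l P Z) (UNIV \<times> UNIV)"
    if l: "l \<in> dual_space sm V" and Z: "Z \<in> siegel" for l Z P
  proof -
    have "((\<lambda>x. poly_fun P (case x of (T, R) \<Rightarrow> freq R) * fourier_coeff c l Z x) has_sum taylor l P Z) fourier_index"
      using has_sum_diff_op[OF c(2)[OF l Z], of P 0] unfolding taylor_def by (simp add: entry_pairing_def)
    moreover have "bij_betw (map_prod (\<lambda>t. mat (real t)) (\<lambda>R. R)) (UNIV \<times> UNIV) fourier_index"
      unfolding fourier_index_def by (intro bij_betw_map_prod bij) (simp add: bij_betw_def)
    ultimately have "((\<lambda>x. (\<lambda>x. poly_fun P (case x of (T, R) \<Rightarrow> freq R) * fourier_coeff c l Z x)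
        (map_prod (\<lambda>t. mat (real t)) (\<lambda>R. R) x)) has_sum taylor l P Z) (UNIV \<times> UNIV)"
      by (subst has_sum_reindex_bij_betw)
    thus ?thesis
      by (rule has_sum_cong[THEN iffD1, rotated]) (auto simp: F_def tr[simplified] fourier_coeff_def)
  qed
  have F_sum: "(F l P t has_sum I l P t) UNIV" if l: "l \<in> dual_space sm V" for l P t
  proof -
    have "(\<lambda>x. case x of (t, R) \<Rightarrow> q (mat \<i>) t * F l P t R) summable_on (UNIV \<times> UNIV)"
      using has_sum_imp_summable[OF total[OF l siegel_nonempty]] .
    from summable_on_slice[OF this, of t] have "(\<lambda>R. q (mat \<i>) t * F l P t R) summable_on UNIV" by simp
    hence "F l P t summable_on UNIV" by (subst (asm) summable_on_cmult_right') (simp_all add: q_def)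
    thus ?thesis by (simp add: I_def)
  qed
  have I_sum: "((\<lambda>t. q Z t * I l P t) has_sum taylor l P Z) UNIV"
    if l: "l \<in> dual_space sm V" and Z: "Z \<in> siegel" for l Z P
    by (rule has_sum_SigmaD[OF total[OF l Z]]) (simp add: has_sum_cmult_right[OF F_sum[OF l]])
  obtain B e where B: "finite B" "B \<subseteq> V" "\<And>b. b \<in> B \<Longrightarrow> e b \<in> dual_space sm V"
    "\<And>v. v \<in> V \<Longrightarrow> (\<Sum>b\<in>B. sm (e b v) b) = v"
    by (rule findim_coordinates[OF findim_V]) (rule that; assumption)
  define a where "a = (\<lambda>t P. if P \<in> T then \<Sum>b\<in>B. sm (I (e b) P t) b else 0)"
  have lin: "l (\<Sum>b\<in>B. sm (k b) b) = (\<Sum>b\<in>B. k b * l b)" if l: "l \<in> dual_space sm V" for l k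
    by (rule linear_on_combination[OF findim_V dual_space_linear[OF l]]) (use B(2) in auto)
  have la: "l (a t P) = I l P t" if l: "l \<in> dual_space sm V" and P: "P \<in> T" for l t P
  proof -
    have "((\<lambda>R. \<Sum>b\<in>B. F (e b) P t R * l b) has_sum (\<Sum>b\<in>B. I (e b) P t * l b)) UNIV"
      by (intro has_sum_finite_sum has_sum_cmult_left F_sum B)
    moreover have "(\<Sum>b\<in>B. F (e b) P t R * l b) = F l P t R" for R
      using lin[OF l, of "\<lambda>b. e b (c (mat (real t)) R)"] unfolding B(4)[OF c(1)]
      by (simp add: F_def sum_distrib_left mult.assoc)
    ultimately have "(F l P t has_sum l (a t P)) UNIV" using P by (simp add: a_def lin[OF l])
    thus ?thesis using F_sum[OF l] has_sum_unique by blast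
  qed
  have aH: "a t \<in> ?H" for t
  proof (rule hom_from_functionals[where t = "\<lambda>l P. I l P t"])
    show "a t P \<in> V" if "P \<in> T" for P
      unfolding a_def using that
      by (simp, intro linear_on_sum[of sm V sm V "\<lambda>x. x", THEN conjunct1])
         (use findim_subspace[OF findim_V] subsetD[OF B(2)] in \<open>simp_all add: linear_on_def\<close>)
    show "I l (P + Q) t = I l P t + I l Q t" if l: "l \<in> dual_space sm V" for l P Q
      using has_sum_add[OF F_sum[OF l, of P t] F_sum[OF l, of Q t]] F_sum[OF l, of "P + Q" t]
      by (auto simp: F_def distrib_right dest: has_sum_unique)
    show "I l (pscale k P) t = k * I l P t" if l: "l \<in> dual_space sm V" for l P k
      using has_sum_cmult_right[OF F_sum[OF l, of P t], of k] F_sum[OF l, of "pscale k P" t]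
      by (auto simp: F_def mult.assoc dest: has_sum_unique)
  qed (auto simp: la, simp add: a_def)
  have "has_sum_into (fun_scale sm) ?H (\<lambda>t. fun_scale sm (q Z t) (a t)) (f_tau sm V T f Z) UNIV"
    if Z: "Z \<in> siegel" for Z
    unfolding has_sum_into_def
  proof
    fix L assume L: "L \<in> dual_space (fun_scale sm) ?H"
    obtain B' and C :: "'v set" and e' where B': "finite B'" "finite C" "B' \<subseteq> T" "\<And>c. c \<in> C \<Longrightarrow> e' c \<in> dual_space sm V"
      "\<And>l. l \<in> dual_space (fun_scale sm) ?H \<Longrightarrow> \<exists>k. \<forall>h\<in>?H. l h = (\<Sum>b\<in>B'. \<Sum>c\<in>C. e' c (h b) * k b c)"
      by (rule dual_hom_expand[OF findim_T findim_V]) (rule that; assumption)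
    obtain k where k: "\<And>h. h \<in> ?H \<Longrightarrow> L h = (\<Sum>b\<in>B'. \<Sum>c\<in>C. e' c (h b) * k b c)"
      using B'(5)[OF L] by blast
    have "((\<lambda>t. \<Sum>b\<in>B'. \<Sum>c\<in>C. q Z t * I (e' c) b t * k b c) has_sum (\<Sum>b\<in>B'. \<Sum>c\<in>C. taylor (e' c) b Z * k b c)) UNIV"
      by (intro has_sum_finite_sum has_sum_cmult_left I_sum B' Z)
    moreover have "L (f_tau sm V T f Z) = (\<Sum>b\<in>B'. \<Sum>c\<in>C. taylor (e' c) b Z * k b c)"
      unfolding k[OF f_tau_hom[OF Z]]
      by (intro sum.cong refl arg_cong[of _ _ "\<lambda>x. x * _"] dual_f_tau[OF Z subsetD[OF B'(3)] B'(4)])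
    moreover have "L (fun_scale sm (q Z t) (a t)) = (\<Sum>b\<in>B'. \<Sum>c\<in>C. q Z t * I (e' c) b t * k b c)" for t
    proof -
      have "L (fun_scale sm (q Z t) (a t)) = q Z t * L (a t)"
        using dual_space_linear[OF L] aH by (simp add: linear_on_def)
      also have "L (a t) = (\<Sum>b\<in>B'. \<Sum>c\<in>C. I (e' c) b t * k b c)"
        unfolding k[OF aH]
        by (intro sum.cong refl arg_cong[of _ _ "\<lambda>x. x * _"] la[OF B'(4) subsetD[OF B'(3)]])
      finally show ?thesis by (simp add: sum_distrib_left mult.assoc)
    qed
    ultimately show "((\<lambda>t. L (fun_scale sm (q Z t) (a t))) has_sum L (f_tau sm V T f Z)) UNIV" by simp
  qed
  with aH show ?thesis unfolding q_def by blast
qed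

end

section \<open>The theorem\<close>

theorem mainTheorem1:
  fixes sm :: "complex \<Rightarrow> 'v::ab_group_add \<Rightarrow> 'v"
    and V\<rho> :: "'v set"
    and \<rho> :: "complex ^ 'n::finite ^ 'n \<Rightarrow> 'v \<Rightarrow> 'v"
    and MM S :: "real ^ 'm::finite ^ 'm"
    and V\<tau> :: "('m \<times> 'n) cpoly set"
    and f :: "(complex ^ 'n ^ 'n) \<times> (complex ^ 'n ^ 'm) \<Rightarrow> 'v"
  assumes "rational_rep sm V\<rho> \<rho>"
    and "pos_def MM" and "half_integral MM"
    and "S = matrix_inv (2 *\<^sub>R MM)"
    and "irreducible_subspace V\<tau>" and "V\<tau> \<subseteq> pluriharmonic S"
    and "f \<in> jacobi_forms sm V\<rho> \<rho> MM"
  shows "f_tau sm V\<rho> V\<tau> f \<in>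
    modular_forms (fun_scale sm) (hom_space pscale V\<tau> sm V\<rho>)
      (tensor_rep pscale V\<tau> sm V\<rho> (tau_hat V\<tau>) \<rho>)"
proof -
  interpret jacobi_setting sm V\<rho> \<rho> MM S V\<tau> f
    by standard (fact assms)+
  show ?thesis
    unfolding modular_forms_def
    using f_tau_holomorphic f_tau_modular f_tau_cusp by blast
qed

end
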